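(* Let $1<\alpha<2$, $T>0$, $\gamma\in\mathbb{R}$ with $\gamma\neq0$, $T\notin\Lambda$, and let $\xi\in(0,T)$ with $\xi\notin\mathrm P_1$. If $\varphi,\psi\in D(A^{2-\frac1\alpha})$ and $h\in D(A)$, then the inverse problem of finding a pair $\{u(t),f\}$ with $$\partial_t^\alpha u(t)+Au(t)=f,\ t\in(0,T),\qquad \gamma u(0)+u(T)=\varphi,\quad \partial_tu(T)=\psi,\qquad u(\xi)=h,$$ has a unique solution $\{u(t),f\}$, and this solution has the form $$u(t)=\sum_{n=1}^\infty\Big(\mathcal P_n^{(2)}(t)\varphi_n+\mathcal P_n^{(3)}(t)\psi_n+\triangle_n(t)f_n\Big)e_n,$$ $$f=\sum_{n=1}^\infty\Big(h_n-\mathcal P_n^{(2)}(\xi)\varphi_n-\mathcal P_n^{(3)}(\xi)\psi_n\Big)\frac{e_n}{\triangle_n(\xi)},$$ where $\varphi_n=(\varphi,e_n)$, $\psi_n=(\psi,e_n)$, $f_n=(f,e_n)$, $h_n=(h,e_n)$.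
   Context: $H$ is a separable (real) Hilbert space with scalar product $(\cdot,\cdot)$ and norm $\|\cdot\|$. $A$ is an unbounded positive self-adjoint operator in $H$ with compact inverse, having a complete orthonormal system of eigenfunctions $e_n$ with eigenvalues $0<\lambda_1\le\lambda_2\le\dots\to+\infty$, $Ae_n=\lambda_ne_n$. For real $\sigma$, $A^\sigma g=\sum_n\lambda_n^\sigma (g,e_n)e_n$, $D(A^\sigma)=\{g\in H:\sum_n\lambda_n^{2\sigma}(g,e_n)^2<\infty\}$, $\|g\|_{D(A^\sigma)}=\|A^\sigma g\|$. For $1<\alpha<2$ the Gerasimov–Caputo derivative is $\partial_t^\alpha y(t)=\frac{1}{\Gamma(2-\alpha)}\int_0^t(t-s)^{1-\alpha}y''(s)\,ds$. $E_{\rho,\mu}(z)=\sum_{k\ge0}z^k/\Gamma(\rho k+\mu)$ is the Mittag-Leffler function. A solution of the inverse problem is a pair $\{u(t),f\}$ with $u\in C([0,T];D(A))\cap C^1([0,T];H)$, $f\in H$, $\partial_t^\alpha u,\,Au\in C((0,T];H)$, satisfying the equation, the two nonlocal/final conditions and $u(\xi)=h$. $\rho(\eta)=\gamma E_{\alpha,1}(-\eta)+E_{\alpha,1}(-\eta)^2+\eta E_{\alpha,2}(-\eta)E_{\alpha,\alpha}(-\eta)$, $\eta>0$, and $\Lambda=\{(\eta/\lambda_n)^{1/\alpha}:\ n\ge1,\ \eta>0,\ \rho(\eta)=0\}$. $$\mathcal P_n^{(2)}(t)=\frac{E_{\alpha,1}(-\lambda_nT^\alpha)E_{\alpha,1}(-\lambda_nt^\alpha)+\lambda_nT^{\alpha-1}E_{\alpha,\alpha}(-\lambda_nT^\alpha)\,tE_{\alpha,2}(-\lambda_nt^\alpha)}{\rho(\lambda_nT^\alpha)},$$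 $$\mathcal P_n^{(3)}(t)=\frac{-TE_{\alpha,2}(-\lambda_nT^\alpha)E_{\alpha,1}(-\lambda_nt^\alpha)+(\gamma+E_{\alpha,1}(-\lambda_nT^\alpha))\,tE_{\alpha,2}(-\lambda_nt^\alpha)}{\rho(\lambda_nT^\alpha)},$$ $$\triangle_n(t)=t^\alpha E_{\alpha,\alpha+1}(-\lambda_nt^\alpha)-T^\alpha E_{\alpha,\alpha+1}(-\lambda_nT^\alpha)\mathcal P_n^{(2)}(t)-T^{\alpha-1}E_{\alpha,\alpha}(-\lambda_nT^\alpha)\mathcal P_n^{(3)}(t).$$ $\mathrm P_1=\{\xi>0:\ \triangle_n(\xi)=0\text{ for some }n\ge1\}$. *)

theory Defs
  imports "HOL-Analysis.Analysis"
begin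

section \<open>Unbounded operators in a Hilbert space\<close>

text \<open>
  An unbounded operator is given by its domain \<open>D\<close> and a total function \<open>A\<close>; the values of
  \<open>A\<close> outside \<open>D\<close> are irrelevant.
\<close>

definition linear_operator :: "'a::real_vector set \<Rightarrow> ('a \<Rightarrow> 'a) \<Rightarrow> bool" where
  "linear_operator D A \<longleftrightarrow> subspace D \<and>
     (\<forall>x\<in>D. \<forall>y\<in>D. A (x + y) = A x + A y) \<and> (\<forall>c. \<forall>x\<in>D. A (c *\<^sub>R x) = c *\<^sub>R A x)"

text \<open>
  The left-hand side of the equivalence says that \<open>(y, z)\<close> belongs to the graph of the adjoint
  of \<open>A\<close>, the right-hand side that it belongs to the graph of \<open>A\<close>.
\<close>

definition self_adjoint :: "'a::real_inner set \<Rightarrow> ('a \<Rightarrow> 'a) \<Rightarrow> bool" where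
  "self_adjoint D A \<longleftrightarrow> linear_operator D A \<and> closure D = UNIV \<and>
     (\<forall>y z. (\<forall>x\<in>D. inner (A x) y = inner x z) \<longleftrightarrow> (y \<in> D \<and> z = A y))"

definition positive_operator :: "'a::real_inner set \<Rightarrow> ('a \<Rightarrow> 'a) \<Rightarrow> bool" where
  "positive_operator D A \<longleftrightarrow> (\<forall>x\<in>D. x \<noteq> 0 \<longrightarrow> 0 < inner (A x) x)"

definition unbounded_operator :: "'a::real_normed_vector set \<Rightarrow> ('a \<Rightarrow> 'a) \<Rightarrow> bool" where
  "unbounded_operator D A \<longleftrightarrow> \<not> (\<exists>C. \<forall>x\<in>D. norm (A x) \<le> C * norm x)"

definition has_compact_inverse :: "'a::real_normed_vector set \<Rightarrow> ('a \<Rightarrow> 'a) \<Rightarrow> bool" where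
  "has_compact_inverse D A \<longleftrightarrow>
     bij_betw A D UNIV \<and> compact (closure (inv_into D A ` cball 0 1))"

definition complete_orthonormal :: "(nat \<Rightarrow> 'a::real_inner) \<Rightarrow> bool" where
  "complete_orthonormal e \<longleftrightarrow>
     (\<forall>m n. inner (e m) (e n) = (if m = n then 1 else 0)) \<and> closure (span (range e)) = UNIV"

text \<open>Eigenvalues and eigenvectors are indexed from 0 instead of 1.\<close>

definition eigensystem ::
    "'a::real_inner set \<Rightarrow> ('a \<Rightarrow> 'a) \<Rightarrow> (nat \<Rightarrow> 'a) \<Rightarrow> (nat \<Rightarrow> real) \<Rightarrow> bool" where
  "eigensystem D A e lam \<longleftrightarrow> complete_orthonormal e \<and>
     (\<forall>n. e n \<in> D \<and> A (e n) = lam n *\<^sub>R e n) \<and>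
     0 < lam 0 \<and> mono lam \<and> filterlim lam at_top sequentially"

text \<open>The domain of the power \<open>A\<^sup>\<sigma>\<close>.\<close>

definition power_domain ::
    "(nat \<Rightarrow> 'a::real_inner) \<Rightarrow> (nat \<Rightarrow> real) \<Rightarrow> real \<Rightarrow> 'a set" where
  "power_domain e lam \<sigma> = {g. summable (\<lambda>n. lam n powr (2 * \<sigma>) * (inner g (e n))\<^sup>2)}"


section \<open>The Gerasimov--Caputo derivative of order between 1 and 2\<close>

definition second_deriv :: "(real \<Rightarrow> 'a::real_normed_vector) \<Rightarrow> real \<Rightarrow> 'a" where
  "second_deriv y s = vector_derivative (\<lambda>r. vector_derivative y (at r)) (at s)"

text \<open>
  The integral below is a Bochner integral. The second derivative is the ordinary one, in the
  norm of the space, and has to exist at every point of the open interval \<open>(0, t)\<close>;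
  \<open>caputo_exists\<close> says that the right-hand side of the definition of \<open>caputo_deriv\<close> is meaningful.
\<close>

definition caputo_exists ::
    "real \<Rightarrow> (real \<Rightarrow> 'a::{banach, second_countable_topology}) \<Rightarrow> real \<Rightarrow> bool" where
  "caputo_exists \<alpha> y t \<longleftrightarrow>
     (\<forall>s\<in>{0<..<t}. y differentiable (at s) \<and>
        (\<lambda>r. vector_derivative y (at r)) differentiable (at s)) \<and>
     set_integrable lborel {0<..<t} (\<lambda>s. (t - s) powr (1 - \<alpha>) *\<^sub>R second_deriv y s)"

definition caputo_deriv ::
    "real \<Rightarrow> (real \<Rightarrow> 'a::{banach, second_countable_topology}) \<Rightarrow> real \<Rightarrow> 'a" where
  "caputo_deriv \<alpha> y t =
     (1 / Gamma (2 - \<alpha>)) *\<^sub>R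
       (LINT s:{0<..<t}|lborel. (t - s) powr (1 - \<alpha>) *\<^sub>R second_deriv y s)"


section \<open>The inverse problem\<close>

definition C1_on_closed_interval ::
    "real \<Rightarrow> real \<Rightarrow> (real \<Rightarrow> 'a::real_normed_vector) \<Rightarrow> bool" where
  "C1_on_closed_interval a b u \<longleftrightarrow>
     (\<forall>t\<in>{a..b}. u differentiable (at t within {a..b})) \<and>
     continuous_on {a..b} (\<lambda>t. vector_derivative u (at t within {a..b}))"

text \<open>
  Since \<open>D\<close> carries the norm \<open>\<lambda>g. norm (A g)\<close>, the first two conjuncts say that \<open>u\<close> is a
  continuous function from \<open>[0, T]\<close> to \<open>D\<close>. Values of \<open>u\<close> outside \<open>[0, T]\<close> play no role.
\<close>

definition is_solution ::
    "'a::{real_inner, banach, second_countable_topology} set \<Rightarrow> ('a \<Rightarrow> 'a) \<Rightarrow> real \<Rightarrow> real \<Rightarrow>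
     real \<Rightarrow> real \<Rightarrow> 'a \<Rightarrow> 'a \<Rightarrow> 'a \<Rightarrow> (real \<Rightarrow> 'a) \<Rightarrow> 'a \<Rightarrow> bool" where
  "is_solution D A \<alpha> T \<gamma> \<xi> \<phi> \<psi> h u f \<longleftrightarrow>
     (\<forall>t\<in>{0..T}. u t \<in> D) \<and>
     continuous_on {0..T} (\<lambda>t. A (u t)) \<and>
     C1_on_closed_interval 0 T u \<and>
     (\<forall>t\<in>{0<..T}. caputo_exists \<alpha> u t) \<and>
     continuous_on {0<..T} (caputo_deriv \<alpha> u) \<and>
     continuous_on {0<..T} (\<lambda>t. A (u t)) \<and>
     (\<forall>t\<in>{0<..<T}. caputo_deriv \<alpha> u t + A (u t) = f) \<and>
     \<gamma> *\<^sub>R u 0 + u T = \<phi> \<and>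
     vector_derivative u (at T within {0..T}) = \<psi> \<and>
     u \<xi> = h"


section \<open>The functions in the solution formula\<close>

definition mittag_leffler :: "real \<Rightarrow> real \<Rightarrow> real \<Rightarrow> real" where
  "mittag_leffler \<rho> \<mu> z = (\<Sum>k. z ^ k / Gamma (\<rho> * real k + \<mu>))"

definition rho :: "real \<Rightarrow> real \<Rightarrow> real \<Rightarrow> real" where
  "rho \<alpha> \<gamma> \<eta> =
     \<gamma> * mittag_leffler \<alpha> 1 (-\<eta>) + (mittag_leffler \<alpha> 1 (-\<eta>))\<^sup>2
     + \<eta> * mittag_leffler \<alpha> 2 (-\<eta>) * mittag_leffler \<alpha> \<alpha> (-\<eta>)"

definition Lambda_set :: "real \<Rightarrow> real \<Rightarrow> (nat \<Rightarrow> real) \<Rightarrow> real set" where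
  "Lambda_set \<alpha> \<gamma> lam = {(\<eta> / lam n) powr (1 / \<alpha>) | n \<eta>. \<eta> > 0 \<and> rho \<alpha> \<gamma> \<eta> = 0}"

text \<open>
  The functions \<open>\<P>\<^sub>n\<^sup>(\<^sup>2\<^sup>)\<close>, \<open>\<P>\<^sub>n\<^sup>(\<^sup>3\<^sup>)\<close> and \<open>\<triangle>\<^sub>n\<close> depend on \<open>n\<close> only through the eigenvalue
  \<open>\<lambda>\<^sub>n\<close>, here the argument \<open>l\<close>.
\<close>

definition P2 :: "real \<Rightarrow> real \<Rightarrow> real \<Rightarrow> real \<Rightarrow> real \<Rightarrow> real" where
  "P2 \<alpha> \<gamma> T l t =
     (mittag_leffler \<alpha> 1 (- l * T powr \<alpha>) * mittag_leffler \<alpha> 1 (- l * t powr \<alpha>)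
      + l * T powr (\<alpha> - 1) * mittag_leffler \<alpha> \<alpha> (- l * T powr \<alpha>)
        * (t * mittag_leffler \<alpha> 2 (- l * t powr \<alpha>)))
     / rho \<alpha> \<gamma> (l * T powr \<alpha>)"

definition P3 :: "real \<Rightarrow> real \<Rightarrow> real \<Rightarrow> real \<Rightarrow> real \<Rightarrow> real" where
  "P3 \<alpha> \<gamma> T l t =
     (- T * mittag_leffler \<alpha> 2 (- l * T powr \<alpha>) * mittag_leffler \<alpha> 1 (- l * t powr \<alpha>)
      + (\<gamma> + mittag_leffler \<alpha> 1 (- l * T powr \<alpha>))
        * (t * mittag_leffler \<alpha> 2 (- l * t powr \<alpha>)))
     / rho \<alpha> \<gamma> (l * T powr \<alpha>)"

definition Tri :: "real \<Rightarrow> real \<Rightarrow> real \<Rightarrow> real \<Rightarrow> real \<Rightarrow> real" where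
  "Tri \<alpha> \<gamma> T l t =
     t powr \<alpha> * mittag_leffler \<alpha> (\<alpha> + 1) (- l * t powr \<alpha>)
     - T powr \<alpha> * mittag_leffler \<alpha> (\<alpha> + 1) (- l * T powr \<alpha>) * P2 \<alpha> \<gamma> T l t
     - T powr (\<alpha> - 1) * mittag_leffler \<alpha> \<alpha> (- l * T powr \<alpha>) * P3 \<alpha> \<gamma> T l t"

definition P1_set :: "real \<Rightarrow> real \<Rightarrow> real \<Rightarrow> (nat \<Rightarrow> real) \<Rightarrow> real set" where
  "P1_set \<alpha> \<gamma> T lam = {\<xi>. \<xi> > 0 \<and> (\<exists>n. Tri \<alpha> \<gamma> T (lam n) \<xi> = 0)}"

end

theory Submission
  imports Defs "HOL-Complex_Analysis.Complex_Analysis"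
begin

text \<open>
  Projecting on \<open>e n\<close> turns the problem into a scalar equation \<open>\<partial>\<^sup>\<alpha>y + \<lambda>y = f\<close> with two nonlocal
  conditions. Every solution of the scalar equation is a combination of three Mittag-Leffler
  functions: integrate the equation against the adjoint solution \<open>(t - s)\<^sup>\<alpha>\<^sup>-\<^sup>1E\<^sub>\<alpha>\<^sub>,\<^sub>\<alpha>(-\<lambda>(t - s)\<^sup>\<alpha>)\<close>,
  exchange the two integrations and integrate by parts. The two conditions then form a linear
  system with determinant \<open>\<rho>(\<lambda>T\<^sup>\<alpha>)\<close>, and \<open>u(\<xi>) = h\<close> determines the coefficient of \<open>f\<close> because
  \<open>\<triangle>\<^sub>n(\<xi>) \<noteq> 0\<close>.

  For existence the coefficients have to be controlled as \<open>\<lambda> \<rightarrow> \<infinity>\<close>. Everything follows from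
  \<open>E\<^sub>\<alpha>\<^sub>,\<^sub>\<mu>(-x) = O(1/x)\<close> for every real \<open>\<mu>\<close> and the recurrence
  \<open>E\<^sub>\<alpha>\<^sub>,\<^sub>\<mu>(-x) = 1/\<Gamma>(\<mu>) - xE\<^sub>\<alpha>\<^sub>,\<^sub>\<mu>\<^sub>+\<^sub>\<alpha>(-x)\<close>: they give \<open>xE\<^sub>\<alpha>\<^sub>,\<^sub>1(-x) \<rightarrow> 1/\<Gamma>(1 - \<alpha>) \<noteq> 0\<close> and
  \<open>E\<^sub>\<alpha>\<^sub>,\<^sub>\<alpha>(-x) = O(1/x\<^sup>2)\<close>, hence \<open>\<lambda>\<rho>(\<lambda>T\<^sup>\<alpha>)\<close> tends to a nonzero multiple of \<open>\<gamma>\<close> and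
  \<open>\<lambda>\<triangle>\<^sub>n(\<xi>) \<rightarrow> 1\<close>. The decay itself comes from
  \<open>E\<^sub>\<alpha>\<^sub>,\<^sub>\<mu>(-x) = (1/2\<pi>i) \<integral> e\<^sup>s s\<^sup>\<alpha>\<^sup>-\<^sup>\<mu> / (s\<^sup>\<alpha> + x) ds\<close> along two rays at angles \<open>\<plusminus>\<theta>\<close> with
  \<open>\<pi>/2 < \<theta> < \<pi>/\<alpha>\<close>, on which no pole is passed and \<open>\<bar>s\<^sup>\<alpha> + x\<bar> \<ge> x sin(\<alpha>\<theta>)\<close>.
\<close>

subsection \<open>Integrals along rays in the complex plane\<close>

text \<open>Complex powers are cut along the negative axis, so every contour is a ray that starts at
  some c > 0 and stays in a convex open region free of the cut; a primitive exists there, and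
  contours are compared through its values. The lower half of Hankel's contour mirrors the upper
  one, so the full integral over 2 \<pi> i is the imaginary part of the upper half over \<pi>. That
  imaginary part does not depend on c, which may therefore tend to 0 (Gamma integral), be large
  (convergence of a geometric series) or be 1 (estimates uniform in x). The exponent 2 - 1/\<alpha>
  arises at t = 0: \<rho>(\<lambda>T^\<alpha>) is of exact order 1/\<lambda>, so \<psi>_n enters
  y'(0) with a factor \<lambda>, whereas t E_{\<alpha>,2}(-\<lambda>t^\<alpha>) is bounded uniformly
  in t only by a multiple of \<lambda>^(-1/\<alpha>). Continuity of A u up to t = 0 then rests on
  square summability of \<lambda>^(2 - 1/\<alpha>) \<psi>_n.\<close>

lemma ray_integral_limit:
  fixes F \<Phi> :: "complex \<Rightarrow> complex"
  assumes prim: "\<And>r. r \<ge> 0 \<Longrightarrow> (\<Phi> has_field_derivative F (a + of_real r * u)) (at (a + of_real r * u))"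
    and int: "set_integrable lborel {0..} (\<lambda>r. F (a + of_real r * u) * u)"
  shows "((\<lambda>R. \<Phi> (a + of_real R * u) - \<Phi> a) \<longlongrightarrow>
      (LBINT r:{0..}. F (a + of_real r * u) * u)) at_top"
proof -
  let ?g = "\<lambda>r. F (a + of_real r * u) * u"
  have L1: "((\<lambda>R. LBINT r. indicator {..R} r *\<^sub>R (indicator {0..} r *\<^sub>R ?g r)) \<longlongrightarrow>
      (LBINT r. indicator {0..} r *\<^sub>R ?g r)) at_top"
    by (rule tendsto_integral_at_top) (use int in \<open>auto simp: set_integrable_def\<close>)
  have L2: "(LBINT r. indicator {..R} r *\<^sub>R (indicator {0..} r *\<^sub>R ?g r))
      = \<Phi> (a + of_real R * u) - \<Phi> a" if "R \<ge> 0" for R :: real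
  proof -
    have "((\<lambda>r. \<Phi> (a + of_real r * u)) has_vector_derivative ?g r) (at r within {0..R})"
      if "r \<in> {0..R}" for r
    proof -
      have "((\<lambda>r. a + of_real r * u) has_vector_derivative u) (at r within {0..R})"
        by (auto intro!: derivative_eq_intros has_vector_derivative_of_real
            simp: has_vector_derivative_def scaleR_conv_of_real)
      moreover have "(\<Phi> has_field_derivative F (a + of_real r * u)) (at (a + of_real r * u))"
        using that by (intro prim) auto
      ultimately show ?thesis
        using field_vector_diff_chain_within[of "\<lambda>r. a + of_real r * u" u r "{0..R}" \<Phi> "F (a + of_real r * u)"]
        by (simp add: o_def has_field_derivative_at_within mult.commute)
    qed
    then have ftc: "(?g has_integral (\<Phi> (a + of_real R * u) - \<Phi> (a + of_real 0 * u))) {0..R}"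
      using that by (intro fundamental_theorem_of_calculus) auto
    have int': "set_integrable lborel {0..R} ?g"
      by (rule set_integrable_subset[OF int]) auto
    have "(LBINT r:{0..R}. ?g r) = \<Phi> (a + of_real R * u) - \<Phi> a"
      unfolding set_borel_integral_eq_integral(2)[OF int'] integral_unique[OF ftc] by simp
    moreover have "indicator {..R} r *\<^sub>R (indicator {0..} r *\<^sub>R ?g r) = indicator {0..R} r *\<^sub>R ?g r" for r
      by (auto simp: indicator_def)
    ultimately show ?thesis by (simp only: set_lebesgue_integral_def)
  qed
  show ?thesis
    unfolding set_lebesgue_integral_def
    by (rule Lim_transform_eventually[OF L1 eventually_mono[OF eventually_ge_at_top[of 0] L2]])
qed

text \<open>Along each ray the integral up to R is an increment of the primitive. Subtracting leaves
  the increment between the two starting points and the one between the two far ends; the latter is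
  at most \<open>B R\<close> times the length of the segment joining them.\<close>

lemma ray_integral_diff:
  fixes F \<Phi> :: "complex \<Rightarrow> complex"
  assumes "convex Q"
    and prim: "\<And>s. s \<in> Q \<Longrightarrow> (\<Phi> has_field_derivative F s) (at s)"
    and p: "\<And>r. r \<ge> 0 \<Longrightarrow> p + of_real r * v \<in> Q"
    and q: "\<And>r. r \<ge> 0 \<Longrightarrow> q + of_real r * w \<in> Q"
    and intp: "set_integrable lborel {0..} (\<lambda>r. F (p + of_real r * v) * v)"
    and intq: "set_integrable lborel {0..} (\<lambda>r. F (q + of_real r * w) * w)"
    and bound: "\<And>R s. R \<ge> 0 \<Longrightarrow> s \<in> closed_segment (p + of_real R * v) (q + of_real R * w)
        \<Longrightarrow> norm (F s) \<le> B R"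
    and decay: "((\<lambda>R. B R * norm ((p + of_real R * v) - (q + of_real R * w))) \<longlongrightarrow> 0) at_top"
  shows "(LBINT r:{0..}. F (p + of_real r * v) * v)
         - (LBINT r:{0..}. F (q + of_real r * w) * w) = \<Phi> q - \<Phi> p"
proof -
  have 0: "((\<lambda>R. \<Phi> (p + of_real R * v) - \<Phi> (q + of_real R * w)) \<longlongrightarrow> 0) at_top"
  proof (rule Lim_null_comparison[OF _ decay])
    show "\<forall>\<^sub>F R in at_top. norm (\<Phi> (p + of_real R * v) - \<Phi> (q + of_real R * w))
        \<le> B R * norm ((p + of_real R * v) - (q + of_real R * w))"
    proof (rule eventually_mono[OF eventually_ge_at_top[of 0]])
      fix R :: real assume R: "0 \<le> R"
      have sub: "closed_segment (p + of_real R * v) (q + of_real R * w) \<subseteq> Q"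
        using p[OF R] q[OF R] \<open>convex Q\<close> by (simp add: closed_segment_subset)
      show "norm (\<Phi> (p + of_real R * v) - \<Phi> (q + of_real R * w))
        \<le> B R * norm ((p + of_real R * v) - (q + of_real R * w))"
        by (rule field_differentiable_bound[OF convex_closed_segment, where f = \<Phi> and f' = F])
          (use sub bound[OF R] prim in \<open>auto intro: has_field_derivative_at_within\<close>)
    qed
  qed
  have "((\<lambda>R. (\<Phi> (p + of_real R * v) - \<Phi> p) - (\<Phi> (q + of_real R * w) - \<Phi> q)
        - (\<Phi> (p + of_real R * v) - \<Phi> (q + of_real R * w))) \<longlongrightarrow>
      (LBINT r:{0..}. F (p + of_real r * v) * v)
         - (LBINT r:{0..}. F (q + of_real r * w) * w) - 0) at_top"
    by (intro tendsto_diff ray_integral_limit prim 0 p q intp intq)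
  then have "((\<lambda>R::real. \<Phi> q - \<Phi> p) \<longlongrightarrow>
      (LBINT r:{0..}. F (p + of_real r * v) * v)
         - (LBINT r:{0..}. F (q + of_real r * w) * w)) at_top"
    by simp
  then show ?thesis
    using tendsto_unique[OF _ _ tendsto_const] trivial_limit_at_top_linorder by metis
qed

section \<open>Elementary bounds and passage to the limit in ray integrals\<close>

lemma powr_le_exp_linear:
  fixes b \<epsilon> :: real
  assumes "\<epsilon> > 0"
  obtains K where "K > 0" "\<And>x. x \<ge> 0 \<Longrightarrow> (1 + x) powr b \<le> K * exp (\<epsilon> * x)"
proof (cases "b > 0")
  case False
  have "(1 + x) powr b \<le> 1 * exp (\<epsilon> * x)" if "x \<ge> 0" for x
  proof -
    have "(1 + x) powr b \<le> (1 + x) powr 0"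
      using False that by (intro powr_mono) auto
    also have "\<dots> \<le> exp (\<epsilon> * x)" using that assms by simp
    finally show ?thesis by simp
  qed
  then show ?thesis using that[of 1] by simp
next
  case True
  \<comment> \<open>\<open>M\<close> makes M * (\<epsilon> / b) at least 1, so 1 + x <= M * (1 +
    (\<epsilon> / b) * x); after 1 + y <= exp y, the b-th power has exactly the exponent \<epsilon>
    * x.\<close>
  define M where "M = max 1 (b / \<epsilon>)"
  have M: "M \<ge> 1" "M * (\<epsilon> / b) \<ge> 1"
    using True assms by (auto simp: M_def field_simps max_def)
  have "(1 + x) powr b \<le> M powr b * exp (\<epsilon> * x)" if x: "x \<ge> 0" for x
  proof -
    have "1 + x \<le> M * (1 + \<epsilon> / b * x)"
      using mult_right_mono[OF M(2) x] M(1) by (simp add: algebra_simps)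
    also have "\<dots> \<le> M * exp (\<epsilon> / b * x)"
      using M(1) by (intro mult_left_mono exp_ge_add_one_self) auto
    finally have "(1 + x) powr b \<le> (M * exp (\<epsilon> / b * x)) powr b"
      using True x by (intro powr_mono2) auto
    also have "\<dots> = M powr b * exp (\<epsilon> * x)"
      using True M(1) by (simp add: powr_mult exp_powr_real)
    finally show ?thesis .
  qed
  then show ?thesis using that[of "M powr b"] M(1) by simp
qed

text \<open>The bound is uniform over exponents of either sign: for x >= 1 the worst one is A, for x
  < 1 it is -A, and the other factor is at least 1 in either case.\<close>

lemma powr_le_of_between:
  fixes x m M a A :: real
  assumes "0 < m" "m \<le> 1" "m \<le> x" "x \<le> M" "1 \<le> M" "\<bar>a\<bar> \<le> A"
  shows "x powr a \<le> m powr (-A) * M powr A"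
proof (cases "x \<ge> 1")
  case True
  have "x powr a \<le> x powr A" using True assms by (intro powr_mono) auto
  also have "\<dots> \<le> M powr A" using True assms by (intro powr_mono2) auto
  also have "\<dots> \<le> m powr (-A) * M powr A"
  proof -
    have "1 \<le> m powr (-A)" using assms powr_mono'[of "-A" 0 m] by auto
    then show ?thesis using mult_right_mono[of 1 "m powr (-A)" "M powr A"] by simp
  qed
  finally show ?thesis .
next
  case False
  have "x powr a \<le> x powr (-A)" using False assms by (intro powr_mono') auto
  also have "\<dots> \<le> m powr (-A)" using False assms by (intro powr_mono2') auto
  also have "\<dots> \<le> m powr (-A) * M powr A"
  proof -
    have "1 \<le> M powr A" using assms by (intro ge_one_powr_ge_zero) auto
    then show ?thesis using mult_left_mono[of 1 "M powr A" "m powr (-A)"] by simp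
  qed
  finally show ?thesis .
qed

lemma set_integrable_exp_neg:
  fixes k K :: real
  assumes "k > 0"
  shows "set_integrable lborel {0..} (\<lambda>r. K * exp (- k * r))"
proof -
  have "(\<lambda>r. exp (- k * r)) absolutely_integrable_on {0..}"
    using integrable_on_exp_minus_to_infinity[OF assms, of 0]
    by (intro nonnegative_absolutely_integrable_1) auto
  then have "set_integrable lborel {0..} (\<lambda>r. exp (- k * r))"
    unfolding absolutely_integrable_on_def[symmetric] set_integrable_def
    by (subst (asm) integrable_completion) (auto)
  then show ?thesis by simp
qed

lemma set_integrable_of_exp_bound:
  fixes f :: "real \<Rightarrow> complex"
  assumes "k > 0" "continuous_on {0..} f" "\<And>r. r \<ge> 0 \<Longrightarrow> norm (f r) \<le> K * exp (- k * r)"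
  shows "set_integrable lborel {0..} f"
  by (rule set_integrable_bound[OF set_integrable_exp_neg[OF assms(1), of K]])
    (use assms in \<open>auto simp: set_borel_measurable_def intro!: borel_measurable_continuous_on_indicator intro: order_trans[OF _ abs_ge_self]\<close>)

text \<open>Lets the vertex c = 1 / Suc n run into the branch point 0. The bound is uniform in c, so
  dominated convergence applies and only pointwise convergence of the integrand is left.\<close>

lemma ray_integral_tendsto:
  fixes F :: "complex \<Rightarrow> complex"
  assumes "k > 0"
    and bound: "\<And>c r. 0 < c \<Longrightarrow> c \<le> 1 \<Longrightarrow> r \<ge> 0 \<Longrightarrow> norm (F (of_real c + of_real r * w)) \<le> K * exp (- k * r)"
    and cont: "\<And>c. 0 < c \<Longrightarrow> c \<le> 1 \<Longrightarrow> continuous_on {0..} (\<lambda>r. F (of_real c + of_real r * w))"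
    and lim: "\<And>r. r \<ge> 0 \<Longrightarrow> (\<lambda>n. F (of_real (1 / Suc n) + of_real r * w)) \<longlonglongrightarrow> F (of_real r * w)"
  shows "(\<lambda>n. LBINT r:{0..}. F (of_real (1 / Suc n) + of_real r * w) * w)
      \<longlonglongrightarrow> (LBINT r:{0..}. F (of_real r * w) * w)"
proof -
  have le1: "1 / real (Suc n) \<le> 1" "1 / real (Suc n) > 0" for n by auto
  have m: "(\<lambda>r. indicator {0..} r *\<^sub>R (F (of_real (1 / Suc n) + of_real r * w) * w)) \<in> borel_measurable lborel" for n
    using cont[OF le1(2) le1(1), of n]
    by (auto intro!: borel_measurable_continuous_on_indicator continuous_intros)
  have l: "(\<lambda>n. indicator {0..} r *\<^sub>R (F (of_real (1 / Suc n) + of_real r * w) * w))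
      \<longlonglongrightarrow> indicator {0..} r *\<^sub>R (F (of_real r * w) * w)" for r
  proof (cases "r \<ge> 0")
    case True
    then show ?thesis using lim[OF True] by (intro tendsto_intros)
  qed auto
  show ?thesis
    unfolding set_lebesgue_integral_def
  proof (rule integral_dominated_convergence)
    show "(\<lambda>r. indicator {0..} r *\<^sub>R (F (of_real r * w) * w)) \<in> borel_measurable lborel"
      by (rule borel_measurable_LIMSEQ_metric[OF m l])
    show "integrable lborel (\<lambda>r. indicator {0..} r *\<^sub>R ((K * norm w) * exp (- k * r)))"
      using set_integrable_exp_neg[OF \<open>k > 0\<close>, of "K * norm w"] by (simp add: set_integrable_def)
    show "AE r in lborel. norm (indicator {0..} r *\<^sub>R (F (of_real (1 / Suc n) + of_real r * w) * w))
        \<le> indicator {0..} r *\<^sub>R ((K * norm w) * exp (- k * r))" for n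
    proof (rule AE_I2)
      fix r :: real
      show "norm (indicator {0..} r *\<^sub>R (F (of_real (1 / Suc n) + of_real r * w) * w))
        \<le> indicator {0..} r *\<^sub>R ((K * norm w) * exp (- k * r))"
      proof (cases "r \<ge> 0")
        case True
        then show ?thesis
          using mult_right_mono[OF bound[OF le1(2) le1(1) True, of n] norm_ge_zero[of w]]
          by (simp add: norm_mult mult_ac)
      qed auto
    qed
  qed (use m l in auto)
qed

text \<open>The vertex r = 0 of the limiting ray lies on the branch cut, so the limit there is taken
  along positive numbers, where the complex power is the real one.\<close>

lemma tendsto_shifted_powr_at_0:
  fixes b :: real and g :: "complex \<Rightarrow> complex"
  assumes "b > 0" "isCont g 0"
  shows "(\<lambda>n. g (of_real (1 / Suc n)) * (of_real (1 / Suc n) :: complex) powr of_real b) \<longlonglongrightarrow> 0"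
proof -
  define x where "x n = 1 / real (Suc n)" for n
  have x: "x n > 0" for n by (simp add: x_def)
  have 0: "x \<longlonglongrightarrow> 0"
    using LIMSEQ_inverse_real_of_nat by (simp add: x_def[abs_def] inverse_eq_divide)
  have "(\<lambda>n. x n powr b) \<longlonglongrightarrow> 0 powr b"
    using 0 assms x by (intro tendsto_powr' tendsto_const) (auto intro: always_eventually less_imp_le)
  then have "(\<lambda>n. of_real (x n powr b) :: complex) \<longlonglongrightarrow> of_real (0 powr b)"
    by (rule tendsto_of_real)
  moreover have "(\<lambda>n. g (of_real (x n))) \<longlonglongrightarrow> g (of_real 0)"
    using assms(2) tendsto_of_real[OF 0] by (intro isCont_tendsto_compose[where g = g]) auto
  ultimately have "(\<lambda>n. g (of_real (x n)) * of_real (x n powr b)) \<longlonglongrightarrow> g (of_real 0) * of_real (0 powr b)"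
    by (intro tendsto_mult)
  moreover have "(of_real (x n) :: complex) powr of_real b = of_real (x n powr b)" for n
    using x[of n] by (intro powr_of_real) auto
  ultimately show ?thesis by (simp add: x_def)
qed

lemma holomorphic_open_convex_primitive:
  fixes F :: "complex \<Rightarrow> complex"
  assumes "convex S" "open S" "F holomorphic_on S"
  obtains \<Phi> where "\<And>s. s \<in> S \<Longrightarrow> (\<Phi> has_field_derivative F s) (at s)"
proof -
  obtain g where g: "\<And>s. s \<in> S \<Longrightarrow> (g has_field_derivative F s) (at s within S)"
    using holomorphic_convex_primitive'[OF assms] by blast
  show ?thesis
  proof (rule that[of g])
    show "(g has_field_derivative F s) (at s)" if "s \<in> S" for s
      using g[OF that] at_within_open[OF that \<open>open S\<close>] by simp
  qed
qed

text \<open>The path of Euler's integral can be turned inside the right half-plane, where the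
  integrand has a primitive, once its vertex is moved to some c > 0; a > 1 makes the integrand tend
  to 0 at the origin, so c can go to 0 afterwards.\<close>

lemma Gamma_integral_rotated:
  fixes a :: real and w :: complex
  assumes "a > 1" "Re w > 0"
  shows "(LBINT r:{0..}. exp (- (of_real r * w)) * (of_real r * w) powr of_real (a - 1) * w) = of_real (Gamma a)"
proof -
  define F :: "complex \<Rightarrow> complex" where "F s = exp (- s) * s powr of_real (a - 1)" for s
  \<comment> \<open>A rate of decay common to the direction w, the direction 1 and all directions
    between them; half of it is spent on the power of s.\<close>
  define k where "k = min 1 (Re w)"
  define N where "N = 2 + norm w"
  have k: "k > 0" "k \<le> 1" "k \<le> Re w" using assms by (auto simp: k_def)
  obtain K0 where K0: "K0 > 0" "\<And>x. x \<ge> 0 \<Longrightarrow> (1 + x) powr (a - 1) \<le> K0 * exp (k / 2 * x)"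
    using powr_le_exp_linear[of "k / 2" "a - 1"] k by auto
  define K where "K = N powr (a - 1) * K0"
  have Fb: "norm (F (of_real c + of_real r * v)) \<le> K * exp (- (k / 2) * r)"
    if "0 < c" "c \<le> 1" "r \<ge> 0" "Re v \<ge> k" "norm v \<le> 1 + norm w" for c r v
  proof -
    let ?s = "of_real c + of_real r * v"
    have "norm ?s \<le> c + r * norm v"
      using norm_triangle_ineq[of "of_real c" "of_real r * v"] that by (simp add: norm_mult)
    also have "\<dots> \<le> 1 + r * (1 + norm w)" using that by (intro add_mono mult_left_mono) auto
    also have "\<dots> \<le> N * (1 + r)" using that by (simp add: N_def algebra_simps)
    finally have "norm ?s powr (a - 1) \<le> (N * (1 + r)) powr (a - 1)"
      using assms by (intro powr_mono2) auto
    also have "\<dots> = N powr (a - 1) * (1 + r) powr (a - 1)"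
      using that by (simp add: powr_mult N_def)
    also have "\<dots> \<le> N powr (a - 1) * (K0 * exp (k / 2 * r))"
      using K0(2)[of r] that by (intro mult_left_mono) auto
    finally have 1: "norm ?s powr (a - 1) \<le> K * exp (k / 2 * r)" by (simp add: K_def)
    have "Re (- ?s) \<le> - k * r" using that mult_left_mono[of k "Re v" r] by (simp add: mult.commute)
    then have "norm (exp (- ?s)) \<le> exp (- k * r)" by (simp only: norm_exp_eq_Re exp_le_cancel_iff)
    then have "norm (exp (- ?s)) * norm ?s powr (a - 1) \<le> exp (- k * r) * (K * exp (k / 2 * r))"
      using 1 by (intro mult_mono) auto
    also have "\<dots> = K * exp (- (k / 2) * r)"
      by (simp add: mult.left_commute exp_add[symmetric] field_simps)
    finally show ?thesis
      by (simp add: F_def norm_mult norm_powr_real_powr' del: of_real_diff)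
  qed
  have np: "s \<notin> \<real>\<^sub>\<le>\<^sub>0" if "Re s > 0" for s :: complex using that by (auto simp: complex_nonpos_Reals_iff)
  have Re_pos: "Re (of_real c + of_real r * v) > 0" if "c > 0" "r \<ge> 0" "Re v > 0" for c r v
    using that by (simp add: add_pos_nonneg)
  have "F holomorphic_on {s. Re s > 0}"
    unfolding F_def by (intro holomorphic_intros) (use np in auto)
  from holomorphic_open_convex_primitive[OF convex_halfspace_Re_gt open_halfspace_Re_gt this]
  obtain \<Phi> where \<Phi>: "\<And>s. s \<in> {s. Re s > 0} \<Longrightarrow> (\<Phi> has_field_derivative F s) (at s)" by blast
  have cont: "continuous_on {0..} (\<lambda>r. F (of_real c + of_real r * v))" if "c > 0" "Re v > 0" for c v
    unfolding F_def by (intro continuous_intros) (use np Re_pos that assms in \<open>auto\<close>)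
  have int: "set_integrable lborel {0..} (\<lambda>r. F (of_real c + of_real r * v) * v)"
    if "0 < c" "c \<le> 1" "Re v \<ge> k" "norm v \<le> 1 + norm w" for c v
  proof (rule set_integrable_of_exp_bound[of "k / 2" _ "K * norm v"])
    show "norm (F (of_real c + of_real r * v) * v) \<le> K * norm v * exp (- (k / 2) * r)" if "r \<ge> 0" for r
      using mult_right_mono[OF Fb[of c r v] norm_ge_zero[of v]] \<open>0 < c\<close> \<open>c \<le> 1\<close> \<open>Re v \<ge> k\<close> \<open>norm v \<le> 1 + norm w\<close> that
      by (simp add: norm_mult mult_ac)
  qed (use that k cont in \<open>auto intro!: continuous_intros\<close>)
  have eq: "(LBINT r:{0..}. F (of_real c + of_real r * w) * w) =
      (LBINT r:{0..}. F (of_real c + of_real r * 1) * 1)" if c: "0 < c" "c \<le> 1" for c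
  proof -
    have "(LBINT r:{0..}. F (of_real c + of_real r * w) * w) -
      (LBINT r:{0..}. F (of_real c + of_real r * 1) * 1) = \<Phi> c - \<Phi> c"
    proof (rule ray_integral_diff[where Q = "{s. Re s > 0}" and B = "\<lambda>R. K * exp (- (k / 2) * R)"])
      fix R :: real and s :: complex
      assume R: "R \<ge> 0" and "s \<in> closed_segment (of_real c + of_real R * w) (of_real c + of_real R * 1)"
      then obtain u where u: "0 \<le> u" "u \<le> 1"
        "s = (1 - u) *\<^sub>R (of_real c + of_real R * w) + u *\<^sub>R (of_real c + of_real R * 1)"
        by (auto simp: in_segment)
      \<comment> \<open>A point of the segment joining the two rays lies on a ray from c in an
        intermediate direction, so \<open>Fb\<close> covers it too.\<close>
      have s: "s = of_real c + of_real R * ((1 - u) *\<^sub>R w + of_real u)"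
        unfolding u(3) by (simp add: scaleR_conv_of_real algebra_simps)
      have 1: "k \<le> Re ((1 - u) *\<^sub>R w + of_real u)"
        using u k convex_bound_le[of "-Re w" "-k" "-1" "1-u" u] by simp
      have "norm ((1 - u) *\<^sub>R w + of_real u) \<le> (1 - u) * norm w + u"
        using norm_triangle_ineq[of "(1 - u) *\<^sub>R w" "of_real u"] u by simp
      also have "\<dots> \<le> 1 + norm w" using u mult_right_mono[of "1 - u" 1 "norm w"] by auto
      finally show "norm (F s) \<le> K * exp (- (k / 2) * R)"
        unfolding s by (intro Fb c R 1)
    next
      have "((\<lambda>R. K * norm (w - 1) * (R * exp (- (k / 2) * R))) \<longlongrightarrow> 0) at_top"
        using k by real_asymp
      then show "((\<lambda>R. K * exp (- (k / 2) * R) *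
          norm (of_real c + of_real R * w - (of_real c + of_real R * 1))) \<longlongrightarrow> 0) at_top"
      proof (rule Lim_transform_eventually)
        show "\<forall>\<^sub>F R in at_top. K * norm (w - 1) * (R * exp (- (k / 2) * R)) =
          K * exp (- (k / 2) * R) * norm (of_real c + of_real R * w - (of_real c + of_real R * 1))"
          using eventually_ge_at_top[of 0]
        proof eventually_elim
          case (elim R)
          have "of_real c + of_real R * w - (of_real c + of_real R * 1) = of_real R * (w - 1)"
            by (simp add: algebra_simps)
          then show ?case using elim by (simp add: norm_mult mult_ac del: add_diff_cancel_left)
        qed
      qed
    qed (use c assms k \<Phi> in \<open>auto simp: convex_halfspace_Re_gt intro!: int int[where v = 1, simplified] Re_pos[simplified]\<close>)
    then show ?thesis by simp
  qed
  have lim: "(\<lambda>n. LBINT r:{0..}. F (of_real (1 / Suc n) + of_real r * v) * v)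
      \<longlonglongrightarrow> (LBINT r:{0..}. F (of_real r * v) * v)"
    if v: "Re v \<ge> k" "norm v \<le> 1 + norm w" for v
  proof (rule ray_integral_tendsto[of "k/2" _ _ K])
    fix r :: real assume r: "r \<ge> 0"
    show "(\<lambda>n. F (of_real (1 / Suc n) + of_real r * v)) \<longlonglongrightarrow> F (of_real r * v)"
    proof (cases "r = 0")
      case True
      show ?thesis using tendsto_shifted_powr_at_0[of "a - 1" "\<lambda>s. exp (- s)"] True assms
        by (auto simp: F_def)
    next
      case False
      then have *: "Re (of_real r * v) > 0" using r v k by auto
      have "isCont F (of_real r * v)"
        unfolding F_def using np[OF *] by (intro continuous_intros) auto
      moreover have "(\<lambda>n. of_real (1 / Suc n) + of_real r * v) \<longlonglongrightarrow> of_real 0 + of_real r * v"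
        by (intro tendsto_intros) (use LIMSEQ_inverse_real_of_nat in \<open>simp add: inverse_eq_divide\<close>)
      ultimately show ?thesis by (intro isCont_tendsto_compose[of "of_real r * v" F]) auto
    qed
  qed (use k v in \<open>auto intro!: Fb[simplified] cont\<close>)
  have "(LBINT r:{0..}. F (of_real r * w) * w) = (LBINT r:{0..}. F (of_real r * 1) * 1)"
  proof (rule LIMSEQ_unique[OF lim])
    have "(\<lambda>n. LBINT r:{0..}. F (of_real (1 / Suc n) + of_real r * w) * w) =
       (\<lambda>n. LBINT r:{0..}. F (of_real (1 / Suc n) + of_real r * 1) * 1)"
      by (rule ext, rule eq) auto
    then show "(\<lambda>n. LBINT r:{0..}. F (of_real (1 / Suc n) + of_real r * w) * w)
      \<longlonglongrightarrow> (LBINT r:{0..}. F (of_real r * 1) * 1)"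
      using lim[of 1] k by simp
  qed (use k in auto)
  also have "\<dots> = of_real (Gamma a)"
  proof -
    have g: "((\<lambda>t. t powr (a - 1) / exp t) has_integral Gamma a) {0..}"
      using assms by (intro Gamma_integral_real) auto
    then have "(\<lambda>t. t powr (a - 1) / exp t) absolutely_integrable_on {0..}"
      by (intro nonnegative_absolutely_integrable_1) auto
    then have si: "set_integrable lborel {0..} (\<lambda>t. t powr (a - 1) / exp t)"
      unfolding set_integrable_def by (subst (asm) integrable_completion) auto
    have "(LBINT t:{0..}. t powr (a - 1) / exp t) = Gamma a"
      using set_borel_integral_eq_integral(2)[OF si] g by (simp add: integral_unique)
    moreover have "(LBINT r:{0..}. F (of_real r * 1) * 1) = (LBINT r:{0..}. of_real (r powr (a - 1) / exp r))"
    proof (rule set_lebesgue_integral_cong)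
      show "\<forall>r. r \<in> {0..} \<longrightarrow> F (of_real r * 1) * 1 = of_real (r powr (a - 1) / exp r)"
      proof (intro allI impI)
        fix r :: real assume "r \<in> {0..}"
        then have "(of_real r :: complex) powr of_real (a - 1) = of_real (r powr (a - 1))"
          by (intro powr_of_real) auto
        then show "F (of_real r * 1) * 1 = of_real (r powr (a - 1) / exp r)"
          by (simp add: F_def exp_minus exp_of_real divide_inverse del: of_real_diff)
      qed
    qed simp
    moreover have "(LBINT r:{0..}. (of_real (r powr (a - 1) / exp r) :: complex)) = of_real (LBINT r:{0..}. r powr (a - 1) / exp r)"
      by (rule set_integral_complex_of_real)
    ultimately show ?thesis by simp
  qed
  finally show ?thesis by (simp add: F_def)
qed

subsection \<open>Hankel's formula for the reciprocal Gamma function\<close>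

lemma Im_primitive_const:
  fixes F \<Phi> :: "complex \<Rightarrow> complex"
  assumes "c1 \<le> c2" "\<And>t. c1 \<le> t \<Longrightarrow> t \<le> c2 \<Longrightarrow> (\<Phi> has_field_derivative F (of_real t)) (at (of_real t))"
    and "\<And>t. c1 \<le> t \<Longrightarrow> t \<le> c2 \<Longrightarrow> F (of_real t) \<in> \<real>"
  shows "Im (\<Phi> (of_real c2)) = Im (\<Phi> (of_real c1))"
proof -
  have "((\<lambda>t. Im (\<Phi> (of_real t))) has_vector_derivative 0) (at t within {c1..c2})" if "t \<in> {c1..c2}" for t
  proof -
    have "((\<lambda>t. \<Phi> (of_real t)) has_vector_derivative F (of_real t)) (at t within {c1..c2})"
      using has_vector_derivative_real_field[of \<Phi> "F (of_real t)" t] assms(2)[of t] that by auto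
    then have "((\<lambda>t. Im (\<Phi> (of_real t))) has_vector_derivative Im (F (of_real t))) (at t within {c1..c2})"
      using bounded_linear.has_vector_derivative[OF bounded_linear_Im] by blast
    then show ?thesis using assms(3)[of t] that complex_is_Real_iff by auto
  qed
  then show ?thesis
    using has_vector_derivative_zero_constant[of "{c1..c2}" "\<lambda>t. Im (\<Phi> (of_real t))"] assms(1)
    by (metis atLeastAtMost_iff convex_real_interval(5) order_refl)
qed

text \<open>The two integrals differ by the integral of F over the real interval from c1 to c2,
  which is real because F is. The segment joining the far ends keeps the length c2 - c1, so
  exponential decay removes it.\<close>

lemma Im_ray_integral_shift:
  fixes F :: "complex \<Rightarrow> complex"
  assumes Q: "convex Q" "open Q" and F: "F holomorphic_on Q"
    and c: "0 < c1" "c1 \<le> c2" and k: "k > 0"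
    and sub: "\<And>c r. c1 \<le> c \<Longrightarrow> c \<le> c2 \<Longrightarrow> r \<ge> 0 \<Longrightarrow> of_real c + of_real r * w \<in> Q"
    and bound: "\<And>c r. c1 \<le> c \<Longrightarrow> c \<le> c2 \<Longrightarrow> r \<ge> 0 \<Longrightarrow> norm (F (of_real c + of_real r * w)) \<le> K * exp (- k * r)"
    and real: "\<And>t. t > 0 \<Longrightarrow> F (of_real t) \<in> \<real>"
  shows "Im (LBINT r:{0..}. F (of_real c1 + of_real r * w) * w)
       = Im (LBINT r:{0..}. F (of_real c2 + of_real r * w) * w)"
proof -
  obtain \<Phi> where \<Phi>: "\<And>s. s \<in> Q \<Longrightarrow> (\<Phi> has_field_derivative F s) (at s)"
    using holomorphic_open_convex_primitive[OF Q F] by blast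
  have int: "set_integrable lborel {0..} (\<lambda>r. F (of_real c + of_real r * w) * w)"
    if "c1 \<le> c" "c \<le> c2" for c
  proof (rule set_integrable_of_exp_bound[OF k, of _ "K * norm w"])
    have "continuous_on {0..} (\<lambda>r. F (of_real c + of_real r * w))"
      by (rule continuous_on_compose2[OF holomorphic_on_imp_continuous_on[OF F]])
        (use sub that in \<open>auto intro!: continuous_intros\<close>)
    then show "continuous_on {0..} (\<lambda>r. F (of_real c + of_real r * w) * w)"
      by (intro continuous_intros)
    show "norm (F (of_real c + of_real r * w) * w) \<le> K * norm w * exp (- k * r)" if "r \<ge> 0" for r
      using mult_right_mono[OF bound[OF \<open>c1 \<le> c\<close> \<open>c \<le> c2\<close> that] norm_ge_zero[of w]]
      by (simp add: norm_mult mult_ac)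
  qed
  have "(LBINT r:{0..}. F (of_real c1 + of_real r * w) * w)
       - (LBINT r:{0..}. F (of_real c2 + of_real r * w) * w) = \<Phi> (of_real c2) - \<Phi> (of_real c1)"
  proof (rule ray_integral_diff[where Q = Q and B = "\<lambda>R. K * exp (- k * R)"])
    fix R :: real and s :: complex
    assume R: "R \<ge> 0" and "s \<in> closed_segment (of_real c1 + of_real R * w) (of_real c2 + of_real R * w)"
    then obtain u where u: "0 \<le> u" "u \<le> 1"
        "s = (1 - u) *\<^sub>R (of_real c1 + of_real R * w) + u *\<^sub>R (of_real c2 + of_real R * w)"
      by (auto simp: in_segment)
    have s: "s = of_real (c1 + u * (c2 - c1)) + of_real R * w"
      unfolding u(3) by (simp add: scaleR_conv_of_real algebra_simps)
    have "c1 + u * (c2 - c1) \<ge> c1" using u c by simp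
    moreover have "c1 + u * (c2 - c1) \<le> c2"
      using u c mult_right_mono[of u 1 "c2 - c1"] by simp
    ultimately show "norm (F s) \<le> K * exp (- k * R)"
      unfolding s using R by (intro bound)
  next
    show "((\<lambda>R. K * exp (- k * R) * norm (of_real c1 + of_real R * w - (of_real c2 + of_real R * w))) \<longlongrightarrow> 0) at_top"
      using k by (simp add: mult.assoc) real_asymp
  qed (use Q c \<Phi> sub in \<open>auto intro!: int\<close>)
  moreover have "Im (\<Phi> (of_real c2)) = Im (\<Phi> (of_real c1))"
    by (rule Im_primitive_const[OF c(2) \<Phi>]) (use sub[of _ 0] real c(1) in auto)
  ultimately show ?thesis by (metis minus_complex.sel(2) right_minus_eq)
qed

text \<open>The upper half of Hankel's contour leaves c at an angle \<theta> beyond \<pi>/2, so that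
  |exp s| decays along it like exp (- \<kappa> * r) with \<kappa> = - cos \<theta> > 0.\<close>

locale hankel_ray =
  fixes \<theta> :: real
  assumes \<theta>: "pi / 2 < \<theta>" "\<theta> < pi"
begin

abbreviation "\<omega> \<equiv> cis \<theta>"
abbreviation "\<kappa> \<equiv> - cos \<theta>"
abbreviation "ray c r \<equiv> complex_of_real c + complex_of_real r * \<omega>"
abbreviation "ray1 r \<equiv> 1 + complex_of_real r * \<omega>"
abbreviation "hankel_integrand a r \<equiv> exp (ray1 r) * ray1 r powr complex_of_real a"

lemma \<kappa>_pos: "\<kappa> > 0"
  using \<theta> cos_gt_zero_pi[of "pi - \<theta>"] by simp

lemma sin_pos: "sin \<theta> > 0"
  using \<theta> by (intro sin_gt_zero) auto

text \<open>\<open>c * sin \<theta>\<close> is the distance of the origin from the line carrying the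
  ray; the dropped square vanishes at the foot of the perpendicular.\<close>

lemma norm_ray_ge:
  assumes "c \<ge> 0" "r \<ge> 0"
  shows "c * sin \<theta> \<le> norm (ray c r)"
proof (rule power2_le_imp_le)
  have "(norm (ray c r))\<^sup>2 = (c + r * cos \<theta>)\<^sup>2 + (r * sin \<theta>)\<^sup>2"
    by (simp add: cmod_power2)
  also have "\<dots> = (c * sin \<theta>)\<^sup>2 + (r + c * cos \<theta>)\<^sup>2"
    using sin_cos_squared_add[of \<theta>] by algebra
  finally show "(c * sin \<theta>)\<^sup>2 \<le> (norm (ray c r))\<^sup>2" by simp
qed auto

lemma norm_ray_le: "c \<ge> 0 \<Longrightarrow> r \<ge> 0 \<Longrightarrow> norm (ray c r) \<le> c + r"
  using norm_triangle_ineq[of "of_real c" "of_real r * \<omega>"] by (simp add: norm_mult)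

text \<open>\<open>K\<close> depends neither on the exponent nor on the vertex as long as both stay
  in compact intervals: the first serves continuity in the exponent, the second the shift of the
  vertex. Half of the exponential decay absorbs the power.\<close>

lemma ray_bound:
  assumes "0 < c1" "c1 \<le> c2"
  obtains K where "K > 0" "\<And>a c r. \<bar>a\<bar> \<le> A \<Longrightarrow> c1 \<le> c \<Longrightarrow> c \<le> c2 \<Longrightarrow> r \<ge> 0 \<Longrightarrow>
    exp (c - \<kappa> * r) * norm (ray c r) powr a \<le> K * exp (- (\<kappa> / 2) * r)"
proof -
  define m where "m = min 1 (c1 * sin \<theta>)"
  have m: "m > 0" "m \<le> 1" "m \<le> c1 * sin \<theta>" using sin_pos assms by (auto simp: m_def)
  obtain K0 where K0: "K0 > 0" "\<And>x. x \<ge> 0 \<Longrightarrow> (1 + x) powr A \<le> K0 * exp (\<kappa> / 2 * x)"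
    using powr_le_exp_linear[of "\<kappa> / 2" A] \<kappa>_pos by auto
  define K where "K = exp c2 * m powr (-A) * (1 + c2) powr A * K0"
  show ?thesis
  proof
    show "K > 0" using K0 assms m by (simp add: K_def)
    fix a c r :: real assume *: "\<bar>a\<bar> \<le> A" "c1 \<le> c" "c \<le> c2" "r \<ge> 0"
    let ?s = "ray c r"
    have "c1 * sin \<theta> \<le> c * sin \<theta>" using * sin_pos by simp
    then have 1: "m \<le> norm ?s" using norm_ray_ge[of c r] * assms m(3) by linarith
    have "c2 * r \<ge> 0" using * assms by simp
    moreover have "norm ?s \<le> c + r" using * assms by (intro norm_ray_le) auto
    moreover have "(1 + c2) * (1 + r) = 1 + c2 + r + c2 * r" by (simp add: algebra_simps)
    ultimately have 2: "norm ?s \<le> (1 + c2) * (1 + r)" using * by linarith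
    have "1 \<le> (1 + c2) * (1 + r)" using * assms by (simp add: algebra_simps)
    then have "norm ?s powr a \<le> m powr (-A) * ((1 + c2) * (1 + r)) powr A"
      by (intro powr_le_of_between m 1 2 *(1))
    also have "\<dots> = m powr (-A) * ((1 + c2) powr A * (1 + r) powr A)"
      using * assms by (simp add: powr_mult)
    also have "\<dots> \<le> m powr (-A) * ((1 + c2) powr A * (K0 * exp (\<kappa> / 2 * r)))"
      using * K0(2)[of r] by (intro mult_left_mono) auto
    finally have "norm ?s powr a \<le> m powr (-A) * ((1 + c2) powr A * (K0 * exp (\<kappa> / 2 * r)))" .
    moreover have "exp (c - \<kappa> * r) \<le> exp c2 * exp (- \<kappa> * r)"
      using * by (simp add: exp_add[symmetric])
    ultimately have "exp (c - \<kappa> * r) * norm ?s powr a \<le>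
        (exp c2 * exp (- \<kappa> * r)) * (m powr (-A) * ((1 + c2) powr A * (K0 * exp (\<kappa> / 2 * r))))"
      by (intro mult_mono) auto
    also have "\<dots> = K * (exp (- \<kappa> * r) * exp (\<kappa> / 2 * r))" by (simp add: K_def mult_ac)
    also have "\<dots> = K * exp (- (\<kappa> / 2) * r)"
      unfolding exp_add[symmetric] by (simp add: field_simps)
    finally show "exp (c - \<kappa> * r) * norm ?s powr a \<le> K * exp (- (\<kappa> / 2) * r)" .
  qed
qed

lemma norm_exp_ray: "norm (exp (ray c r)) = exp (c - \<kappa> * r)"
  by (simp add: norm_exp_eq_Re mult.commute)

lemma ray_nonneg_Reals: "c > 0 \<Longrightarrow> r \<ge> 0 \<Longrightarrow> ray c r \<notin> \<real>\<^sub>\<le>\<^sub>0"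
  using sin_pos by (auto simp: complex_nonpos_Reals_iff mult_less_0_iff)

lemma Im_hankel_indep:
  assumes "0 < c1" "c1 \<le> c2"
  shows "Im (LBINT r:{0..}. exp (ray c1 r) * (ray c1 r) powr of_real a * \<omega>)
       = Im (LBINT r:{0..}. exp (ray c2 r) * (ray c2 r) powr of_real a * \<omega>)"
proof -
  obtain K where K: "K > 0" "\<And>b c r. \<bar>b\<bar> \<le> \<bar>a\<bar> \<Longrightarrow> c1 \<le> c \<Longrightarrow> c \<le> c2 \<Longrightarrow> r \<ge> 0 \<Longrightarrow>
    exp (c - \<kappa> * r) * norm (ray c r) powr b \<le> K * exp (- (\<kappa> / 2) * r)"
    using ray_bound[OF assms] by metis
  \<comment> \<open>The half-plane around the bisector of the positive axis and the ray: it contains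
    both and misses the negative axis because \<theta> < \<pi>.\<close>
  define Q where "Q = {s. inner (cis (\<theta> / 2)) s > 0}"
  have cosp: "cos (\<theta> / 2) > 0" using \<theta> by (intro cos_gt_zero_pi) auto
  have Q: "convex Q" "open Q" unfolding Q_def by (auto intro: convex_halfspace_gt open_halfspace_gt)
  have npos: "s \<notin> \<real>\<^sub>\<le>\<^sub>0" if "s \<in> Q" for s
    using that cosp by (auto simp: Q_def inner_complex_def complex_nonpos_Reals_iff zero_less_mult_iff)
  show ?thesis
  proof (rule Im_ray_integral_shift[where Q = Q and F = "\<lambda>s. exp s * s powr of_real a" and k = "\<kappa> / 2" and K = K])
    show "(\<lambda>s. exp s * s powr of_real a) holomorphic_on Q"
      by (intro holomorphic_intros) (use npos in auto)
    show "ray c r \<in> Q" if "c1 \<le> c" "c \<le> c2" "0 \<le> r" for c r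
    proof -
      have "inner (cis (\<theta> / 2)) (ray c r) =
          c * cos (\<theta> / 2) + r * (cos \<theta> * cos (\<theta> / 2) + sin \<theta> * sin (\<theta> / 2))"
        by (simp add: inner_complex_def algebra_simps)
      also have "cos \<theta> * cos (\<theta> / 2) + sin \<theta> * sin (\<theta> / 2) = cos (\<theta> / 2)"
        using cos_diff[of \<theta> "\<theta> / 2"] by simp
      also have "c * cos (\<theta> / 2) + r * cos (\<theta> / 2) = (c + r) * cos (\<theta> / 2)" by (simp add: algebra_simps)
      also have "(c + r) * cos (\<theta> / 2) > 0" using that assms cosp by (intro mult_pos_pos) auto
      finally show ?thesis by (simp add: Q_def)
    qed
    show "norm (exp (ray c r) * (ray c r) powr of_real a) \<le> K * exp (- (\<kappa> / 2) * r)"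
      if "c1 \<le> c" "c \<le> c2" "0 \<le> r" for c r
      using K(2)[of a c r] that by (simp add: norm_mult norm_exp_ray norm_powr_real_powr' del: norm_exp_eq_Re)
    show "exp (of_real t) * of_real t powr of_real a \<in> (\<real> :: complex set)" if "0 < t" for t :: real
      using that by (auto simp: powr_of_real exp_of_real)
  qed (use \<kappa>_pos Q assms in auto)
qed

text \<open>For a > 0 the vertex can be pulled to 0. Substituting s = -w turns exp s into exp (-w),
  and w runs in the direction -\<omega>, which has positive real part: a rotated Gamma integral
  remains, with the coefficient -cis (\<pi> a).\<close>

lemma Im_hankel_neg_exponent:
  assumes "a > 0" "c > 0"
  shows "Im (LBINT r:{0..}. exp (ray c r) * (ray c r) powr of_real a * \<omega>)
       = - sin (pi * a) * Gamma (1 + a)"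
proof -
  define F :: "complex \<Rightarrow> complex" where "F s = exp s * s powr of_real a" for s
  obtain K where K: "K > 0" "\<And>x. x \<ge> 0 \<Longrightarrow> (1 + x) powr a \<le> K * exp (\<kappa> / 2 * x)"
    using powr_le_exp_linear[of "\<kappa> / 2" a] \<kappa>_pos by auto
  have lim: "(\<lambda>n. LBINT r:{0..}. F (of_real (1 / Suc n) + of_real r * \<omega>) * \<omega>)
      \<longlonglongrightarrow> (LBINT r:{0..}. F (of_real r * \<omega>) * \<omega>)"
  proof (rule ray_integral_tendsto[of "\<kappa> / 2" _ _ "exp 1 * K"])
    show "norm (F (ray c r)) \<le> exp 1 * K * exp (- (\<kappa> / 2) * r)"
      if "0 < c" "c \<le> 1" "0 \<le> r" for c r
    proof -
      have "norm (ray c r) powr a \<le> (1 + r) powr a"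
        using norm_ray_le[of c r] that assms by (intro powr_mono2) auto
      also have "\<dots> \<le> K * exp (\<kappa> / 2 * r)" using K that by auto
      finally have "exp (c - \<kappa> * r) * norm (ray c r) powr a \<le>
          (exp 1 * exp (- \<kappa> * r)) * (K * exp (\<kappa> / 2 * r))"
        using that by (intro mult_mono) (auto simp: exp_add[symmetric])
      also have "\<dots> = exp 1 * K * (exp (- \<kappa> * r) * exp (\<kappa> / 2 * r))" by (simp add: mult_ac)
      also have "\<dots> = exp 1 * K * exp (- (\<kappa> / 2) * r)"
        unfolding exp_add[symmetric] by (simp add: field_simps)
      finally show ?thesis
        by (simp add: F_def norm_mult norm_exp_ray norm_powr_real_powr' del: norm_exp_eq_Re)
    qed
    show "continuous_on {0..} (\<lambda>r. F (ray c r))" if "0 < c" "c \<le> 1" for c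
      unfolding F_def by (intro continuous_intros) (use that ray_nonneg_Reals assms sin_pos in auto)
    fix r :: real assume r: "r \<ge> 0"
    show "(\<lambda>n. F (of_real (1 / Suc n) + of_real r * \<omega>)) \<longlonglongrightarrow> F (of_real r * \<omega>)"
    proof (cases "r = 0")
      case True
      show ?thesis using tendsto_shifted_powr_at_0[of a "\<lambda>s. exp s"] True assms
        by (auto simp: F_def)
    next
      case False
      then have "of_real r * \<omega> \<notin> \<real>\<^sub>\<le>\<^sub>0" using r sin_pos by (auto simp: complex_nonpos_Reals_iff)
      then have "isCont F (of_real r * \<omega>)"
        unfolding F_def by (intro continuous_intros) auto
      moreover have "(\<lambda>n. of_real (1 / Suc n) + of_real r * \<omega>) \<longlonglongrightarrow> of_real 0 + of_real r * \<omega>"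
        by (intro tendsto_intros) (use LIMSEQ_inverse_real_of_nat in \<open>simp add: inverse_eq_divide\<close>)
      ultimately show ?thesis by (intro isCont_tendsto_compose[of "of_real r * \<omega>" F]) auto
    qed
  qed (use \<kappa>_pos in auto)
  have "Im (LBINT r:{0..}. F (of_real (1 / Suc n) + of_real r * \<omega>) * \<omega>)
      = Im (LBINT r:{0..}. F (ray c r) * \<omega>)" for n
    using Im_hankel_indep[of c "1 / Suc n" a] Im_hankel_indep[of "1 / Suc n" c a] assms(2)
    unfolding F_def by (cases "c \<le> 1 / Suc n") auto
  then have "Im (LBINT r:{0..}. F (ray c r) * \<omega>)
      = Im (LBINT r:{0..}. F (of_real r * \<omega>) * \<omega>)"
    using tendsto_Im[OF lim] by (simp add: LIMSEQ_const_iff)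
  also have "(LBINT r:{0..}. F (of_real r * \<omega>) * \<omega>)
      = (LBINT r:{0..}. (- cis (pi * a)) * (exp (- (of_real r * (- \<omega>))) * (of_real r * (- \<omega>)) powr of_real (1 + a - 1) * (- \<omega>)))"
  proof (rule set_lebesgue_integral_cong)
    show "\<forall>r. r \<in> {0..} \<longrightarrow> F (of_real r * \<omega>) * \<omega> =
      - cis (pi * a) * (exp (- (of_real r * (- \<omega>))) * (of_real r * (- \<omega>)) powr of_real (1 + a - 1) * (- \<omega>))"
    proof (intro allI impI)
      fix r :: real assume "r \<in> {0..}"
      have "(of_real r * \<omega>) powr of_real a = cis (pi * a) * (of_real r * (- \<omega>)) powr of_real a"
      proof (cases "r = 0")
        case False
        let ?z = "of_real r * (- \<omega>)"
        have z: "?z \<noteq> 0" "Im ?z < 0" using False \<open>r \<in> {0..}\<close> sin_pos by auto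
        \<comment> \<open>Below the real axis negation adds i \<pi> to the logarithm; this is the
          origin of the factor \<open>cis (pi * a)\<close>.\<close>
        then have "Ln (- ?z) = Ln ?z + \<i> * of_real pi" by (subst Ln_minus) auto
        then have "(- ?z) powr of_real a = exp (of_real a * Ln ?z + \<i> * of_real (pi * a))"
          using z unfolding powr_def by (simp add: algebra_simps)
        also have "\<dots> = cis (pi * a) * ?z powr of_real a"
          using z unfolding powr_def by (simp add: exp_add cis_conv_exp mult_ac)
        finally show ?thesis by simp
      qed auto
      then show "F (of_real r * \<omega>) * \<omega> =
        - cis (pi * a) * (exp (- (of_real r * (- \<omega>))) * (of_real r * (- \<omega>)) powr of_real (1 + a - 1) * (- \<omega>))"
        by (simp add: F_def)
    qed
  qed simp
  also have "\<dots> = - cis (pi * a) * (LBINT r:{0..}. exp (- (of_real r * (- \<omega>))) * (of_real r * (- \<omega>)) powr of_real (1 + a - 1) * (- \<omega>))"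
    by (rule set_integral_mult_right)
  also have "\<dots> = - cis (pi * a) * of_real (Gamma (1 + a))"
    using assms \<kappa>_pos by (subst Gamma_integral_rotated) auto
  finally show ?thesis by (simp add: F_def)
qed


definition hankel_integral :: "real \<Rightarrow> complex" where
  "hankel_integral a = (LBINT r:{0..}. hankel_integrand a r * \<omega>)"

lemma hankel_integrand_bound:
  obtains K where "K > 0" "\<And>a r. \<bar>a\<bar> \<le> A \<Longrightarrow> r \<ge> 0 \<Longrightarrow>
    norm (hankel_integrand a r) \<le> K * exp (- (\<kappa> / 2) * r)"
proof -
  obtain K where K: "K > 0" "\<And>a c r. \<bar>a\<bar> \<le> A \<Longrightarrow> 1 \<le> c \<Longrightarrow> c \<le> 1 \<Longrightarrow> r \<ge> 0 \<Longrightarrow>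
    exp (c - \<kappa> * r) * norm (ray c r) powr a \<le> K * exp (- (\<kappa> / 2) * r)"
    using ray_bound[of 1 1 A] by auto
  show ?thesis
    using that[of K] K(1) K(2)[of _ 1] norm_exp_ray[of 1]
    by (simp add: norm_mult norm_powr_real_powr' del: norm_exp_eq_Re)
qed

lemma one_ray_nonneg_Reals: "r \<ge> 0 \<Longrightarrow> ray1 r \<notin> \<real>\<^sub>\<le>\<^sub>0"
  using ray_nonneg_Reals[of 1 r] by simp

lemma one_ray_nonzero: "r \<ge> 0 \<Longrightarrow> ray1 r \<noteq> 0"
  using one_ray_nonneg_Reals[of r] by auto

lemma continuous_on_hankel_integrand:
  "continuous_on {0..} (\<lambda>r. hankel_integrand a r)"
  using one_ray_nonneg_Reals one_ray_nonzero sin_pos by (intro continuous_intros) auto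

lemma set_integrable_hankel:
  "set_integrable lborel {0..} (\<lambda>r. hankel_integrand a r * \<omega>)"
proof -
  obtain K where K: "K > 0" "\<And>r. r \<ge> 0 \<Longrightarrow>
    norm (hankel_integrand a r) \<le> K * exp (- (\<kappa> / 2) * r)"
    using hankel_integrand_bound[of "\<bar>a\<bar>"] by (metis order_refl)
  show ?thesis
    by (rule set_integrable_of_exp_bound[of "\<kappa> / 2" _ K])
      (use \<kappa>_pos K in \<open>auto intro!: continuous_on_mult_right continuous_on_hankel_integrand simp: norm_mult\<close>)
qed

text \<open>Integrate the derivative of exp s * s^a along the ray. The boundary term at the vertex 1
  is -e, which is real and drops out of the imaginary part; what remains is the functional equation
  of the reciprocal Gamma function.\<close>

lemma hankel_integral_rec: "Im (hankel_integral a) = - a * Im (hankel_integral (a - 1))"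
proof -
  define \<Phi> :: "complex \<Rightarrow> complex" where "\<Phi> s = exp s * s powr of_real a" for s
  define F :: "complex \<Rightarrow> complex" where
    "F s = exp s * s powr of_real a + of_real a * (exp s * s powr of_real (a - 1))" for s
  have Feq: "F (ray1 r) * \<omega> =
      hankel_integrand a r * \<omega>
      + of_real a * (hankel_integrand (a - 1) r * \<omega>)" for r
    by (simp add: F_def algebra_simps)
  have lim: "((\<lambda>R. \<Phi> (1 + of_real R * \<omega>) - \<Phi> 1) \<longlongrightarrow>
      (LBINT r:{0..}. F (ray1 r) * \<omega>)) at_top"
  proof (rule ray_integral_limit)
    show "(\<Phi> has_field_derivative F (ray1 r)) (at (ray1 r))" if "r \<ge> 0" for r
      unfolding \<Phi>_def F_def using one_ray_nonneg_Reals[OF that]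
      by (auto intro!: derivative_eq_intros simp: algebra_simps)
    show "set_integrable lborel {0..} (\<lambda>r. F (ray1 r) * \<omega>)"
      unfolding Feq by (intro set_integral_add set_integrable_mult_right set_integrable_hankel)
  qed
  obtain K where K: "K > 0" "\<And>r. r \<ge> 0 \<Longrightarrow>
    norm (\<Phi> (ray1 r)) \<le> K * exp (- (\<kappa> / 2) * r)"
    using hankel_integrand_bound[of "\<bar>a\<bar>"] unfolding \<Phi>_def by (metis order_refl)
  have "((\<lambda>R. \<Phi> (1 + of_real R * \<omega>)) \<longlongrightarrow> 0) at_top"
  proof (rule Lim_null_comparison)
    show "\<forall>\<^sub>F R in at_top. norm (\<Phi> (1 + of_real R * \<omega>)) \<le> K * exp (- (\<kappa> / 2) * R)"
      using eventually_ge_at_top[of 0] by eventually_elim (rule K(2))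
    show "((\<lambda>R. K * exp (- (\<kappa> / 2) * R)) \<longlongrightarrow> 0) at_top"
      using \<kappa>_pos by real_asymp
  qed
  then have "((\<lambda>R. \<Phi> (1 + of_real R * \<omega>) - \<Phi> 1) \<longlongrightarrow> 0 - \<Phi> 1) at_top"
    by (intro tendsto_intros)
  then have "(LBINT r:{0..}. F (ray1 r) * \<omega>) = - \<Phi> 1"
    using tendsto_unique[OF trivial_limit_at_top_linorder lim] by simp
  moreover have "(LBINT r:{0..}. F (ray1 r) * \<omega>) = hankel_integral a + of_real a * hankel_integral (a - 1)"
  proof -
    let ?f = "\<lambda>a r. hankel_integrand a r * \<omega>"
    have "set_integrable lborel {0..} (\<lambda>r. of_real a * ?f (a - 1) r)"
      by (intro set_integrable_mult_right set_integrable_hankel)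
    from set_integral_add(2)[OF set_integrable_hankel[of a] this]
    show ?thesis
      unfolding Feq hankel_integral_def by (simp only: set_integral_mult_right)
  qed
  ultimately have "hankel_integral a + of_real a * hankel_integral (a - 1) = - of_real (exp 1)"
    by (simp add: \<Phi>_def exp_of_real[symmetric])
  from arg_cong[OF this, of Im] show ?thesis by simp
qed

text \<open>A convergent sequence of exponents is bounded, and \<open>hankel_integrand_bound\<close>
  is uniform on bounded exponents, so dominated convergence applies.\<close>

lemma continuous_hankel_integral: "isCont hankel_integral a"
  unfolding continuous_at_sequentially o_def
proof (intro allI impI)
  fix x :: "nat \<Rightarrow> real" assume x: "x \<longlonglongrightarrow> a"
  then obtain A where A: "\<And>n. \<bar>x n\<bar> \<le> A"
    using convergent_imp_Bseq[of x] by (auto simp: convergent_def Bseq_def)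
  have "\<bar>a\<bar> \<le> A"
    by (rule LIMSEQ_le_const2[OF tendsto_rabs[OF x]]) (use A in auto)
  obtain K where K: "K > 0" "\<And>a r. \<bar>a\<bar> \<le> A \<Longrightarrow> r \<ge> 0 \<Longrightarrow>
    norm (hankel_integrand a r) \<le> K * exp (- (\<kappa> / 2) * r)"
    using hankel_integrand_bound[of A] by blast
  show "(\<lambda>n. hankel_integral (x n)) \<longlonglongrightarrow> hankel_integral a"
    unfolding hankel_integral_def set_lebesgue_integral_def
  proof (rule integral_dominated_convergence)
    show "(\<lambda>r. indicator {0..} r *\<^sub>R (hankel_integrand b r * \<omega>)) \<in> borel_measurable lborel" for b
      using set_integrable_hankel[of b] unfolding set_integrable_def by (rule borel_measurable_integrable)
    then show "(\<lambda>r. indicator {0..} r *\<^sub>R (hankel_integrand (x n) r * \<omega>)) \<in> borel_measurable lborel" for n .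
    show "integrable lborel (\<lambda>r. indicator {0..} r *\<^sub>R (K * exp (- (\<kappa> / 2) * r)))"
      using set_integrable_exp_neg[of "\<kappa> / 2" K] \<kappa>_pos by (simp add: set_integrable_def)
    show "AE r in lborel. (\<lambda>n. indicator {0..} r *\<^sub>R (hankel_integrand (x n) r * \<omega>))
        \<longlonglongrightarrow> indicator {0..} r *\<^sub>R (hankel_integrand a r * \<omega>)"
    proof (rule AE_I2)
      fix r :: real
      show "(\<lambda>n. indicator {0..} r *\<^sub>R (hankel_integrand (x n) r * \<omega>))
        \<longlonglongrightarrow> indicator {0..} r *\<^sub>R (hankel_integrand a r * \<omega>)"
      proof (cases "r \<ge> 0")
        case True
        have "(\<lambda>n. exp (of_real (x n) * Ln (ray1 r))) \<longlonglongrightarrow> exp (of_real a * Ln (ray1 r))"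
          by (intro tendsto_intros x)
        then show ?thesis using True one_ray_nonzero[OF True]
          by (auto intro!: tendsto_intros simp: powr_def)
      qed auto
    qed
    show "AE r in lborel. norm (indicator {0..} r *\<^sub>R (hankel_integrand (x n) r * \<omega>))
        \<le> indicator {0..} r *\<^sub>R (K * exp (- (\<kappa> / 2) * r))" for n
      using K(2)[OF A] by (intro AE_I2) (auto simp: indicator_def norm_mult)
  qed
qed

text \<open>Hankel's formula, with the contour folded onto its upper half.\<close>

lemma hankel_formula_1: "Im (hankel_integral (- z)) = pi * rGamma z"
proof -
  define d where "d z = Im (hankel_integral (- z)) - pi * rGamma z" for z
  \<comment> \<open>The difference \<open>d\<close> of the two sides inherits the recurrence that
    both satisfy, and it vanishes for z < 0; from there it is carried to the right in steps of
    length 1.\<close>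
  have rec: "d z = z * d (z + 1)" for z
  proof -
    have "- z - 1 = - (z + 1)" by simp
    then have "Im (hankel_integral (- z)) = z * Im (hankel_integral (- (z + 1)))"
      using hankel_integral_rec[of "- z"] by simp
    moreover have "rGamma z = z * rGamma (z + 1)" by (simp add: rGamma_plus1)
    ultimately show ?thesis unfolding d_def by algebra
  qed
  \<comment> \<open>For z < 0 the integral is known from Euler's integral, and the reflection
    formula identifies it with the reciprocal Gamma function.\<close>
  have neg: "d z = 0" if "z < 0" for z
  proof -
    have "Im (hankel_integral (- z)) = sin (pi * z) * Gamma (1 - z)"
      using Im_hankel_neg_exponent[of "- z" 1] that by (simp add: hankel_integral_def)
    moreover have "rGamma z * rGamma (1 - z) = sin (pi * z) / pi"
    proof -
      have e: "1 - complex_of_real z = of_real (1 - z)" "of_real pi * complex_of_real z = of_real (pi * z)"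
        by simp_all
      have "complex_of_real (rGamma z * rGamma (1 - z)) = of_real (sin (pi * z) / pi)"
        using rGamma_reflection_complex[of "of_real z"]
        unfolding e rGamma_complex_of_real sin_of_real by (simp only: of_real_mult of_real_divide)
      then show ?thesis by (simp only: of_real_eq_iff)
    qed
    moreover have "Gamma (1 - z) > 0" using that by (intro Gamma_real_pos) auto
    then have "Gamma (1 - z) * rGamma (1 - z) = 1" by (simp add: rGamma_inverse_Gamma)
    moreover have "pi * (sin (pi * z) / pi) = sin (pi * z)" by simp
    ultimately show ?thesis unfolding d_def by algebra
  qed
  have cont: "isCont d z" for z
  proof -
    have "isCont (\<lambda>x. hankel_integral (- x)) z"
      by (rule isCont_o2[OF _ continuous_hankel_integral]) (intro continuous_intros)
    moreover have "isCont (rGamma :: real \<Rightarrow> real) z" by (intro continuous_intros)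
    ultimately show ?thesis unfolding d_def by (intro continuous_intros isCont_Im)
  qed
  have "\<forall>z. z < real n \<longrightarrow> d z = 0" for n
  proof (induction n)
    case 0
    then show ?case using neg by simp
  next
    case (Suc n)
    have *: "d z = 0" if "z < real (Suc n)" "z \<noteq> 1" for z
      using rec[of "z - 1"] Suc that by auto
    \<comment> \<open>The recurrence leaves \<open>d 1\<close> undetermined, hence the detour through continuity.\<close>
    have "d 1 = 0" if "1 < real (Suc n)"
    proof -
      have "(\<lambda>k. d (1 - 1 / real (Suc k))) \<longlonglongrightarrow> d 1"
      proof (rule isCont_tendsto_compose[OF cont])
        show "(\<lambda>k. 1 - 1 / real (Suc k)) \<longlonglongrightarrow> 1"
          using tendsto_diff[OF tendsto_const[of 1] LIMSEQ_inverse_real_of_nat] by (simp add: inverse_eq_divide)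
      qed
      moreover have "d (1 - 1 / real (Suc k)) = 0" for k
      proof (rule *)
        have "1 / real (Suc k) > 0" by simp
        then show "1 - 1 / real (Suc k) < real (Suc n)" using that by linarith
      qed simp
      ultimately show ?thesis by (simp add: LIMSEQ_const_iff)
    qed
    with * show ?case by (metis)
  qed
  moreover obtain n where "z < real n" using reals_Archimedean2 by blast
  ultimately show ?thesis by (simp add: d_def)
qed

lemma hankel_formula:
  assumes "c > 0"
  shows "Im (LBINT r:{0..}. exp (ray c r) * (ray c r) powr of_real (- z) * \<omega>)
      = pi * rGamma z"
  using Im_hankel_indep[of 1 c "-z"] Im_hankel_indep[of c 1 "-z"] assms hankel_formula_1[of z]
  unfolding hankel_integral_def by (cases "c \<le> 1") auto

end

subsection \<open>Decay of the Mittag-Leffler function\<close>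

locale ml_ray = hankel_ray +
  fixes \<alpha> \<mu> :: real
  assumes \<alpha>: "1 < \<alpha>" "\<alpha> < 2" and \<theta>\<alpha>: "\<alpha> * \<theta> < pi"
begin

abbreviation "\<sigma> \<equiv> sin (\<alpha> * \<theta>)"

lemma \<alpha>\<theta>_pos: "\<alpha> * \<theta> > 0"
  using \<alpha> \<theta> pi_gt_zero by (intro mult_pos_pos) linarith+

lemma \<sigma>_pos: "\<sigma> > 0"
  using \<alpha>\<theta>_pos \<theta>\<alpha> by (intro sin_gt_zero) auto

text \<open>|s| sin (\<theta> - Arg s) is the signed distance of s from the line through 0 in the
  direction \<omega>; it equals c sin \<theta> all along the ray, so the argument never reaches
  \<theta>.\<close>

lemma Arg_ray:
  assumes "c > 0" "r \<ge> 0"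
  shows "0 \<le> Arg (ray c r)" "Arg (ray c r) < \<theta>"
proof -
  let ?s = "ray c r"
  have s0: "?s \<noteq> 0" using ray_nonneg_Reals[OF assms] by auto
  have Im: "Im ?s \<ge> 0" using assms sin_pos by simp
  show A: "0 \<le> Arg ?s" using Im by (simp add: Arg_less_0)
  have polar: "norm ?s * cos (Arg ?s) = Re ?s" "norm ?s * sin (Arg ?s) = Im ?s"
    by (metis rcis_cmod_Arg Re_rcis, metis rcis_cmod_Arg Im_rcis)
  have "norm ?s * sin (\<theta> - Arg ?s) = sin \<theta> * (norm ?s * cos (Arg ?s)) - cos \<theta> * (norm ?s * sin (Arg ?s))"
    unfolding sin_diff by (simp only: right_diff_distrib mult_ac)
  also have "\<dots> = sin \<theta> * Re ?s - cos \<theta> * Im ?s" unfolding polar ..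
  also have "\<dots> = c * sin \<theta>" by (simp add: algebra_simps)
  also have "\<dots> > 0" using assms sin_pos by simp
  finally have "sin (\<theta> - Arg ?s) > 0" by (simp only: zero_less_mult_iff) auto
  show "Arg ?s < \<theta>"
  proof (rule ccontr)
    assume "\<not> Arg ?s < \<theta>"
    then have "sin (- (\<theta> - Arg ?s)) \<ge> 0"
      using Arg_le_pi[of ?s] \<theta> pi_gt_zero by (intro sin_ge_zero) linarith+
    with \<open>sin (\<theta> - Arg ?s) > 0\<close> show False unfolding sin_minus by linarith
  qed
qed

lemma powr_real_polar: "s \<noteq> 0 \<Longrightarrow> s powr of_real a = of_real (norm s powr a) * cis (a * Arg s)"
proof -
  assume "s \<noteq> 0"
  then have "Ln s = of_real (ln (norm s)) + \<i> * of_real (Arg s)"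
    by (simp add: complex_eq_iff Arg_eq_Im_Ln)
  then have "s powr of_real a = exp (of_real (a * ln (norm s)) + \<i> * of_real (a * Arg s))"
    using \<open>s \<noteq> 0\<close> by (simp add: powr_def algebra_simps)
  also have "\<dots> = of_real (exp (a * ln (norm s))) * cis (a * Arg s)"
    by (simp only: exp_add exp_of_real cis_conv_exp)
  finally show ?thesis using \<open>s \<noteq> 0\<close> by (simp add: powr_def)
qed

text \<open>With \<rho> = x |s|^(-\<alpha>) and p = \<alpha> Arg s, the square of the norm is 1 + 2
  \<rho> cos p + \<rho>^2, and cos p >= cos (\<alpha> \<theta>). Completing the square in \<rho>
  gives the bound uniform in x, completing it the other way gives the bound that grows with
  x.\<close>

lemma denominator_ge:
  assumes "c > 0" "r \<ge> 0" "x \<ge> 0"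
  defines "s \<equiv> ray c r"
  shows "\<sigma> \<le> norm (1 + of_real x * s powr of_real (- \<alpha>))"
    and "\<sigma> * (x * norm s powr (- \<alpha>)) \<le> norm (1 + of_real x * s powr of_real (- \<alpha>))"
proof -
  have s0: "s \<noteq> 0" unfolding s_def using ray_nonneg_Reals[OF assms(1,2)] by auto
  define \<rho> where "\<rho> = x * norm s powr (- \<alpha>)"
  define p where "p = \<alpha> * Arg s"
  have "\<rho> \<ge> 0" using assms by (simp add: \<rho>_def)
  have p: "0 \<le> p" "p \<le> \<alpha> * \<theta>" using Arg_ray[OF assms(1,2)] \<alpha> by (simp_all add: p_def s_def)
  have "of_real x * s powr of_real (- \<alpha>) = of_real \<rho> * cis (- p)"
    unfolding powr_real_polar[OF s0] by (simp add: \<rho>_def p_def)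
  then have "(norm (1 + of_real x * s powr of_real (- \<alpha>)))\<^sup>2 = (1 + \<rho> * cos p)\<^sup>2 + (\<rho> * sin p)\<^sup>2"
    by (simp add: cmod_power2)
  also have "\<dots> = 1 + 2 * \<rho> * cos p + \<rho>\<^sup>2"
    using sin_cos_squared_add[of p] by algebra
  finally have n: "(norm (1 + of_real x * s powr of_real (- \<alpha>)))\<^sup>2 = 1 + 2 * \<rho> * cos p + \<rho>\<^sup>2" .
  have "cos (\<alpha> * \<theta>) \<le> cos p" using p \<theta>\<alpha> by (intro cos_monotone_0_pi_le) auto
  then have *: "1 + 2 * \<rho> * cos (\<alpha> * \<theta>) + \<rho>\<^sup>2 \<le> 1 + 2 * \<rho> * cos p + \<rho>\<^sup>2"
    using \<open>\<rho> \<ge> 0\<close> by (simp add: mult_left_mono)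
  have "\<sigma>\<^sup>2 \<le> \<sigma>\<^sup>2 + (\<rho> + cos (\<alpha> * \<theta>))\<^sup>2" by simp
  also have "\<dots> = 1 + 2 * \<rho> * cos (\<alpha> * \<theta>) + \<rho>\<^sup>2" using sin_cos_squared_add[of "\<alpha> * \<theta>"] by algebra
  finally show "\<sigma> \<le> norm (1 + of_real x * s powr of_real (- \<alpha>))"
    using * n by (intro power2_le_imp_le[OF _ norm_ge_zero]) linarith
  have "(\<sigma> * \<rho>)\<^sup>2 \<le> (\<sigma> * \<rho>)\<^sup>2 + (1 + \<rho> * cos (\<alpha> * \<theta>))\<^sup>2" by simp
  also have "\<dots> = 1 + 2 * \<rho> * cos (\<alpha> * \<theta>) + \<rho>\<^sup>2" using sin_cos_squared_add[of "\<alpha> * \<theta>"] by algebra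
  finally show "\<sigma> * (x * norm s powr (- \<alpha>)) \<le> norm (1 + of_real x * s powr of_real (- \<alpha>))"
    using * n unfolding \<rho>_def[symmetric] by (intro power2_le_imp_le[OF _ norm_ge_zero]) linarith
qed

text \<open>The integrand exp s * s^(\<alpha> - \<mu>) / (s^\<alpha> + x) with s^\<alpha> divided
  out, so that it expands into a geometric series in x s^(-\<alpha>) whose terms are integrands of
  Hankel's formula.\<close>

definition kernel :: "real \<Rightarrow> complex \<Rightarrow> complex" where
  "kernel x s = exp s * s powr of_real (- \<mu>) / (1 + of_real x * s powr of_real (- \<alpha>))"

abbreviation "kernel_integral x c \<equiv> (LBINT r:{0..}. kernel x (ray c r) * \<omega>)"

text \<open>\<open>Q\<close> is the half-plane of arguments between \<pi>/\<alpha> - \<pi> and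
  \<pi>/\<alpha>. Its upper edge is as high as the poles allow, since s^\<alpha> = -x first happens
  at the argument \<pi>/\<alpha>; \<alpha> < 2 keeps the lower edge above -\<pi>/\<alpha>.\<close>

definition "\<delta> = pi / \<alpha> - pi / 2"
definition "Q = {s. inner (cis \<delta>) s > 0}"

lemma \<delta>: "0 < \<delta>" "\<delta> < pi / 2" "\<theta> - \<delta> < pi / 2"
  using \<alpha> \<theta>\<alpha> by (auto simp: \<delta>_def field_simps)

lemma Q: "convex Q" "open Q"
  unfolding Q_def by (auto intro: convex_halfspace_gt open_halfspace_gt)

lemma cos_\<delta>: "cos \<delta> > 0" using \<delta> by (intro cos_gt_zero_pi) auto

lemma Q_nonneg_Reals: "s \<in> Q \<Longrightarrow> s \<notin> \<real>\<^sub>\<le>\<^sub>0"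
  using cos_\<delta> by (auto simp: Q_def inner_complex_def complex_nonpos_Reals_iff zero_less_mult_iff)

lemma ray_in_Q:
  assumes "c > 0" "r \<ge> 0"
  shows "ray c r \<in> Q"
proof -
  have "cos (\<theta> - \<delta>) > 0" using \<delta> \<theta> by (intro cos_gt_zero_pi) linarith+
  then have "c * cos \<delta> + r * (cos \<theta> * cos \<delta> + sin \<theta> * sin \<delta>) > 0"
    using assms cos_\<delta> unfolding cos_diff by (intro add_pos_nonneg) auto
  then show ?thesis by (simp add: Q_def inner_complex_def algebra_simps)
qed

lemma Q_denominator:
  assumes "s \<in> Q" "x \<ge> 0"
  shows "1 + of_real x * s powr of_real (- \<alpha>) \<noteq> 0"
proof
  assume z: "1 + of_real x * s powr of_real (- \<alpha>) = 0"
  have s0: "s \<noteq> 0" using Q_nonneg_Reals[OF assms(1)] by auto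
  define p where "p = Arg s"
  have polar: "norm s * cos p = Re s" "norm s * sin p = Im s"
    unfolding p_def by (metis rcis_cmod_Arg Re_rcis, metis rcis_cmod_Arg Im_rcis)
  have "norm s * cos (p - \<delta>) = cos \<delta> * (norm s * cos p) + sin \<delta> * (norm s * sin p)"
    unfolding cos_diff by (simp add: algebra_simps)
  also have "\<dots> = cos \<delta> * Re s + sin \<delta> * Im s" unfolding polar ..
  also have "\<dots> > 0" using assms by (simp add: Q_def inner_complex_def)
  finally have pos: "cos (p - \<delta>) > 0" by (simp add: zero_less_mult_iff)
  have p: "- pi < p" "p \<le> pi" using mpi_less_Arg[of s] Arg_le_pi[of s] by (auto simp: p_def)
  \<comment> \<open>Since |p| <= \<pi> and 0 < \<delta> < \<pi>/2, the number |p - \<delta>| is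
    below 3\<pi>/2, and the cosine is not positive between \<pi>/2 and 3\<pi>/2.\<close>
  have "\<bar>p - \<delta>\<bar> < pi / 2"
  proof (rule ccontr)
    assume "\<not> \<bar>p - \<delta>\<bar> < pi / 2"
    then have "cos (\<bar>p - \<delta>\<bar> - pi) \<ge> 0" using p \<delta> by (intro cos_ge_zero) (auto simp: abs_if split: if_splits)
    moreover have "cos (\<bar>p - \<delta>\<bar> - pi) = - cos (p - \<delta>)" by (simp add: cos_diff abs_if)
    ultimately show False using pos by simp
  qed
  then have "p < pi / \<alpha>" "- p < pi - pi / \<alpha>"
    unfolding \<delta>_def abs_less_iff by linarith+
  moreover have "pi - pi / \<alpha> < pi / \<alpha>" using \<alpha> by (simp add: field_simps)
  ultimately have "p < pi / \<alpha>" "- p < pi / \<alpha>" by linarith+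
  then have ap: "\<alpha> * p < pi" "- pi < \<alpha> * p"
    using \<alpha> mult_strict_left_mono[of p "pi / \<alpha>" \<alpha>] mult_strict_left_mono[of "- p" "pi / \<alpha>" \<alpha>] by auto
  have w: "of_real x * s powr of_real (- \<alpha>) = of_real (x * norm s powr (- \<alpha>)) * cis (- (\<alpha> * p))"
    unfolding powr_real_polar[OF s0] by (simp add: p_def)
  have e: "1 + of_real (x * norm s powr (- \<alpha>)) * cis (- (\<alpha> * p)) = 0"
    using z unfolding w .
  define \<rho> where "\<rho> = x * norm s powr (- \<alpha>)"
  have "1 + \<rho> * cos (\<alpha> * p) = 0" "\<rho> * sin (\<alpha> * p) = 0"
    using arg_cong[OF e, of Re] arg_cong[OF e, of Im] by (auto simp: \<rho>_def)
  then have "\<rho> \<noteq> 0" "sin (\<alpha> * p) = 0" "1 + \<rho> * cos (\<alpha> * p) = 0" by auto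
  then have "\<alpha> * p = 0"
    using sin_gt_zero[of "\<alpha> * p"] sin_gt_zero[of "- (\<alpha> * p)"] ap by (cases "\<alpha> * p" "0 :: real" rule: linorder_cases) auto
  then have "1 + \<rho> = 0" using \<open>1 + \<rho> * cos (\<alpha> * p) = 0\<close> by (simp only: cos_zero mult_1_right)
  moreover have "\<rho> \<ge> 0" using assms by (simp add: \<rho>_def)
  ultimately show False by simp
qed

lemma kernel_holomorphic: "x \<ge> 0 \<Longrightarrow> kernel x holomorphic_on Q"
  unfolding kernel_def using Q_denominator Q_nonneg_Reals by (intro holomorphic_intros) auto

text \<open>The series expansion needs a vertex far to the right, depending on x; the decay estimate
  needs one vertex for all x.\<close>

lemma kernel_indep:
  assumes "x \<ge> 0" "c \<ge> 1"
  shows "Im (kernel_integral x 1)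
       = Im (kernel_integral x c)"
proof -
  obtain K where K: "K > 0" "\<And>b d r. \<bar>b\<bar> \<le> \<bar>\<mu>\<bar> \<Longrightarrow> 1 \<le> d \<Longrightarrow> d \<le> c \<Longrightarrow> r \<ge> 0 \<Longrightarrow>
    exp (d - \<kappa> * r) * norm (ray d r) powr b \<le> K * exp (- (\<kappa> / 2) * r)"
    using ray_bound[of 1 c "\<bar>\<mu>\<bar>"] assms by auto
  show ?thesis
  proof (rule Im_ray_integral_shift[where Q = Q and k = "\<kappa> / 2" and K = "K / \<sigma>"])
    show "norm (kernel x (ray d r)) \<le> K / \<sigma> * exp (- (\<kappa> / 2) * r)"
      if d: "1 \<le> d" "d \<le> c" and r: "0 \<le> r" for d r
    proof -
      have "norm (kernel x (ray d r)) \<le> (K * exp (- (\<kappa> / 2) * r)) / \<sigma>"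
        using K(2)[of "-\<mu>" d r] denominator_ge(1)[of d r x] d r assms(1) \<sigma>_pos K(1) unfolding kernel_def norm_divide
        by (intro frac_le) (auto simp: norm_mult norm_exp_ray norm_powr_real_powr' simp del: norm_exp_eq_Re)
      then show ?thesis by simp
    qed
    show "kernel x (of_real t) \<in> \<real>" if "0 < t" for t
    proof -
      have "kernel x (of_real t) = of_real (exp t * t powr (-\<mu>) / (1 + x * t powr (-\<alpha>)))"
        using that powr_of_real[of t "-\<mu>"] powr_of_real[of t "-\<alpha>"] by (simp add: kernel_def exp_of_real)
      then show ?thesis by (metis Reals_of_real)
    qed
  qed (use assms \<kappa>_pos Q kernel_holomorphic ray_in_Q in auto)
qed

text \<open>Expand the kernel into its geometric series and integrate term by term with Hankel's
  formula. The convergence of the Mittag-Leffler series itself is obtained here as well.\<close>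

lemma mittag_leffler_sums_1:
  assumes "x > 0"
  shows "(\<lambda>k. (- x) ^ k / Gamma (\<alpha> * real k + \<mu>)) sums
      (Im (kernel_integral x 1) / pi)"
proof -
  \<comment> \<open>By \<open>norm_ray_ge\<close>, every point of the ray then satisfies
    |s|^\<alpha> >= 2 x, so the ratio of the geometric series is at most 1/2 in modulus.\<close>
  define c where "c = max 1 ((2 * x) powr (1 / \<alpha>) / sin \<theta>)"
  have c: "c \<ge> 1" "c > 0" "(2 * x) powr (1 / \<alpha>) \<le> c * sin \<theta>"
    using sin_pos by (auto simp: c_def field_simps max_def)
  define S where "S r = ray c r" for r
  have S0: "S r \<noteq> 0" if "r \<ge> 0" for r
    using ray_nonneg_Reals[OF c(2) that] by (auto simp: S_def)
  have half: "x * norm (S r) powr (- \<alpha>) \<le> 1 / 2" if "r \<ge> 0" for r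
  proof -
    have "(2 * x) powr (1 / \<alpha>) \<le> norm (S r)" using c norm_ray_ge[of c r] that by (simp add: S_def)
    then have "norm (S r) powr (- \<alpha>) \<le> ((2 * x) powr (1 / \<alpha>)) powr (- \<alpha>)"
      using \<alpha> assms by (intro powr_mono2') auto
    also have "\<dots> = 1 / (2 * x)" using \<alpha> assms by (simp add: powr_powr powr_minus_divide)
    finally show ?thesis using assms by (simp add: field_simps)
  qed
  obtain K where K: "K > 0" "\<And>b d r. \<bar>b\<bar> \<le> \<bar>\<mu>\<bar> \<Longrightarrow> c \<le> d \<Longrightarrow> d \<le> c \<Longrightarrow> r \<ge> 0 \<Longrightarrow>
    exp (d - \<kappa> * r) * norm (ray d r) powr b \<le> K * exp (- (\<kappa> / 2) * r)"
    using ray_bound[of c c "\<bar>\<mu>\<bar>"] c by auto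
  define f where "f k r = (of_real ((- x) ^ k) * (exp (S r) * S r powr of_real (- (\<alpha> * real k + \<mu>)) * \<omega>))" for k r
  have feq: "f k r = exp (S r) * S r powr of_real (- \<mu>) * \<omega> * (- (of_real x * S r powr of_real (- \<alpha>))) ^ k"
    if "r \<ge> 0" for k r
  proof -
    have "S r powr of_real (- (\<alpha> * real k + \<mu>)) = S r powr of_real (- \<mu>) * (S r powr of_real (- \<alpha>)) ^ k"
      using S0[OF that] by (simp add: powr_def exp_add[symmetric] exp_of_nat_mult[symmetric] algebra_simps)
    then show ?thesis by (simp add: f_def power_mult_distrib[symmetric] mult_ac flip: power_mult_distrib)
  qed
  have fnorm: "norm (f k r) \<le> (1 / 2) ^ k * (K * exp (- (\<kappa> / 2) * r))" if "r \<ge> 0" for k r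
  proof -
    have "norm (f k r) = exp (c - \<kappa> * r) * norm (S r) powr (- \<mu>) * (x * norm (S r) powr (- \<alpha>)) ^ k"
      unfolding feq[OF that] using assms
      by (simp add: norm_mult norm_power norm_exp_ray norm_powr_real_powr' S_def del: norm_exp_eq_Re)
    also have "\<dots> \<le> (K * exp (- (\<kappa> / 2) * r)) * (1 / 2) ^ k"
      using K(2)[of "-\<mu>" c r] K(1) half[OF that] assms that
      by (intro mult_mono[OF _ power_mono]) (auto simp: S_def)
    finally show ?thesis by (simp add: mult.commute)
  qed
  have cont: "continuous_on {0..} (f k)" for k
  proof -
    have "continuous_on {0..} S" unfolding S_def by (intro continuous_intros)
    moreover from this have "continuous_on {0..} (\<lambda>r. S r powr of_real b)" for b
      using ray_nonneg_Reals[OF c(2)] S0 c(2) sin_pos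
      by (intro continuous_on_powr_complex continuous_on_const) (auto simp: S_def)
    ultimately show ?thesis
      unfolding f_def[abs_def] by (intro continuous_on_mult continuous_on_const continuous_on_exp)
  qed
  have int: "set_integrable lborel {0..} (f k)" for k
  proof (rule set_integrable_of_exp_bound[OF _ cont])
    show "\<kappa> / 2 > 0" using \<kappa>_pos by simp
    show "norm (f k r) \<le> (1 / 2) ^ k * K * exp (- (\<kappa> / 2) * r)" if "r \<ge> 0" for r
      using fnorm[OF that] by (simp only: mult.assoc)
  qed
  have intK: "set_integrable lborel {0..} (\<lambda>r. K * exp (- (\<kappa> / 2) * r))"
    using set_integrable_exp_neg[of "\<kappa> / 2" K] \<kappa>_pos by simp
  have "(\<lambda>k. LBINT r. indicator {0..} r *\<^sub>R f k r) sums (LBINT r. (\<Sum>k. indicator {0..} r *\<^sub>R f k r))"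
  proof (rule sums_integral)
    show "integrable lborel (\<lambda>r. indicator {0..} r *\<^sub>R f k r)" for k
      using int by (simp add: set_integrable_def)
    have sm: "summable (\<lambda>k. (1 / 2 :: real) ^ k * M)" for M
      by (intro summable_mult2 summable_geometric) auto
    show "AE r in lborel. summable (\<lambda>k. norm (indicator {0..} r *\<^sub>R f k r))"
    proof (rule AE_I2)
      fix r :: real
      show "summable (\<lambda>k. norm (indicator {0..} r *\<^sub>R f k r))"
        by (rule summable_comparison_test'[OF sm[of "K * exp (- (\<kappa> / 2) * r)"], of 0])
          (use fnorm K(1) in \<open>auto simp: indicator_def\<close>)
    qed
    show "summable (\<lambda>k. LBINT r. norm (indicator {0..} r *\<^sub>R f k r))"
    proof (rule summable_comparison_test'[OF sm[of "LBINT r:{0..}. K * exp (- (\<kappa> / 2) * r)"], of 0])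
      fix k :: nat
      have le: "(LBINT r. norm (indicator {0..} r *\<^sub>R f k r)) \<le>
          (LBINT r. (1 / 2) ^ k * (indicator {0..} r *\<^sub>R (K * exp (- (\<kappa> / 2) * r))))"
        using int[of k] intK fnorm[of _ k] unfolding set_integrable_def
        by (intro integral_mono integrable_norm integrable_mult_right) (auto simp: indicator_def)
      show "norm (LBINT r. norm (indicator {0..} r *\<^sub>R f k r)) \<le>
          (1 / 2) ^ k * (LBINT r:{0..}. K * exp (- (\<kappa> / 2) * r))"
      proof -
        have "0 \<le> (LBINT r. norm (indicator {0..} r *\<^sub>R f k r))"
          by (rule integral_nonneg_AE) (rule AE_I2, rule norm_ge_zero)
        then show ?thesis
          using le unfolding set_lebesgue_integral_def real_norm_def
          by (simp only: integral_mult_right_zero abs_of_nonneg)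
      qed
    qed
  qed
  moreover have "(\<Sum>k. indicator {0..} r *\<^sub>R f k r) = indicator {0..} r *\<^sub>R (kernel x (S r) * \<omega>)" for r
  proof (cases "r \<ge> 0")
    case True
    let ?q = "- (of_real x * S r powr of_real (- \<alpha>))"
    have "norm ?q \<le> 1 / 2" using half[OF True] assms by (simp add: norm_mult norm_powr_real_powr')
    then have "(\<lambda>k. ?q ^ k) sums (1 / (1 - ?q))" by (intro geometric_sums) auto
    then have "(\<lambda>k. f k r) sums (exp (S r) * S r powr of_real (- \<mu>) * \<omega> * (1 / (1 - ?q)))"
      unfolding feq[OF True] by (rule sums_mult)
    then show ?thesis using True by (simp add: sums_iff kernel_def mult_ac)
  qed auto
  ultimately have sums: "(\<lambda>k. LBINT r:{0..}. f k r) sums (LBINT r:{0..}. kernel x (S r) * \<omega>)"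
    unfolding set_lebesgue_integral_def by simp
  have "Im (LBINT r:{0..}. f k r) = pi * ((- x) ^ k / Gamma (\<alpha> * real k + \<mu>))" for k
  proof -
    have "(LBINT r:{0..}. f k r) = of_real ((- x) ^ k) *
        (LBINT r:{0..}. exp (S r) * S r powr of_real (- (\<alpha> * real k + \<mu>)) * \<omega>)"
      unfolding f_def by (rule set_integral_mult_right)
    then have "Im (LBINT r:{0..}. f k r) = (- x) ^ k *
        Im (LBINT r:{0..}. exp (S r) * S r powr of_real (- (\<alpha> * real k + \<mu>)) * \<omega>)"
      by (simp only: Im_complex_of_real Re_complex_of_real times_complex.sel mult_zero_left add_0_right)
    also have "\<dots> = (- x) ^ k * (pi * rGamma (\<alpha> * real k + \<mu>))"
      unfolding S_def hankel_formula[OF c(2)] ..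
    \<comment> \<open>At a pole \<open>Gamma\<close> has the value 0 and division by 0 gives 0, so 1
      / Gamma agrees with the entire function \<open>rGamma\<close> at every real argument.\<close>
    finally show ?thesis by (simp add: rGamma_inverse_Gamma divide_inverse)
  qed
  with sums_Im[OF sums] have "(\<lambda>k. pi * ((- x) ^ k / Gamma (\<alpha> * real k + \<mu>))) sums
      Im (LBINT r:{0..}. kernel x (S r) * \<omega>)" by simp
  from sums_divide[OF this, of pi] show ?thesis
    unfolding kernel_indep[OF less_imp_le[OF assms] c(1)] by (simp add: S_def)
qed

text \<open>The second bound of \<open>denominator_ge\<close> contributes the factor 1/x; with the
  vertex fixed at 1 the remaining integral \<open>I\<close> does not involve x.\<close>

lemma kernel_integral_bound: "\<exists>C>0. \<forall>x>0. norm (kernel_integral x 1) \<le> C / x"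
proof -
  obtain K where K: "K > 0" "\<And>b d r. \<bar>b\<bar> \<le> \<bar>\<alpha> - \<mu>\<bar> \<Longrightarrow> 1 \<le> d \<Longrightarrow> d \<le> 1 \<Longrightarrow> r \<ge> 0 \<Longrightarrow>
    exp (d - \<kappa> * r) * norm (ray d r) powr b \<le> K * exp (- (\<kappa> / 2) * r)"
    using ray_bound[of 1 1 "\<bar>\<alpha> - \<mu>\<bar>"] by auto
  define I where "I = (LBINT r:{0..}. K / \<sigma> * exp (- (\<kappa> / 2) * r))"
  have int: "set_integrable lborel {0..} (\<lambda>r. K / \<sigma> * exp (- (\<kappa> / 2) * r))"
    using set_integrable_exp_neg[of "\<kappa> / 2" "K / \<sigma>"] \<kappa>_pos by simp
  have "I \<ge> 0" unfolding I_def set_lebesgue_integral_def using K(1) \<sigma>_pos by (intro integral_nonneg_AE) auto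
  have "norm (kernel_integral x 1) \<le> (I + 1) / x" if x: "x > 0" for x
  proof -
    let ?k = "\<lambda>r. kernel x (ray 1 r) * \<omega>"
    have b: "norm (?k r) \<le> 1 / x * (K / \<sigma> * exp (- (\<kappa> / 2) * r))" if r: "r \<ge> 0" for r
    proof -
      let ?s = "ray 1 r"
      have s0: "?s \<noteq> 0" using ray_nonneg_Reals[of 1 r] r by auto
      have "norm (?k r) = exp (1 - \<kappa> * r) * norm ?s powr (- \<mu>) / norm (1 + of_real x * ?s powr of_real (- \<alpha>))"
        by (simp only: kernel_def norm_mult norm_divide norm_exp_ray norm_cis norm_powr_real_powr' Reals_of_real
            Re_complex_of_real mult_1_right)
      also have "\<dots> \<le> exp (1 - \<kappa> * r) * norm ?s powr (- \<mu>) / (\<sigma> * (x * norm ?s powr (- \<alpha>)))"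
      proof -
        have pos: "\<sigma> * (x * norm ?s powr (- \<alpha>)) > 0" using \<sigma>_pos x s0 by simp
        have le: "\<sigma> * (x * norm ?s powr (- \<alpha>)) \<le> norm (1 + of_real x * ?s powr of_real (- \<alpha>))"
          using denominator_ge(2)[of 1 r x] r x by simp
        show ?thesis
          by (rule divide_left_mono[OF le _ mult_pos_pos[OF less_le_trans[OF pos le] pos]]) auto
      qed
      also have "\<dots> = exp (1 - \<kappa> * r) * norm ?s powr (\<alpha> - \<mu>) / (\<sigma> * x)"
        using s0 by (simp add: powr_minus powr_diff field_simps)
      also have "\<dots> \<le> K * exp (- (\<kappa> / 2) * r) / (\<sigma> * x)"
        using K(2)[of "\<alpha> - \<mu>" 1 r] r x \<sigma>_pos by (intro divide_right_mono) auto
      finally show ?thesis by (simp add: mult.commute)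
    qed
    have cont: "continuous_on {0..} ?k"
    proof (intro continuous_intros)
      show "continuous_on {0..} (\<lambda>r. kernel x (ray 1 r))"
        by (rule continuous_on_compose2[OF holomorphic_on_imp_continuous_on[OF kernel_holomorphic[of x]]])
          (use x ray_in_Q[of 1] in \<open>auto intro!: continuous_intros\<close>)
    qed
    have intk: "set_integrable lborel {0..} ?k"
    proof (rule set_integrable_of_exp_bound[OF _ cont])
      show "\<kappa> / 2 > 0" using \<kappa>_pos by simp
      show "norm (?k r) \<le> 1 / x * (K / \<sigma>) * exp (- (\<kappa> / 2) * r)" if "r \<ge> 0" for r
        using b[OF that] by (simp only: mult.assoc)
    qed
    have "norm (LBINT r:{0..}. ?k r) \<le> (LBINT r:{0..}. norm (?k r))"
      using intk by (rule set_integral_norm_bound)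
    also have "\<dots> \<le> (LBINT r:{0..}. 1 / x * (K / \<sigma> * exp (- (\<kappa> / 2) * r)))"
      using b by (intro set_integral_mono set_integrable_norm intk set_integrable_mult_right int) auto
    also have "\<dots> = 1 / x * I" unfolding I_def by (rule set_integral_mult_right)
    also have "\<dots> \<le> (I + 1) / x" using x by (simp add: field_simps)
    finally show ?thesis .
  qed
  then show ?thesis using \<open>I \<ge> 0\<close> by (intro exI[of _ "I + 1"]) auto
qed

end

text \<open>The angle is the midpoint of \<pi>/2 and \<pi>/\<alpha>; there is room between them
  because \<alpha> < 2.\<close>

lemma ml_ray_exists:
  assumes "1 < \<alpha>" "\<alpha> < 2"
  shows "ml_ray ((pi / 2 + pi / \<alpha>) / 2) \<alpha>"
proof
  have "pi / 2 < pi / \<alpha>" "pi / \<alpha> < pi" using assms by (auto simp: field_simps)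
  moreover have "pi / 2 < (pi / 2 + q) / 2 \<and> (pi / 2 + q) / 2 < pi" if "pi / 2 < q" "q < pi" for q
    using that by auto
  ultimately show "pi / 2 < (pi / 2 + pi / \<alpha>) / 2" "(pi / 2 + pi / \<alpha>) / 2 < pi" by blast+
  show "\<alpha> * ((pi / 2 + pi / \<alpha>) / 2) < pi" using assms by (simp add: field_simps)
qed (use assms in auto)

lemma mittag_leffler_sums_neg:
  assumes "1 < \<alpha>" "\<alpha> < 2" "x > 0"
  shows "(\<lambda>k. (- x) ^ k / Gamma (\<alpha> * real k + \<mu>)) sums mittag_leffler \<alpha> \<mu> (- x)"
  unfolding mittag_leffler_def
  by (rule summable_sums, rule sums_summable, rule ml_ray.mittag_leffler_sums_1[OF ml_ray_exists[OF assms(1,2)] assms(3)])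

lemma mittag_leffler_decay:
  assumes "1 < \<alpha>" "\<alpha> < 2"
  shows "\<exists>C>0. \<forall>x>0. \<bar>mittag_leffler \<alpha> \<mu> (- x)\<bar> \<le> C / x"
proof -
  interpret ml_ray "(pi / 2 + pi / \<alpha>) / 2" \<alpha> \<mu>
    by (rule ml_ray_exists[OF assms])
  define I where "I x = (kernel_integral x 1)" for x
  from kernel_integral_bound obtain C where C: "C > 0" "\<forall>x>0. norm (I x) \<le> C / x"
    unfolding I_def[symmetric] by (elim exE conjE)
  have abs_pi: "\<bar>y / pi\<bar> \<le> \<bar>y\<bar>" for y
    using mult_left_mono[of 1 pi "\<bar>y\<bar>"] pi_ge_two by (simp add: abs_divide pos_divide_le_eq)
  have "\<bar>mittag_leffler \<alpha> \<mu> (- x)\<bar> \<le> C / x" if "x > 0" for x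
  proof -
    have "mittag_leffler \<alpha> \<mu> (- x) = Im (I x) / pi"
      using mittag_leffler_sums_1[OF that] unfolding mittag_leffler_def I_def[symmetric] by (rule sums_unique[symmetric])
    also have "\<bar>Im (I x) / pi\<bar> \<le> \<bar>Im (I x)\<bar>" by (rule abs_pi)
    also have "\<dots> \<le> norm (I x)" by (rule abs_Im_le_cmod)
    also have "\<dots> \<le> C / x" using C(2) that by blast
    finally show ?thesis .
  qed
  with C(1) show ?thesis by blast
qed

subsection \<open>Recurrence, derivatives and fractional integrals\<close>

locale caputo_order =
  fixes \<alpha> :: real
  assumes \<alpha>: "1 < \<alpha>" "\<alpha> < 2"
begin

abbreviation "E \<equiv> mittag_leffler \<alpha>"

text \<open>A power series that converges at -(|z| + 1) converges absolutely at z.\<close>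

lemma ml_abs_summable: "summable (\<lambda>k. \<bar>z ^ k / Gamma (\<alpha> * real k + \<mu>)\<bar>)"
proof -
  have "summable (\<lambda>k. 1 / Gamma (\<alpha> * real k + \<mu>) * (- (\<bar>z\<bar> + 1)) ^ k)"
    using sums_summable[OF mittag_leffler_sums_neg[OF \<alpha>, of "\<bar>z\<bar> + 1" \<mu>]] by (simp add: mult.commute)
  from powser_insidea[OF this, of z] show ?thesis by (simp add: mult.commute)
qed

lemma ml_summable: "summable (\<lambda>k. z ^ k / Gamma (\<alpha> * real k + \<mu>))"
  using ml_abs_summable by (rule summable_rabs_cancel)

lemma ml_sums: "(\<lambda>k. z ^ k / Gamma (\<alpha> * real k + \<mu>)) sums E \<mu> z"
  unfolding mittag_leffler_def using ml_summable by (rule summable_sums)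

lemma ml_0: "E \<mu> 0 = 1 / Gamma \<mu>"
proof -
  have "(\<lambda>k. 0 ^ k / Gamma (\<alpha> * real k + \<mu>)) = (\<lambda>k. if k = 0 then 1 / Gamma \<mu> else 0)"
    by (auto simp: fun_eq_iff)
  then show ?thesis using ml_sums[of 0 \<mu>] sums_If_finite_set[of "{0}" "\<lambda>_. 1 / Gamma \<mu>"]
    by (simp add: sums_iff)
qed

lemma ml_rec: "E \<mu> z = 1 / Gamma \<mu> + z * E (\<mu> + \<alpha>) z"
proof -
  have "(\<lambda>k. z ^ Suc k / Gamma (\<alpha> * real (Suc k) + \<mu>)) = (\<lambda>k. z * (z ^ k / Gamma (\<alpha> * real k + (\<mu> + \<alpha>))))"
    by (auto simp: fun_eq_iff algebra_simps)
  then have "(\<lambda>k. z ^ Suc k / Gamma (\<alpha> * real (Suc k) + \<mu>)) sums (z * E (\<mu> + \<alpha>) z)"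
    using sums_mult[OF ml_sums[of z "\<mu> + \<alpha>"], of z] by simp
  from sums_Suc[OF this] show ?thesis
    using ml_sums[of z \<mu>] sums_unique2 by fastforce
qed

text \<open>The coefficient of z^k in \<alpha> z E' carries \<alpha> k = (\<alpha> k + \<mu> - 1) -
  (\<mu> - 1), and the first summand lowers the argument of the reciprocal Gamma function by one.
  Describing \<open>d\<close> through \<alpha> z d avoids a division by z at 0.\<close>

lemma ml_deriv:
  obtains d where "(E \<mu> has_real_derivative d) (at z)"
    and "\<alpha> * z * d = E (\<mu> - 1) z - (\<mu> - 1) * E \<mu> z"
proof -
  define c where "c k = 1 / Gamma (\<alpha> * real k + \<mu>)" for k
  have sm: "summable (\<lambda>k. c k * x ^ k)" for x
    using ml_summable[of x \<mu>] by (simp add: c_def mult.commute)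
  have Eeq: "E \<mu> x = (\<Sum>k. c k * x ^ k)" for x
    by (simp add: mittag_leffler_def c_def)
  define d where "d = (\<Sum>k. diffs c k * z ^ k)"
  have 1: "(E \<mu> has_real_derivative d) (at z)"
    unfolding Eeq[abs_def] d_def using sm by (rule termdiffs_strong_converges_everywhere)
  have "summable (\<lambda>k. diffs c k * z ^ k)"
    by (rule termdiff_converges_all) (rule sm)
  then have "(\<lambda>k. of_nat k * c k * z ^ (k - Suc 0)) sums d"
    unfolding d_def by (rule diffs_equiv)
  from sums_mult[OF this, of "\<alpha> * z"]
  have "(\<lambda>k. \<alpha> * z * (of_nat k * c k * z ^ (k - Suc 0))) sums (\<alpha> * z * d)" .
  moreover have "\<alpha> * z * (of_nat k * c k * z ^ (k - Suc 0)) =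
      z ^ k / Gamma (\<alpha> * real k + (\<mu> - 1)) - (\<mu> - 1) * (z ^ k / Gamma (\<alpha> * real k + \<mu>))" for k
  proof -
    have "z * (of_nat k * z ^ (k - Suc 0)) = of_nat k * z ^ k" by (cases k) auto
    then have "\<alpha> * z * (of_nat k * c k * z ^ (k - Suc 0)) = \<alpha> * c k * (of_nat k * z ^ k)"
      by (metis mult.assoc mult.left_commute)
    also have "\<dots> = z ^ k * ((\<alpha> * real k + (\<mu> - 1)) * rGamma (\<alpha> * real k + \<mu>)) - (\<mu> - 1) * (z ^ k * rGamma (\<alpha> * real k + \<mu>))"
      by (simp add: c_def rGamma_inverse_Gamma divide_inverse algebra_simps)
    also have "(\<alpha> * real k + (\<mu> - 1)) * rGamma (\<alpha> * real k + \<mu>) = rGamma (\<alpha> * real k + (\<mu> - 1))"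
      using rGamma_plus1[of "\<alpha> * real k + (\<mu> - 1)"] by (simp add: algebra_simps)
    finally show ?thesis
      by (simp add: divide_inverse rGamma_inverse_Gamma)
  qed
  ultimately have "(\<lambda>k. z ^ k / Gamma (\<alpha> * real k + (\<mu> - 1)) - (\<mu> - 1) * (z ^ k / Gamma (\<alpha> * real k + \<mu>)))
      sums (\<alpha> * z * d)" by simp
  moreover have "(\<lambda>k. z ^ k / Gamma (\<alpha> * real k + (\<mu> - 1)) - (\<mu> - 1) * (z ^ k / Gamma (\<alpha> * real k + \<mu>)))
      sums (E (\<mu> - 1) z - (\<mu> - 1) * E \<mu> z)"
    by (intro sums_diff sums_mult ml_sums)
  ultimately have 2: "\<alpha> * z * d = E (\<mu> - 1) z - (\<mu> - 1) * E \<mu> z" by (rule sums_unique2)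
  from 1 2 show ?thesis by (rule that)
qed

lemma continuous_on_ml [continuous_intros]:
  "continuous_on S f \<Longrightarrow> continuous_on S (\<lambda>x. E \<mu> (f x))"
  by (rule continuous_on_compose2[of UNIV])
    (auto intro!: continuous_at_imp_continuous_on intro: DERIV_isCont ml_deriv)

text \<open>The factor t^(\<mu> - 1) compensates the term (\<mu> - 1) E_\<mu> of
  \<open>ml_deriv\<close>, so differentiation only lowers \<mu> by one.\<close>

lemma power_ml_deriv:
  assumes "t > 0"
  shows "((\<lambda>t. t powr (\<mu> - 1) * E \<mu> (- l * t powr \<alpha>)) has_real_derivative
    t powr (\<mu> - 2) * E (\<mu> - 1) (- l * t powr \<alpha>)) (at t)"
proof -
  let ?z = "- l * t powr \<alpha>"
  obtain d where d: "(E \<mu> has_real_derivative d) (at ?z)"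
    and e: "\<alpha> * ?z * d = E (\<mu> - 1) ?z - (\<mu> - 1) * E \<mu> ?z" by (rule ml_deriv)
  have "((\<lambda>t. E \<mu> (- l * t powr \<alpha>)) has_real_derivative d * (- l * (\<alpha> * t powr (\<alpha> - 1)))) (at t)"
    by (rule DERIV_chain2[where f = "E \<mu>" and g = "\<lambda>t. - l * t powr \<alpha>", OF d]) (use assms in \<open>auto intro!: derivative_eq_intros\<close>)
  moreover have "((\<lambda>t. t powr (\<mu> - 1)) has_real_derivative (\<mu> - 1) * t powr (\<mu> - 2)) (at t)"
    using assms by (auto intro!: derivative_eq_intros)
  ultimately have D: "((\<lambda>t. t powr (\<mu> - 1) * E \<mu> (- l * t powr \<alpha>)) has_real_derivative
     (\<mu> - 1) * t powr (\<mu> - 2) * E \<mu> ?z + d * (- l * (\<alpha> * t powr (\<alpha> - 1))) * t powr (\<mu> - 1)) (at t)"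
    by (rule DERIV_mult[rotated])
  have "t powr (\<alpha> - 1) * t powr (\<mu> - 1) = t powr (\<mu> - 2) * t powr \<alpha>"
    by (simp add: powr_add[symmetric] algebra_simps)
  then have "d * (- l * (\<alpha> * t powr (\<alpha> - 1))) * t powr (\<mu> - 1) = t powr (\<mu> - 2) * (\<alpha> * ?z * d)"
    by algebra
  then have "(\<mu> - 1) * t powr (\<mu> - 2) * E \<mu> ?z + d * (- l * (\<alpha> * t powr (\<alpha> - 1))) * t powr (\<mu> - 1)
      = t powr (\<mu> - 2) * E (\<mu> - 1) ?z"
    unfolding e by algebra
  with D show ?thesis by simp
qed

lemma ml_bound: "\<exists>C>0. \<forall>x\<ge>0. \<bar>E \<mu> (- x)\<bar> \<le> C / (1 + x)"
proof -
  obtain C1 where C1: "C1 > 0" "\<And>x. x > 0 \<Longrightarrow> \<bar>E \<mu> (- x)\<bar> \<le> C1 / x"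
    using mittag_leffler_decay[OF \<alpha>, of \<mu>] by blast
  have "bounded ((\<lambda>x. E \<mu> (- x)) ` {0..1})"
    by (intro compact_imp_bounded compact_continuous_image continuous_intros) auto
  then obtain C2 where C2: "C2 > 0" "\<And>x. x \<in> {0..1} \<Longrightarrow> \<bar>E \<mu> (- x)\<bar> \<le> C2"
    unfolding bounded_pos by auto
  have "\<bar>E \<mu> (- x)\<bar> \<le> (2 * C1 + 2 * C2) / (1 + x)" if "x \<ge> 0" for x
  proof (cases "x \<le> 1")
    case True
    have "\<bar>E \<mu> (- x)\<bar> * (1 + x) \<le> C2 * 2"
      using C2(2)[of x] C2(1) True that by (intro mult_mono) auto
    then show ?thesis using that C1(1) by (simp add: field_simps)
  next
    case False
    have "\<bar>E \<mu> (- x)\<bar> * (1 + x) \<le> C1 / x * (2 * x)"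
      using C1(2)[of x] C1(1) False by (intro mult_mono) auto
    then show ?thesis using False C2(1) by (simp add: field_simps)
  qed
  then show ?thesis using C1(1) C2(1) by (intro exI[of _ "2 * C1 + 2 * C2"]) auto
qed

text \<open>1 / Gamma 0 = 0, so the recurrence at \<mu> = 0 has no constant term, and the decay of
  E_0 yields one more power of x for E_\<alpha>.\<close>

lemma ml_\<alpha>_bound: "\<exists>C>0. \<forall>x>0. \<bar>E \<alpha> (- x)\<bar> \<le> C / x\<^sup>2"
proof -
  obtain C where C: "C > 0" "\<And>x. x > 0 \<Longrightarrow> \<bar>E 0 (- x)\<bar> \<le> C / x"
    using mittag_leffler_decay[OF \<alpha>, of 0] by blast
  have "\<bar>E \<alpha> (- x)\<bar> \<le> C / x\<^sup>2" if "x > 0" for x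
  proof -
    have "E 0 (- x) = - x * E \<alpha> (- x)" using ml_rec[of 0 "- x"] by simp
    then have "x * \<bar>E \<alpha> (- x)\<bar> \<le> C / x" using C(2)[OF that] that by (simp add: abs_mult)
    then show ?thesis using that by (simp add: field_simps power2_eq_square)
  qed
  with C(1) show ?thesis by blast
qed

lemma ml_1_asymptotic: "((\<lambda>x. x * E 1 (- x)) \<longlongrightarrow> 1 / Gamma (1 - \<alpha>)) at_top"
proof -
  obtain C where C: "C > 0" "\<And>x. x > 0 \<Longrightarrow> \<bar>E (1 - \<alpha>) (- x)\<bar> \<le> C / x"
    using mittag_leffler_decay[OF \<alpha>, of "1 - \<alpha>"] by blast
  have "((\<lambda>x. E (1 - \<alpha>) (- x)) \<longlongrightarrow> 0) at_top"
  proof (rule Lim_null_comparison)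
    show "\<forall>\<^sub>F x in at_top. norm (E (1 - \<alpha>) (- x)) \<le> C / x"
      using eventually_gt_at_top[of 0] by eventually_elim (use C in simp)
    show "((\<lambda>x. C / x) \<longlongrightarrow> 0) at_top" by real_asymp
  qed
  then have "((\<lambda>x. 1 / Gamma (1 - \<alpha>) - E (1 - \<alpha>) (- x)) \<longlongrightarrow> 1 / Gamma (1 - \<alpha>) - 0) at_top"
    by (intro tendsto_intros)
  moreover have "1 / Gamma (1 - \<alpha>) - E (1 - \<alpha>) (- x) = x * E 1 (- x)" for x
    using ml_rec[of "1 - \<alpha>" "- x"] by simp
  ultimately show ?thesis by simp
qed

text \<open>\<open>Gamma\<close> is 0 exactly at its poles, and 1 - \<alpha> lies strictly between
  -1 and 0.\<close>

lemma Gamma_1_minus_\<alpha>_nonzero: "Gamma (1 - \<alpha>) \<noteq> 0"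
proof -
  have "1 - \<alpha> \<notin> \<int>"
  proof
    assume "1 - \<alpha> \<in> \<int>"
    then obtain n :: int where "1 - \<alpha> = of_int n" by (metis Ints_cases)
    then have "n < 0" "- 1 < n" using \<alpha> by linarith+
    then show False by simp
  qed
  then show ?thesis using nonpos_Ints_subset_Ints by (auto simp: Gamma_eq_zero_iff)
qed

end

section \<open>Fractional integration of Mittag-Leffler functions\<close>

lemma Beta_integral_scaled:
  fixes a b t :: real
  assumes "a > 0" "b > 0" "t > 0"
  shows "set_integrable lborel {0<..<t} (\<lambda>s. (t - s) powr (b - 1) * s powr (a - 1))"
    and "(LBINT s:{0<..<t}. (t - s) powr (b - 1) * s powr (a - 1)) = t powr (a + b - 1) * Beta a b"
proof -
  let ?f = "\<lambda>s. indicator {0<..<t} s *\<^sub>R ((t - s) powr (b - 1) * s powr (a - 1))"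
  let ?g = "\<lambda>x. x powr (a - 1) * (1 - x) powr (b - 1)"
  have int01: "set_integrable lborel {0<..<1} ?g"
    by (rule set_integrable_subset[OF integrable_Beta[OF assms(1,2)]]) auto
  have val01: "(LBINT x:{0<..<1}. ?g x) = Beta a b"
    using has_integral_Beta_real[OF assms(1,2)] set_borel_integral_eq_integral(2)[OF int01]
    by (simp add: has_integral_Icc_iff_Ioo integral_unique)
  have fg: "?f (0 + t * x) = t powr (a + b - 2) * (indicator {0<..<1} x *\<^sub>R ?g x)" for x
  proof (cases "0 < x \<and> x < 1")
    case True
    have "t - t * x = t * (1 - x)" by (simp add: algebra_simps)
    then have "(t - t * x) powr (b - 1) * (t * x) powr (a - 1)
        = (t powr (b - 1) * t powr (a - 1)) * (x powr (a - 1) * (1 - x) powr (b - 1))"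
      using True assms by (simp add: powr_mult)
    also have "t powr (b - 1) * t powr (a - 1) = t powr (a + b - 2)"
      by (simp add: powr_add[symmetric] add_ac)
    finally show ?thesis using True assms by (simp add: indicator_def)
  next
    case False
    then have "\<not> (0 < t * x \<and> t * x < t)" using assms by (simp add: zero_less_mult_iff)
    then show ?thesis using False by (auto simp: indicator_def)
  qed
  have "integrable lborel (\<lambda>x. ?f (0 + t * x))"
    unfolding fg using int01 by (simp add: set_integrable_def)
  then show "set_integrable lborel {0<..<t} (\<lambda>s. (t - s) powr (b - 1) * s powr (a - 1))"
    unfolding set_integrable_def using lborel_integrable_real_affine_iff[of t ?f 0] assms by simp
  have "(LBINT s. ?f s) = \<bar>t\<bar> *\<^sub>R (LBINT x. ?f (0 + t * x))"
    by (rule lborel_integral_real_affine) (use assms in simp)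
  also have "\<dots> = t * (t powr (a + b - 2) * Beta a b)"
    unfolding fg using val01 assms by (simp add: set_lebesgue_integral_def)
  also have "\<dots> = t powr (a + b - 1) * Beta a b"
    using assms powr_add[of t 1 "a + b - 2"] by simp
  finally show "(LBINT s:{0<..<t}. (t - s) powr (b - 1) * s powr (a - 1)) = t powr (a + b - 1) * Beta a b"
    by (simp add: set_lebesgue_integral_def)
qed

context caputo_order
begin

text \<open>In each term the Beta integral replaces \<Gamma>(\<alpha>k + \<mu>) by
  \<Gamma>(\<alpha>k + \<mu> + \<beta>), so a Riemann-Liouville integral of order \<beta> raises the
  second index by \<beta>.\<close>

lemma ml_fractional_integral:
  fixes \<beta> \<mu> t l :: real
  assumes "\<beta> > 0" "\<mu> > 0" "t > 0"
  defines "f \<equiv> \<lambda>s. (t - s) powr (\<beta> - 1) * (s powr (\<mu> - 1) * E \<mu> (- l * s powr \<alpha>))"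
  shows "set_integrable lborel {0<..<t} f"
    and "(LBINT s:{0<..<t}. f s) = Gamma \<beta> * (t powr (\<mu> + \<beta> - 1) * E (\<mu> + \<beta>) (- l * t powr \<alpha>))"
proof -
  define g where "g k s = (- l) ^ k / Gamma (\<alpha> * real k + \<mu>) * (indicator {0<..<t} s *\<^sub>R
    ((t - s) powr (\<beta> - 1) * s powr (\<alpha> * real k + \<mu> - 1)))" for k s
  have pos: "\<alpha> * real k + \<mu> > 0" for k using \<alpha> assms by (simp add: add_nonneg_pos)
  have int: "integrable lborel (g k)" for k
    using Beta_integral_scaled(1)[OF pos[of k] assms(1,3)] unfolding g_def[abs_def] set_integrable_def
    by (intro integrable_mult_right)
  have Beta_eq: "Beta (\<alpha> * real k + \<mu>) \<beta> / Gamma (\<alpha> * real k + \<mu>) = Gamma \<beta> / Gamma (\<alpha> * real k + (\<mu> + \<beta>))" for k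
    using less_imp_neq[OF Gamma_real_pos[OF pos[of k]]] by (simp add: Beta_def add.assoc)
  have tk: "t powr (\<alpha> * real k + \<mu> + \<beta> - 1) = t powr (\<mu> + \<beta> - 1) * (t powr \<alpha>) ^ k" for k
    using assms by (simp add: powr_add[symmetric] powr_powr powr_realpow[symmetric] algebra_simps)
  have val: "(LBINT s. c * (indicator {0<..<t} s *\<^sub>R
      ((t - s) powr (\<beta> - 1) * s powr (\<alpha> * real k + \<mu> - 1)))) = c * (t powr (\<alpha> * real k + \<mu> + \<beta> - 1) * Beta (\<alpha> * real k + \<mu>) \<beta>)" for c k
    using Beta_integral_scaled(2)[OF pos[of k] assms(1,3)] by (simp add: set_lebesgue_integral_def)
  have valg: "(LBINT s. g k s) = Gamma \<beta> * t powr (\<mu> + \<beta> - 1) * ((- l * t powr \<alpha>) ^ k / Gamma (\<alpha> * real k + (\<mu> + \<beta>)))" for k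
  proof -
    have "(LBINT s. g k s) = (- l) ^ k * t powr (\<alpha> * real k + \<mu> + \<beta> - 1) * (Beta (\<alpha> * real k + \<mu>) \<beta> / Gamma (\<alpha> * real k + \<mu>))"
      unfolding g_def val by simp
    then show ?thesis unfolding Beta_eq tk power_mult_distrib[of "- l" "t powr \<alpha>" k] by (simp add: mult_ac)
  qed
  \<comment> \<open>Each term has constant sign in s, so its L1 norm is the modulus of its integral,
    and summability of the norms is absolute convergence of the series of index \<mu> +
    \<beta>.\<close>
  have valabs: "(LBINT s. norm (g k s)) = \<bar>LBINT s. g k s\<bar>" for k
  proof -
    have "norm (g k s) = \<bar>(- l) ^ k / Gamma (\<alpha> * real k + \<mu>)\<bar> * (indicator {0<..<t} s *\<^sub>R
      ((t - s) powr (\<beta> - 1) * s powr (\<alpha> * real k + \<mu> - 1)))" for s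
      by (simp add: g_def abs_mult)
    then have "(LBINT s. norm (g k s)) = \<bar>(- l) ^ k / Gamma (\<alpha> * real k + \<mu>)\<bar> *
        (t powr (\<alpha> * real k + \<mu> + \<beta> - 1) * Beta (\<alpha> * real k + \<mu>) \<beta>)"
      by (simp only: val)
    moreover have "Beta (\<alpha> * real k + \<mu>) \<beta> \<ge> 0"
      using pos[of k] assms by (simp add: Beta_def Gamma_real_nonneg)
    ultimately show ?thesis unfolding g_def val by (simp add: abs_mult)
  qed
  have sm1: "summable (\<lambda>k. norm (g k s))" for s
  proof (cases "0 < s \<and> s < t")
    case True
    have "norm (g k s) = (t - s) powr (\<beta> - 1) * s powr (\<mu> - 1) * \<bar>(- l * s powr \<alpha>) ^ k / Gamma (\<alpha> * real k + \<mu>)\<bar>" for k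
    proof -
      have "s powr (\<alpha> * real k + \<mu> - 1) = s powr (\<mu> - 1) * (s powr \<alpha>) ^ k"
        using True by (simp add: powr_add[symmetric] powr_powr powr_realpow[symmetric] algebra_simps)
      then show ?thesis using True by (simp add: g_def abs_mult power_mult_distrib)
    qed
    then show ?thesis using summable_mult[OF ml_abs_summable] by simp
  qed (auto simp: g_def indicator_def)
  have sm2: "summable (\<lambda>k. LBINT s. norm (g k s))"
    unfolding valabs valg abs_mult[of "Gamma \<beta> * t powr (\<mu> + \<beta> - 1)"] by (intro summable_mult ml_abs_summable)
  have gsum: "(\<Sum>k. g k s) = indicator {0<..<t} s *\<^sub>R f s" for s
  proof (cases "0 < s \<and> s < t")
    case True
    have "g k s = (t - s) powr (\<beta> - 1) * s powr (\<mu> - 1) * ((- l * s powr \<alpha>) ^ k / Gamma (\<alpha> * real k + \<mu>))" for k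
    proof -
      have "s powr (\<alpha> * real k + \<mu> - 1) = s powr (\<mu> - 1) * (s powr \<alpha>) ^ k"
        using True by (simp add: powr_add[symmetric] powr_powr powr_realpow[symmetric] algebra_simps)
      then show ?thesis using True unfolding power_mult_distrib[of "- l" "s powr \<alpha>" k] by (simp add: g_def mult_ac)
    qed
    then have "(\<lambda>k. g k s) sums ((t - s) powr (\<beta> - 1) * s powr (\<mu> - 1) * E \<mu> (- l * s powr \<alpha>))"
      by (simp only: sums_mult ml_sums)
    then show ?thesis using True by (simp add: sums_iff f_def)
  qed (auto simp: g_def indicator_def)
  have "integrable lborel (\<lambda>s. \<Sum>k. g k s)"
    by (rule integrable_suminf[OF int AE_I2[OF sm1] sm2])
  then show "set_integrable lborel {0<..<t} f" unfolding gsum set_integrable_def .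
  have "(\<lambda>k. LBINT s. g k s) sums (LBINT s. (\<Sum>k. g k s))"
    by (rule sums_integral[OF int AE_I2[OF sm1] sm2])
  then have "(\<lambda>k. LBINT s. g k s) sums (LBINT s:{0<..<t}. f s)"
    unfolding gsum set_lebesgue_integral_def .
  moreover have "(\<lambda>k. LBINT s. g k s) sums (Gamma \<beta> * t powr (\<mu> + \<beta> - 1) * E (\<mu> + \<beta>) (- l * t powr \<alpha>))"
    unfolding valg by (intro sums_mult ml_sums)
  ultimately show "(LBINT s:{0<..<t}. f s) = Gamma \<beta> * (t powr (\<mu> + \<beta> - 1) * E (\<mu> + \<beta>) (- l * t powr \<alpha>))"
    using sums_unique2 by fastforce
qed

end

subsection \<open>The scalar fractional equation\<close>

text \<open>The difference quotient at 0 is g itself. This gives the one-sided derivatives at 0 once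
  a factor t is split off.\<close>

lemma has_field_derivative_mult_self_at_0:
  fixes g :: "real \<Rightarrow> real"
  assumes "(g \<longlongrightarrow> g 0) (at 0 within S)"
  shows "((\<lambda>t. t * g t) has_field_derivative g 0) (at 0 within S)"
  unfolding has_field_derivative_iff
proof (rule Lim_transform_eventually[OF assms])
  show "\<forall>\<^sub>F x in at 0 within S. g x = (x * g x - 0 * g 0) / (x - 0)"
    unfolding eventually_at_filter by (auto intro: always_eventually)
qed

context caputo_order
begin

text \<open>
  The three fundamental solutions of the scalar equation \<open>\<partial>\<^sup>\<alpha>y + l y = g\<close>, belonging to \<open>y(0)\<close>,
  \<open>y'(0)\<close> and \<open>g\<close>, and the common derivative \<open>ml_p\<close> of \<open>ml_k\<close> and of \<open>- ml_c / l\<close>.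
\<close>

definition "ml_c l t = E 1 (- l * t powr \<alpha>)"
definition "ml_s l t = t * E 2 (- l * t powr \<alpha>)"
definition "ml_k l t = t powr \<alpha> * E (\<alpha> + 1) (- l * t powr \<alpha>)"
definition "ml_p l t = t powr (\<alpha> - 1) * E \<alpha> (- l * t powr \<alpha>)"
definition "ml_q l t = t powr (\<alpha> - 2) * E (\<alpha> - 1) (- l * t powr \<alpha>)"

lemma ml_c_eq: "ml_c l t = 1 - l * ml_k l t"
  using ml_rec[of 1 "- l * t powr \<alpha>"] by (simp add: ml_c_def ml_k_def add.commute)

lemma ml_at_0 [simp]: "ml_c l 0 = 1" "ml_s l 0 = 0" "ml_k l 0 = 0" "ml_p l 0 = 0"
  using \<alpha> by (simp_all add: ml_c_def ml_s_def ml_k_def ml_p_def ml_0)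

lemma continuous_on_ml_parts:
  shows "continuous_on {0..} (ml_c l)" "continuous_on {0..} (ml_s l)"
    "continuous_on {0..} (ml_k l)" "continuous_on {0..} (ml_p l)"
  unfolding ml_c_def[abs_def] ml_s_def[abs_def] ml_k_def[abs_def] ml_p_def[abs_def] using \<alpha>
  by (intro continuous_intros continuous_on_powr'; auto)+

lemma ml_s_deriv:
  assumes "t \<ge> 0"
  shows "(ml_s l has_real_derivative ml_c l t) (at t within {0..})"
proof (cases "t = 0")
  case True
  have "continuous_on {0..} (\<lambda>t. E 2 (- l * t powr \<alpha>))"
    using \<alpha> by (intro continuous_intros continuous_on_powr') auto
  then have "((\<lambda>t. E 2 (- l * t powr \<alpha>)) \<longlongrightarrow> E 2 (- l * 0 powr \<alpha>)) (at 0 within {0..})"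
    unfolding continuous_on_def by (rule bspec[where x = 0]) simp
  then show ?thesis
    using has_field_derivative_mult_self_at_0[of "\<lambda>t. E 2 (- l * t powr \<alpha>)" "{0..}"] True
    by (simp add: ml_s_def[abs_def] ml_0 Gamma_numeral)
next
  case False
  with assms have t: "t > 0" by simp
  have "(ml_s l has_real_derivative ml_c l t) (at t)"
  proof (rule has_field_derivative_transform_within_open[where S = "{0<..}"])
    show "((\<lambda>t. t powr (2 - 1) * E 2 (- l * t powr \<alpha>)) has_real_derivative ml_c l t) (at t)"
      using power_ml_deriv[OF t, of 2 l] t by (simp add: ml_c_def)
  qed (use t in \<open>auto simp: ml_s_def\<close>)
  then show ?thesis by (rule has_field_derivative_at_within)
qed

lemma ml_k_deriv:
  assumes "t \<ge> 0"
  shows "(ml_k l has_real_derivative ml_p l t) (at t within {0..})"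
proof (cases "t = 0")
  case True
  let ?g = "\<lambda>t. t powr (\<alpha> - 1) * E (\<alpha> + 1) (- l * t powr \<alpha>)"
  have "continuous_on {0..} ?g"
    using \<alpha> by (intro continuous_intros continuous_on_powr') auto
  then have "(?g \<longlongrightarrow> ?g 0) (at 0 within {0..})"
    unfolding continuous_on_def by (rule bspec[where x = 0]) simp
  then have D: "((\<lambda>t. t * ?g t) has_real_derivative ?g 0) (at 0 within {0..})"
    by (rule has_field_derivative_mult_self_at_0)
  have e: "t * ?g t = ml_k l t" if "t \<in> {0..}" for t
    using that powr_add[of t 1 "\<alpha> - 1"] by (cases "t = 0") (auto simp: ml_k_def)
  have "(ml_k l has_real_derivative ?g 0) (at 0 within {0..})"
    by (rule has_field_derivative_transform_within[OF D, where d = 1]) (use e in auto)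
  then show ?thesis using True by (simp add: ml_p_def)
next
  case False
  with assms have t: "t > 0" by simp
  have "(ml_k l has_real_derivative ml_p l t) (at t)"
    using power_ml_deriv[OF t, of "\<alpha> + 1" l] by (simp add: ml_k_def[abs_def] ml_p_def)
  then show ?thesis by (rule has_field_derivative_at_within)
qed

lemma ml_c_deriv:
  assumes "t \<ge> 0"
  shows "(ml_c l has_real_derivative - l * ml_p l t) (at t within {0..})"
  unfolding ml_c_eq[abs_def] using ml_k_deriv[OF assms, of l]
  by (auto intro!: derivative_eq_intros)

text \<open>The derivative behaves like t^(\<alpha> - 2) at 0: it is unbounded there, whence t > 0,
  but integrable because \<alpha> > 1.\<close>

lemma ml_p_deriv:
  assumes "t > 0"
  shows "(ml_p l has_real_derivative ml_q l t) (at t)"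
  using power_ml_deriv[OF assms, of \<alpha> l] by (simp add: ml_p_def[abs_def] ml_q_def)

lemma continuous_on_ml_q: "continuous_on {0<..} (ml_q l)"
  unfolding ml_q_def[abs_def] by (intro continuous_intros) auto

text \<open>Integration against the Caputo kernel is fractional integration of order 2 - \<alpha>:
  it raises the index \<alpha> - 1 of \<open>ml_q\<close> to 1, and in \<open>caputo_ml_p\<close>
  the index \<alpha> of \<open>ml_p\<close> to 2.\<close>

lemma caputo_ml_q:
  assumes "t > 0"
  shows "set_integrable lborel {0<..<t} (\<lambda>s. (t - s) powr (1 - \<alpha>) * ml_q l s)"
    and "(LBINT s:{0<..<t}. (t - s) powr (1 - \<alpha>) * ml_q l s) = Gamma (2 - \<alpha>) * ml_c l t"
  using ml_fractional_integral[of "2 - \<alpha>" "\<alpha> - 1" t l] \<alpha> assms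
  by (simp_all add: ml_q_def ml_c_def)

lemma caputo_ml_p:
  assumes "t > 0"
  shows "set_integrable lborel {0<..<t} (\<lambda>s. (t - s) powr (1 - \<alpha>) * ml_p l s)"
    and "(LBINT s:{0<..<t}. (t - s) powr (1 - \<alpha>) * ml_p l s) = Gamma (2 - \<alpha>) * ml_s l t"
  using ml_fractional_integral[of "2 - \<alpha>" "\<alpha>" t l] \<alpha> assms
  by (simp_all add: ml_p_def ml_s_def)

lemma ml_p_measurable [measurable]: "ml_p l \<in> borel_measurable borel"
proof -
  have [measurable]: "E \<alpha> \<in> borel_measurable borel"
    using continuous_on_ml[OF continuous_on_id, of UNIV \<alpha>] by (intro borel_measurable_continuous_onI) simp
  show ?thesis unfolding ml_p_def[abs_def] by measurable
qed

text \<open>Pairing \<open>y''\<close> with the solution \<open>ml_p\<close> of the adjoint equation by Fubini.\<close>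

lemma caputo_adjoint:
  fixes z :: "real \<Rightarrow> real"
  assumes t: "t > 0" and z: "set_integrable lborel {0<..<t} z"
  shows "set_integrable lborel {0<..<t} (\<lambda>r. z r * ml_s l (t - r))"
    and "(LBINT s:{0<..<t}. ml_p l (t - s) * (LBINT r:{0<..<s}. (s - r) powr (1 - \<alpha>) * z r))
       = Gamma (2 - \<alpha>) * (LBINT r:{0<..<t}. z r * ml_s l (t - r))"
proof -
  define w where "w r = indicator {0<..<t} r *\<^sub>R z r" for r
  have w: "integrable lborel w" using z by (simp add: w_def[abs_def] set_integrable_def)
  have [measurable]: "w \<in> borel_measurable borel" using borel_measurable_integrable[OF w] by simp
  have bnd: "\<exists>M>0. \<forall>s\<in>{0..t}. \<bar>f s\<bar> \<le> M" if "continuous_on {0..} f" for f :: "real \<Rightarrow> real"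
  proof -
    have "continuous_on {0..t} f" using that by (rule continuous_on_subset) auto
    then have "bounded (f ` {0..t})" by (intro compact_imp_bounded compact_continuous_image) auto
    then show ?thesis unfolding bounded_pos by auto
  qed
  obtain M where M: "M > 0" "\<And>s. s \<in> {0..t} \<Longrightarrow> \<bar>ml_p l s\<bar> \<le> M"
    using bnd[OF continuous_on_ml_parts(4)] by blast
  obtain N where N: "N > 0" "\<And>s. s \<in> {0..t} \<Longrightarrow> \<bar>ml_s l s\<bar> \<le> N"
    using bnd[OF continuous_on_ml_parts(2)] by blast
  \<comment> \<open>The double integral lives on the triangle 0 < r < s < t; the constraint 0 < r is
    contained in \<open>w\<close>.\<close>
  define F where "F r s = (if r < s \<and> s < t then w r * (ml_p l (t - s) * (s - r) powr (1 - \<alpha>)) else 0)" for r s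
  have [measurable]: "case_prod F \<in> borel_measurable (lborel \<Otimes>\<^sub>M lborel)"
    unfolding F_def[abs_def] by measurable
  have reflect: "(LBINT s. indicator {r<..<t} s *\<^sub>R g (t - s)) = (LBINT s:{0<..<t - r}. g s)"
    and reflect_int: "set_integrable lborel {0<..<t - r} g \<Longrightarrow> integrable lborel (\<lambda>s. indicator {r<..<t} s *\<^sub>R g (t - s))"
    for r and g :: "real \<Rightarrow> real"
  proof -
    have e: "indicator {0<..<t - r} (t + (- 1) * s) *\<^sub>R g (t + (- 1) * s) = indicator {r<..<t} s *\<^sub>R g (t - s)" for s
      by (auto simp: indicator_def)
    show "(LBINT s. indicator {r<..<t} s *\<^sub>R g (t - s)) = (LBINT s:{0<..<t - r}. g s)"
      unfolding set_lebesgue_integral_def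
      using lborel_integral_real_affine[of "-1" "\<lambda>s. indicator {0<..<t - r} s *\<^sub>R g s" t] unfolding e by simp
    show "integrable lborel (\<lambda>s. indicator {r<..<t} s *\<^sub>R g (t - s))" if "set_integrable lborel {0<..<t - r} g"
      using that lborel_integrable_real_affine[of "\<lambda>s. indicator {0<..<t - r} s *\<^sub>R g s" "-1" t]
      unfolding set_integrable_def e by simp
  qed
  define \<phi> where "\<phi> r q = (t - r - q) powr (1 - \<alpha>) * ml_p l q" for r q
  \<comment> \<open>A majorant of |\<phi>|; the factor \<open>q powr (1 - 1)\<close> is 1 for q > 0
    and brings it into the form of \<open>Beta_integral_scaled\<close> with a = 1.\<close>
  define upb where "upb r q = M * ((t - r - q) powr (1 - \<alpha>) * q powr (1 - 1))" for r q
  have Feq: "F r s = w r * (indicator {r<..<t} s *\<^sub>R \<phi> r (t - s))" for r s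
    by (auto simp: F_def \<phi>_def indicator_def)
  have Fint: "integrable lborel (F r)" and Fval: "(LBINT s. F r s) = Gamma (2 - \<alpha>) * (w r * ml_s l (t - r))"
    for r
  proof -
    have "integrable lborel (F r) \<and> (LBINT s. F r s) = Gamma (2 - \<alpha>) * (w r * ml_s l (t - r))"
    proof (cases "0 < r \<and> r < t")
      case True
      then have tr: "t - r > 0" by simp
      have "integrable lborel (F r)"
        unfolding Feq[abs_def]
        by (intro integrable_mult_right reflect_int) (simp only: \<phi>_def caputo_ml_p(1)[OF tr])
      moreover have "(LBINT s. F r s) = w r * (LBINT s. indicator {r<..<t} s *\<^sub>R \<phi> r (t - s))"
        unfolding Feq by (rule integral_mult_right_zero)
      moreover have "\<dots> = w r * (Gamma (2 - \<alpha>) * ml_s l (t - r))"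
        proof -
        have "(LBINT q:{0<..<t - r}. \<phi> r q) = Gamma (2 - \<alpha>) * ml_s l (t - r)"
          unfolding \<phi>_def by (rule caputo_ml_p(2)[OF tr])
        then show ?thesis by (simp only: reflect)
      qed
      ultimately show ?thesis by simp
    next
      case False
      then have "w r = 0" by (simp add: w_def)
      moreover from this have "F r = (\<lambda>s. 0)" by (auto simp: F_def fun_eq_iff)
      ultimately show ?thesis by simp
    qed
    then show "integrable lborel (F r)" "(LBINT s. F r s) = Gamma (2 - \<alpha>) * (w r * ml_s l (t - r))"
      by auto
  qed
  define B where "B = M * (t powr (2 - \<alpha>) * Beta 1 (2 - \<alpha>))"
  have Fnorm: "(LBINT s. norm (F r s)) \<le> B * \<bar>w r\<bar>" for r
  proof (cases "0 < r \<and> r < t")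
    case True
    then have tr: "t - r > 0" by simp
    have bi: "set_integrable lborel {0<..<t - r} (upb r)"
      unfolding upb_def[abs_def] using Beta_integral_scaled(1)[of 1 "2 - \<alpha>" "t - r"] \<alpha> tr by (intro set_integrable_mult_right) simp
    have bv: "(LBINT q:{0<..<t - r}. upb r q) = M * ((t - r) powr (2 - \<alpha>) * Beta 1 (2 - \<alpha>))"
      unfolding upb_def using Beta_integral_scaled(2)[of 1 "2 - \<alpha>" "t - r"] \<alpha> tr by simp
    have "(LBINT s. norm (F r s)) \<le> (LBINT s. \<bar>w r\<bar> *
        (indicator {r<..<t} s *\<^sub>R upb r (t - s)))"
    proof (rule integral_mono)
      show "integrable lborel (\<lambda>s. norm (F r s))" using Fint by (rule integrable_norm)
      show "integrable lborel (\<lambda>s. \<bar>w r\<bar> *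
        (indicator {r<..<t} s *\<^sub>R upb r (t - s)))"
        by (intro integrable_mult_right reflect_int bi)
      fix s
      show "norm (F r s) \<le> \<bar>w r\<bar> *
        (indicator {r<..<t} s *\<^sub>R upb r (t - s))"
      proof (cases "r < s \<and> s < t")
        case s: True
        have "\<bar>ml_p l (t - s)\<bar> * (s - r) powr (1 - \<alpha>) \<le> M * (s - r) powr (1 - \<alpha>)"
          using M(2)[of "t - s"] s True by (intro mult_right_mono) auto
        then show ?thesis using s by (simp add: F_def upb_def abs_mult mult_left_mono)
      qed (auto simp: F_def)
    qed
    also have "\<dots> = \<bar>w r\<bar> * (M * ((t - r) powr (2 - \<alpha>) * Beta 1 (2 - \<alpha>)))"
      unfolding integral_mult_right_zero reflect bv ..
    also have "\<dots> \<le> \<bar>w r\<bar> * B"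
      unfolding B_def using M(1) \<alpha> True
      by (intro mult_left_mono mult_right_mono powr_mono2) (auto simp: Beta_def Gamma_real_nonneg)
    finally show ?thesis by (simp add: mult.commute)
  next
    case False
    then have "w r = 0" by (simp add: w_def)
    moreover from this have "F r s = 0" for s by (simp add: F_def)
    ultimately show ?thesis by simp
  qed
  have prod_int: "integrable (lborel \<Otimes>\<^sub>M lborel) (case_prod F)"
  proof (rule lborel_pair.Fubini_integrable)
    show "integrable lborel (\<lambda>r. LBINT s. norm (case_prod F (r, s)))"
    proof (rule Bochner_Integration.integrable_bound)
      show "integrable lborel (\<lambda>r. B * \<bar>w r\<bar>)" using w by (intro integrable_mult_right integrable_abs)
      show "AE r in lborel. norm (LBINT s. norm (case_prod F (r, s))) \<le> norm (B * \<bar>w r\<bar>)"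
      proof (rule AE_I2)
        fix r
        have "0 \<le> (LBINT s. norm (F r s))" by (rule integral_nonneg_AE) simp
        then show "norm (LBINT s. norm (case_prod F (r, s))) \<le> norm (B * \<bar>w r\<bar>)"
          using Fnorm[of r] by simp
      qed
    qed measurable
    show "AE r in lborel. integrable lborel (\<lambda>s. case_prod F (r, s))" using Fint by simp
  qed measurable
  have sw: "set_integrable lborel {0<..<t} (\<lambda>r. z r * ml_s l (t - r))"
    unfolding set_integrable_def
  proof (rule Bochner_Integration.integrable_bound)
    show "integrable lborel (\<lambda>r. N * \<bar>w r\<bar>)" using w by (intro integrable_mult_right integrable_abs)
    have "(\<lambda>r. indicator {0<..<t} r *\<^sub>R ml_s l (t - r)) \<in> borel_measurable borel"
      by (intro borel_measurable_continuous_on_indicator continuous_on_compose2[OF continuous_on_ml_parts(2)])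
        (auto intro!: continuous_intros)
    then have "(\<lambda>r. w r * (indicator {0<..<t} r *\<^sub>R ml_s l (t - r))) \<in> borel_measurable lborel" by simp
    moreover have "w r * (indicator {0<..<t} r *\<^sub>R ml_s l (t - r)) = indicator {0<..<t} r *\<^sub>R (z r * ml_s l (t - r))" for r
      by (simp add: w_def indicator_def)
    ultimately show "(\<lambda>r. indicator {0<..<t} r *\<^sub>R (z r * ml_s l (t - r))) \<in> borel_measurable lborel" by (simp only:)
    show "AE r in lborel. norm (indicator {0<..<t} r *\<^sub>R (z r * ml_s l (t - r))) \<le> norm (N * \<bar>w r\<bar>)"
    proof (rule AE_I2)
      fix r
      show "norm (indicator {0<..<t} r *\<^sub>R (z r * ml_s l (t - r))) \<le> norm (N * \<bar>w r\<bar>)"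
      proof (cases "r \<in> {0<..<t}")
        case True
        then have "\<bar>ml_s l (t - r)\<bar> * \<bar>z r\<bar> \<le> N * \<bar>z r\<bar>"
          using N(2)[of "t - r"] by (intro mult_right_mono) auto
        then show ?thesis using True N(1) by (simp add: w_def abs_mult mult.commute)
      qed (simp add: w_def)
    qed
  qed
  then show "set_integrable lborel {0<..<t} (\<lambda>r. z r * ml_s l (t - r))" .
  have "(LBINT s:{0<..<t}. ml_p l (t - s) * (LBINT r:{0<..<s}. (s - r) powr (1 - \<alpha>) * z r))
      = (LBINT s. (LBINT r. F r s))"
    unfolding set_lebesgue_integral_def[of lborel "{0<..<t}"]
  proof (rule Bochner_Integration.integral_cong[OF refl])
    fix s
    show "indicator {0<..<t} s *\<^sub>R (ml_p l (t - s) * (LBINT r:{0<..<s}. (s - r) powr (1 - \<alpha>) * z r))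
        = (LBINT r. F r s)"
    proof (cases "0 < s \<and> s < t")
      case True
      have "F r s = ml_p l (t - s) * (indicator {0<..<s} r *\<^sub>R ((s - r) powr (1 - \<alpha>) * z r))" for r
        using True by (auto simp: F_def w_def indicator_def)
      then have "(LBINT r. F r s) = ml_p l (t - s) * (LBINT r:{0<..<s}. (s - r) powr (1 - \<alpha>) * z r)"
        unfolding set_lebesgue_integral_def by (simp only: integral_mult_right_zero)
      then show ?thesis using True by simp
    next
      case False
      then have "F r s = 0" for r by (auto simp: F_def w_def)
      then show ?thesis using False by auto
    qed
  qed
  also have "\<dots> = (LBINT r. (LBINT s. F r s))"
    by (rule lborel_pair.Fubini_integral[OF prod_int])
  also have "\<dots> = Gamma (2 - \<alpha>) * (LBINT r. w r * ml_s l (t - r))"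
    unfolding Fval by (rule integral_mult_right_zero)
  also have "(LBINT r. w r * ml_s l (t - r)) = (LBINT r:{0<..<t}. z r * ml_s l (t - r))"
    unfolding set_lebesgue_integral_def w_def by (simp add: mult.assoc)
  finally show "(LBINT s:{0<..<t}. ml_p l (t - s) * (LBINT r:{0<..<s}. (s - r) powr (1 - \<alpha>) * z r))
       = Gamma (2 - \<alpha>) * (LBINT r:{0<..<t}. z r * ml_s l (t - r))" .
qed

lemma caputo_scalar_unique:
  fixes y y1 y2 :: "real \<Rightarrow> real"
  assumes t: "t > 0"
    and cont: "continuous_on {0..t} y" "continuous_on {0..t} y1"
    and deriv: "\<And>s. s \<in> {0<..<t} \<Longrightarrow> (y has_real_derivative y1 s) (at s)"
      "\<And>s. s \<in> {0<..<t} \<Longrightarrow> (y1 has_real_derivative y2 s) (at s)"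
    and int: "set_integrable lborel {0<..<t} y2"
    and eq: "\<And>s. s \<in> {0<..<t} \<Longrightarrow>
      (LBINT r:{0<..<s}. (s - r) powr (1 - \<alpha>) * y2 r) = Gamma (2 - \<alpha>) * (g - l * y s)"
  shows "y t = y 0 * ml_c l t + y1 0 * ml_s l t + g * ml_k l t"
proof -
  \<comment> \<open>The values of the fundamental solutions at 0 give P t = y t, and P 0 is the
    claimed right-hand side; so the aim is that the derivative of \<open>P\<close> has integral 0
    over (0, t).\<close>
  define P where "P s = y1 s * ml_s l (t - s) + y s * ml_c l (t - s) + g * ml_k l (t - s)" for s
  define h where "h s = ml_p l (t - s) * (g - l * y s)" for s
  have contc: "continuous_on {0..t} (\<lambda>s. f (t - s))" if "continuous_on {0..} f" for f :: "real \<Rightarrow> real"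
    by (rule continuous_on_compose2[OF that]) (auto intro!: continuous_intros)
  have dP: "(P has_vector_derivative y2 s * ml_s l (t - s) - h s) (at s)" if s: "s \<in> {0<..<t}" for s
  proof -
    have ch: "((\<lambda>s. f (t - s)) has_real_derivative - d) (at s)"
      if "(f has_real_derivative d) (at (t - s) within {0..})" for f d
    proof -
      have "(f has_real_derivative d) (at (t - s))"
        using that s at_within_interior[of "t - s" "{0..}"] by auto
      moreover have "((\<lambda>s. t - s) has_real_derivative - 1) (at s)"
        by (auto intro!: derivative_eq_intros)
      ultimately show ?thesis
        using DERIV_chain2[where f = f and g = "\<lambda>s. t - s" and x = s and s = UNIV] by fastforce
    qed
    have "t - s \<ge> 0" using s by simp
    then have dd: "((\<lambda>s. ml_s l (t - s)) has_real_derivative - ml_c l (t - s)) (at s)"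
      "((\<lambda>s. ml_c l (t - s)) has_real_derivative - (- l * ml_p l (t - s))) (at s)"
      "((\<lambda>s. ml_k l (t - s)) has_real_derivative - ml_p l (t - s)) (at s)"
      by (intro ch ml_s_deriv ml_c_deriv ml_k_deriv; simp)+
    show ?thesis
      unfolding P_def h_def has_real_derivative_iff_has_vector_derivative[symmetric]
      by (auto intro!: derivative_eq_intros deriv[OF s] dd simp: algebra_simps)
  qed
  have cP: "continuous_on {0..t} P"
    unfolding P_def by (intro continuous_intros cont contc continuous_on_ml_parts)
  \<comment> \<open>\<open>y2\<close> may be unbounded near the ends, hence the fundamental theorem
    with derivatives only inside the interval.\<close>
  have "((\<lambda>s. y2 s * ml_s l (t - s) - h s) has_integral (P t - P 0)) {0..t}"
    by (rule fundamental_theorem_of_calculus_interior)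
      (use t dP cP in auto)
  then have I1: "((\<lambda>s. y2 s * ml_s l (t - s) - h s) has_integral (P t - P 0)) {0<..<t}"
    by (simp add: has_integral_Icc_iff_Ioo)
  have "continuous_on {0..t} h"
    unfolding h_def by (intro continuous_intros cont contc continuous_on_ml_parts)
  then have "set_integrable lborel {0..t} h" by (rule borel_integrable_atLeastAtMost')
  then have h: "set_integrable lborel {0<..<t} h" by (rule set_integrable_subset) auto
  note ad = caputo_adjoint[OF t int, of l]
  have G: "Gamma (2 - \<alpha>) > 0" using \<alpha> by (intro Gamma_real_pos) auto
  \<comment> \<open>By the equation the inner integral is \<open>Gamma (2 - \<alpha>)\<close> times
    the factor \<open>g - l * y s\<close> of \<open>h\<close>, so \<open>caputo_adjoint\<close>
    trades the integral of \<open>h\<close> for that of \<open>y2\<close> against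
    \<open>ml_s\<close>.\<close>
  have "(LBINT s:{0<..<t}. ml_p l (t - s) * (LBINT r:{0<..<s}. (s - r) powr (1 - \<alpha>) * y2 r))
     = (LBINT s:{0<..<t}. Gamma (2 - \<alpha>) * h s)"
    by (rule set_lebesgue_integral_cong) (auto simp: eq h_def)
  also have "\<dots> = Gamma (2 - \<alpha>) * (LBINT s:{0<..<t}. h s)" by (rule set_integral_mult_right)
  finally have "(LBINT s:{0<..<t}. h s) = (LBINT r:{0<..<t}. y2 r * ml_s l (t - r))"
    using ad(2) G by simp
  then have "(LBINT s:{0<..<t}. y2 s * ml_s l (t - s) - h s) = 0"
    using set_integral_diff(2)[OF ad(1) h] by simp
  moreover have "(LBINT s:{0<..<t}. y2 s * ml_s l (t - s) - h s) = P t - P 0"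
    using set_borel_integral_eq_integral(2)[OF set_integral_diff(1)[OF ad(1) h]] integral_unique[OF I1] by simp
  ultimately show ?thesis by (simp add: P_def)
qed

end

subsection \<open>Orthonormal expansions\<close>

locale orthonormal_basis =
  fixes e :: "nat \<Rightarrow> 'a::{real_inner, banach, second_countable_topology}"
  assumes e: "complete_orthonormal e"
begin

lemma inner_e: "inner (e m) (e n) = (if m = n then 1 else 0)"
  using e by (simp add: complete_orthonormal_def)

lemma norm_sum_e:
  assumes "finite I"
  shows "(norm (\<Sum>i\<in>I. c i *\<^sub>R e i))\<^sup>2 = (\<Sum>i\<in>I. (c i)\<^sup>2)"
proof -
  let ?s = "\<Sum>i\<in>I. c i *\<^sub>R e i"
  have "inner (e i) ?s = c i" if "i \<in> I" for i
  proof -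
    have "inner (e i) ?s = (\<Sum>j\<in>I. if i = j then c j else 0)"
      unfolding inner_sum_right by (rule sum.cong) (auto simp: inner_e)
    then show ?thesis using assms that by simp
  qed
  moreover have "inner ?s ?s = (\<Sum>i\<in>I. c i * inner (e i) ?s)"
    unfolding inner_sum_left by simp
  ultimately have "inner ?s ?s = (\<Sum>i\<in>I. c i * c i)" by simp
  then show ?thesis by (simp only: power2_norm_eq_inner) (simp only: power2_eq_square)
qed

lemma bessel: "summable (\<lambda>n. (inner x (e n))\<^sup>2)"
proof (rule summableI_nonneg_bounded)
  fix N
  let ?s = "\<Sum>n<N. inner x (e n) *\<^sub>R e n"
  have 1: "inner x ?s = (\<Sum>n<N. (inner x (e n))\<^sup>2)" by (simp add: inner_sum_right power2_eq_square)
  have "0 \<le> (norm (x - ?s))\<^sup>2" by simp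
  also have "\<dots> = (norm x)\<^sup>2 - 2 * inner x ?s + (norm ?s)\<^sup>2"
    by (simp add: power2_norm_eq_inner inner_diff_left inner_diff_right inner_commute)
  also have "\<dots> = (norm x)\<^sup>2 - (\<Sum>n<N. (inner x (e n))\<^sup>2)"
    unfolding 1 by (subst norm_sum_e) auto
  finally show "(\<Sum>n<N. (inner x (e n))\<^sup>2) \<le> (norm x)\<^sup>2" by simp
qed auto

text \<open>By orthogonality a block is controlled by the squares of its coefficients. One
  \<open>M\<close> serves all sequences dominated by \<open>B\<close>, which is what uniform
  convergence in a parameter needs.\<close>

lemma norm_block_less:
  assumes "summable (\<lambda>n. (B n)\<^sup>2)" "\<epsilon> > 0"
  shows "\<exists>M. \<forall>c m n. (\<forall>i. \<bar>c i\<bar> \<le> B i) \<longrightarrow> m \<ge> M \<longrightarrow> norm (\<Sum>i=m..<n. c i *\<^sub>R e i) < \<epsilon>"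
proof -
  have "\<epsilon>\<^sup>2 > 0" using assms(2) by simp
  then obtain M where M: "\<forall>m\<ge>M. \<forall>n. norm (\<Sum>i=m..<n. (B i)\<^sup>2) < \<epsilon>\<^sup>2"
    using assms(1)[unfolded summable_Cauchy] by blast
  have "norm (\<Sum>i=m..<n. c i *\<^sub>R e i) < \<epsilon>" if c: "\<forall>i. \<bar>c i\<bar> \<le> B i" and m: "m \<ge> M" for c m n
  proof -
    have "(norm (\<Sum>i=m..<n. c i *\<^sub>R e i))\<^sup>2 = (\<Sum>i=m..<n. (c i)\<^sup>2)" by (rule norm_sum_e) simp
    also have "\<dots> \<le> (\<Sum>i=m..<n. (B i)\<^sup>2)"
      using c by (intro sum_mono) (metis abs_ge_zero power2_abs power_mono)
    also have "\<dots> < \<epsilon>\<^sup>2" using M[rule_format, OF m, of n] unfolding real_norm_def by linarith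
    finally have "(norm (\<Sum>i=m..<n. c i *\<^sub>R e i))\<^sup>2 < \<epsilon>\<^sup>2" .
    then show ?thesis by (rule power_less_imp_less_base) (use assms(2) in simp)
  qed
  then show ?thesis by (intro exI[of _ M]) simp
qed

lemma summable_e:
  assumes "summable (\<lambda>n. (c n)\<^sup>2)"
  shows "summable (\<lambda>n. c n *\<^sub>R e n)"
  unfolding summable_Cauchy
proof (intro allI impI)
  fix \<epsilon> :: real assume "\<epsilon> > 0"
  have "summable (\<lambda>n. (\<bar>c n\<bar>)\<^sup>2)" using assms by simp
  from norm_block_less[OF this \<open>\<epsilon> > 0\<close>] obtain M where
    "\<forall>d m n. (\<forall>i. \<bar>d i\<bar> \<le> \<bar>c i\<bar>) \<longrightarrow> m \<ge> M \<longrightarrow> norm (\<Sum>i=m..<n. d i *\<^sub>R e i) < \<epsilon>" ..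
  then show "\<exists>N. \<forall>m\<ge>N. \<forall>n. norm (\<Sum>i=m..<n. c i *\<^sub>R e i) < \<epsilon>" by (intro exI[of _ M]) simp
qed

lemma sums_inner_e:
  assumes "(\<lambda>n. c n *\<^sub>R e n) sums x"
  shows "inner x (e m) = c m"
proof -
  have "(\<lambda>n. inner (c n *\<^sub>R e n) (e m)) sums inner x (e m)"
    by (rule bounded_linear.sums[OF bounded_linear_inner_left assms])
  moreover have "(\<lambda>n. inner (c n *\<^sub>R e n) (e m)) = (\<lambda>n. if n = m then c n else 0)"
    by (auto simp: fun_eq_iff inner_e)
  moreover have "(\<lambda>n. if n = m then c n else 0) sums c m"
    using sums_If_finite_set[of "{m}" c] by simp
  ultimately show ?thesis by (metis sums_unique2)
qed

lemma inner_suminf_e: "summable (\<lambda>n. (c n)\<^sup>2) \<Longrightarrow> inner (\<Sum>n. c n *\<^sub>R e n) (e m) = c m"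
  by (intro sums_inner_e summable_sums summable_e)

text \<open>The closed subspace orthogonal to x - y contains all basis vectors, hence the whole
  space and x - y itself.\<close>

lemma eq_of_inner_e:
  assumes "\<And>n. inner x (e n) = inner y (e n)"
  shows "x = y"
proof -
  let ?K = "{z. inner (x - y) z = 0}"
  have "span (range e) \<subseteq> ?K"
    by (rule span_minimal) (use assms in \<open>auto simp: subspace_def inner_diff_left inner_add_right\<close>)
  moreover have "closed ?K" by (rule closed_hyperplane)
  ultimately have "closure (span (range e)) \<subseteq> ?K" by (rule closure_minimal)
  moreover have "x - y \<in> closure (span (range e))" using e by (simp add: complete_orthonormal_def)
  ultimately have "inner (x - y) (x - y) = 0" by blast
  then show ?thesis by simp
qed

lemma expansion: "(\<lambda>n. inner x (e n) *\<^sub>R e n) sums x"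
proof -
  have "(\<Sum>n. inner x (e n) *\<^sub>R e n) = x"
    by (rule eq_of_inner_e) (simp add: inner_suminf_e bessel)
  then show ?thesis using summable_sums[OF summable_e[OF bessel]] by metis
qed

lemma summable_sq_bound:
  fixes B c :: "nat \<Rightarrow> real"
  assumes "summable (\<lambda>n. (B n)\<^sup>2)" "\<And>n. \<bar>c n\<bar> \<le> K * B n"
  shows "summable (\<lambda>n. (c n)\<^sup>2)"
proof (rule summable_comparison_test'[where N = 0])
  show "summable (\<lambda>n. K\<^sup>2 * (B n)\<^sup>2)" using assms(1) by (rule summable_mult)
  show "norm ((c n)\<^sup>2) \<le> K\<^sup>2 * (B n)\<^sup>2" for n
    using power_mono[OF assms(2)[of n] abs_ge_zero, of 2] by (simp add: power_mult_distrib)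
qed

text \<open>A square summable majorant takes the place of the summable one in Weierstrass' test;
  orthogonality makes this weaker requirement sufficient.\<close>

lemma uniform_limit_e:
  assumes "summable (\<lambda>n. (B n)\<^sup>2)" "\<And>n t. t \<in> S \<Longrightarrow> \<bar>c n t\<bar> \<le> B n"
  shows "uniform_limit S (\<lambda>N t. \<Sum>n<N. c n t *\<^sub>R e n) (\<lambda>t. \<Sum>n. c n t *\<^sub>R e n) sequentially"
proof -
  have "uniformly_Cauchy_on S (\<lambda>N t. \<Sum>n<N. c n t *\<^sub>R e n)"
  proof (rule uniformly_Cauchy_onI')
    fix \<epsilon> :: real assume "\<epsilon> > 0"
    from norm_block_less[OF assms(1) this] obtain M where
      M: "\<forall>d m n. (\<forall>i. \<bar>d i\<bar> \<le> B i) \<longrightarrow> m \<ge> M \<longrightarrow> norm (\<Sum>i=m..<n. d i *\<^sub>R e i) < \<epsilon>" ..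
    show "\<exists>M. \<forall>x\<in>S. \<forall>m\<ge>M. \<forall>n>m. dist (\<Sum>i<m. c i x *\<^sub>R e i) (\<Sum>i<n. c i x *\<^sub>R e i) < \<epsilon>"
    proof (intro exI[of _ M] ballI allI impI)
      fix x m n assume *: "x \<in> S" "M \<le> m" "m < (n :: nat)"
      have "(\<Sum>i<n. c i x *\<^sub>R e i) - (\<Sum>i<m. c i x *\<^sub>R e i) = (\<Sum>i=m..<n. c i x *\<^sub>R e i)"
        using * by (simp add: sum_diff_nat_ivl lessThan_atLeast0)
      moreover have "norm (\<Sum>i=m..<n. c i x *\<^sub>R e i) < \<epsilon>"
        using M[rule_format, of "\<lambda>i. c i x" m n] assms(2) * by blast
      ultimately have "norm ((\<Sum>i<n. c i x *\<^sub>R e i) - (\<Sum>i<m. c i x *\<^sub>R e i)) < \<epsilon>"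
        by (simp only:)
      then show "dist (\<Sum>i<m. c i x *\<^sub>R e i) (\<Sum>i<n. c i x *\<^sub>R e i) < \<epsilon>"
        by (subst trans[OF dist_commute dist_norm])
    qed
  qed
  then have "uniformly_convergent_on S (\<lambda>N t. \<Sum>n<N. c n t *\<^sub>R e n)"
    by (rule Cauchy_uniformly_convergent)
  then show ?thesis
    by (simp add: uniformly_convergent_uniform_limit_iff suminf_eq_lim)
qed

lemma norm_suminf_e_le:
  assumes "summable (\<lambda>n. (B n)\<^sup>2)" "\<And>n. \<bar>c n\<bar> \<le> B n"
  shows "norm (\<Sum>n. c n *\<^sub>R e n) \<le> sqrt (\<Sum>n. (B n)\<^sup>2)"
proof (rule LIMSEQ_le_const2)
  have "summable (\<lambda>n. (c n)\<^sup>2)"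
    by (rule summable_sq_bound[OF assms(1), of _ 1]) (use assms(2) in simp)
  then show "(\<lambda>N. norm (\<Sum>n<N. c n *\<^sub>R e n)) \<longlonglongrightarrow> norm (\<Sum>n. c n *\<^sub>R e n)"
    by (intro tendsto_norm summable_LIMSEQ summable_e)
  have "norm (\<Sum>n<N. c n *\<^sub>R e n) \<le> sqrt (\<Sum>n. (B n)\<^sup>2)" for N
  proof (rule real_le_rsqrt)
    have "(norm (\<Sum>n<N. c n *\<^sub>R e n))\<^sup>2 = (\<Sum>n<N. (c n)\<^sup>2)" by (rule norm_sum_e) simp
    also have "\<dots> \<le> (\<Sum>n<N. (B n)\<^sup>2)"
      using assms(2) by (intro sum_mono) (metis abs_ge_zero power2_abs power_mono)
    also have "\<dots> \<le> (\<Sum>n. (B n)\<^sup>2)" by (rule sum_le_suminf[OF assms(1)]) auto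
    finally show "(norm (\<Sum>n<N. c n *\<^sub>R e n))\<^sup>2 \<le> (\<Sum>n. (B n)\<^sup>2)" .
  qed
  then show "\<exists>N. \<forall>n\<ge>N. norm (\<Sum>n<n. c n *\<^sub>R e n) \<le> sqrt (\<Sum>n. (B n)\<^sup>2)" by blast
qed

lemma continuous_on_suminf_e:
  assumes "summable (\<lambda>n. (B n)\<^sup>2)" "\<And>n t. t \<in> S \<Longrightarrow> \<bar>c n t\<bar> \<le> B n"
    and "\<And>n. continuous_on S (c n)"
  shows "continuous_on S (\<lambda>t. \<Sum>n. c n t *\<^sub>R e n)"
  by (rule uniform_limit_theorem[OF _ uniform_limit_e[OF assms(1,2)]])
    (auto intro!: always_eventually continuous_intros assms(3))

lemma has_vector_derivative_suminf_e:
  fixes c d :: "nat \<Rightarrow> real \<Rightarrow> real"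
  assumes S: "convex S" "x \<in> S"
    and B: "summable (\<lambda>n. (B n)\<^sup>2)" "\<And>n t. t \<in> S \<Longrightarrow> \<bar>d n t\<bar> \<le> B n"
    and C: "summable (\<lambda>n. (C n)\<^sup>2)" "\<And>n t. t \<in> S \<Longrightarrow> \<bar>c n t\<bar> \<le> C n"
    and deriv: "\<And>n t. t \<in> S \<Longrightarrow> (c n has_real_derivative d n t) (at t within S)"
  shows "((\<lambda>t. \<Sum>n. c n t *\<^sub>R e n) has_vector_derivative (\<Sum>n. d n x *\<^sub>R e n)) (at x within S)"
proof -
  let ?g' = "\<lambda>t. \<Sum>n. d n t *\<^sub>R e n"
  have "\<exists>g. \<forall>t\<in>S. (\<lambda>n. c n t *\<^sub>R e n) sums g t \<and> (g has_derivative (\<lambda>h. h *\<^sub>R ?g' t)) (at t within S)"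
  proof (rule has_derivative_series[where f' = "\<lambda>n t h. h *\<^sub>R (d n t *\<^sub>R e n)" and x = x])
    show "((\<lambda>t. c n t *\<^sub>R e n) has_derivative (\<lambda>h. h *\<^sub>R (d n t *\<^sub>R e n))) (at t within S)" if "t \<in> S" for n t
    proof -
      have "(c n has_vector_derivative d n t) (at t within S)"
        using deriv[OF that] by (simp add: has_real_derivative_iff_has_vector_derivative)
      then have "((\<lambda>t. c n t *\<^sub>R e n) has_vector_derivative d n t *\<^sub>R e n) (at t within S)"
        by (rule bounded_linear.has_vector_derivative[OF bounded_linear_scaleR_left])
      then show ?thesis by (simp add: has_vector_derivative_def)
    qed
    fix \<epsilon> :: real assume "\<epsilon> > 0"
    from uniform_limitD[OF uniform_limit_e[OF B] this]
    have "\<forall>\<^sub>F N in sequentially. \<forall>t\<in>S. dist (\<Sum>n<N. d n t *\<^sub>R e n) (?g' t) < \<epsilon>" .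
    then show "\<forall>\<^sub>F N in sequentially. \<forall>t\<in>S. \<forall>h. norm ((\<Sum>n<N. h *\<^sub>R (d n t *\<^sub>R e n)) - h *\<^sub>R ?g' t) \<le> \<epsilon> * norm h"
    proof eventually_elim
      case (elim N)
      show ?case
      proof (intro ballI allI)
        fix t h assume "t \<in> S"
        have "(\<Sum>n<N. h *\<^sub>R (d n t *\<^sub>R e n)) - h *\<^sub>R ?g' t = h *\<^sub>R ((\<Sum>n<N. d n t *\<^sub>R e n) - ?g' t)"
          by (simp only: scaleR_sum_right scaleR_diff_right)
        then have "norm ((\<Sum>n<N. h *\<^sub>R (d n t *\<^sub>R e n)) - h *\<^sub>R ?g' t) = \<bar>h\<bar> * dist (\<Sum>n<N. d n t *\<^sub>R e n) (?g' t)"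
          by (simp only: norm_scaleR dist_norm)
        also have "\<dots> \<le> \<bar>h\<bar> * \<epsilon>" using elim \<open>t \<in> S\<close> by (intro mult_left_mono) (auto intro: less_imp_le)
        finally show "norm ((\<Sum>n<N. h *\<^sub>R (d n t *\<^sub>R e n)) - h *\<^sub>R ?g' t) \<le> \<epsilon> * norm h" by (simp add: mult.commute)
      qed
    qed
  next
    have "summable (\<lambda>n. (c n x)\<^sup>2)"
      by (rule summable_sq_bound[OF C(1), of _ 1]) (use C(2) S in auto)
    then show "(\<lambda>n. c n x *\<^sub>R e n) sums (\<Sum>n. c n x *\<^sub>R e n)" by (intro summable_sums summable_e)
  qed (use S in auto)
  then obtain g where g: "\<And>t. t \<in> S \<Longrightarrow> (\<lambda>n. c n t *\<^sub>R e n) sums g t"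
    "\<And>t. t \<in> S \<Longrightarrow> (g has_derivative (\<lambda>h. h *\<^sub>R ?g' t)) (at t within S)" by blast
  have "(g has_vector_derivative ?g' x) (at x within S)"
    using g(2)[OF S(2)] by (simp add: has_vector_derivative_def)
  then show ?thesis
  proof (rule has_vector_derivative_transform[OF S(2), rotated])
    show "(\<Sum>n. c n t *\<^sub>R e n) = g t" if "t \<in> S" for t using sums_unique[OF g(1)[OF that]] by simp
  qed
qed

end

section \<open>The operator in spectral coordinates\<close>

locale spectral_operator = orthonormal_basis e
  for e :: "nat \<Rightarrow> 'a::{real_inner, banach, second_countable_topology}" +
  fixes D :: "'a set" and A :: "'a \<Rightarrow> 'a" and lam :: "nat \<Rightarrow> real"
  assumes sa: "self_adjoint D A" and eig: "eigensystem D A e lam"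
begin

lemma lam_pos: "lam n > 0" and lam_0_le: "lam 0 \<le> lam n"
proof -
  show "lam 0 \<le> lam n" using eig by (auto simp: eigensystem_def mono_def)
  moreover have "0 < lam 0" using eig by (auto simp: eigensystem_def)
  ultimately show "lam n > 0" by linarith
qed

lemma lam_at_top: "filterlim lam at_top sequentially"
  using eig by (auto simp: eigensystem_def)

lemma inner_A_e:
  assumes "x \<in> D"
  shows "inner (A x) (e n) = lam n * inner x (e n)"
proof -
  have "e n \<in> D" "A (e n) = lam n *\<^sub>R e n" using eig by (auto simp: eigensystem_def)
  then have "inner (A x) (e n) = inner x (A (e n))"
    using sa assms unfolding self_adjoint_def by metis
  then show ?thesis using \<open>A (e n) = lam n *\<^sub>R e n\<close> by simp
qed

text \<open>For a self-adjoint operator a pair lies in the graph as soon as it passes the test of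
  the adjoint against every x in \<open>D\<close>; that test holds coefficient by
  coefficient.\<close>

lemma suminf_in_domain:
  assumes c: "summable (\<lambda>n. (c n)\<^sup>2)" and lc: "summable (\<lambda>n. (lam n * c n)\<^sup>2)"
  shows "(\<Sum>n. c n *\<^sub>R e n) \<in> D" and "A (\<Sum>n. c n *\<^sub>R e n) = (\<Sum>n. (lam n * c n) *\<^sub>R e n)"
proof -
  let ?y = "\<Sum>n. c n *\<^sub>R e n" and ?z = "\<Sum>n. (lam n * c n) *\<^sub>R e n"
  have "inner (A x) ?y = inner x ?z" if x: "x \<in> D" for x
  proof -
    have "(\<lambda>n. inner (A x) (c n *\<^sub>R e n)) sums inner (A x) ?y"
      by (intro bounded_linear.sums[OF bounded_linear_inner_right] summable_sums summable_e c)
    moreover have "(\<lambda>n. inner x ((lam n * c n) *\<^sub>R e n)) sums inner x ?z"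
      by (intro bounded_linear.sums[OF bounded_linear_inner_right] summable_sums summable_e lc)
    moreover have "inner (A x) (c n *\<^sub>R e n) = inner x ((lam n * c n) *\<^sub>R e n)" for n
      by (simp add: inner_A_e[OF x])
    ultimately show ?thesis by (simp only: sums_unique2)
  qed
  then have "?y \<in> D \<and> ?z = A ?y"
    using sa unfolding self_adjoint_def by blast
  then show "?y \<in> D" "A ?y = ?z" by auto
qed

end

subsection \<open>The scalar nonlocal problem\<close>

context caputo_order
begin

text \<open>With \<tau> = l^(1/\<alpha>) t the claim is \<tau> <= 1 + \<tau>^\<alpha>. This scaling
  is the source of the exponent 1/\<alpha> in the estimates.\<close>

lemma div_one_plus_powr_le:
  assumes "l > 0" "t \<ge> 0"
  shows "t / (1 + l * t powr \<alpha>) \<le> l powr (- 1 / \<alpha>)"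
proof (cases "t = 0")
  case False
  with assms have t: "t > 0" by simp
  define \<tau> where "\<tau> = l powr (1 / \<alpha>) * t"
  have \<tau>: "\<tau> > 0" using assms t by (simp add: \<tau>_def)
  have e: "\<tau> powr \<alpha> = l * t powr \<alpha>"
    using assms t \<alpha> by (simp add: \<tau>_def powr_mult powr_powr)
  have "\<tau> \<le> 1 + \<tau> powr \<alpha>"
  proof (cases "\<tau> \<le> 1")
    case True
    then show ?thesis using powr_ge_zero[of \<tau> \<alpha>] by linarith
  next
    case False
    then have "\<tau> powr 1 \<le> \<tau> powr \<alpha>" using \<alpha> by (intro powr_mono) auto
    then show ?thesis using \<tau> by simp
  qed
  then have "l powr (1 / \<alpha>) * t \<le> 1 + l * t powr \<alpha>" using e by (simp add: \<tau>_def)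
  then have "t \<le> (1 + l * t powr \<alpha>) / l powr (1 / \<alpha>)" using assms by (simp add: field_simps)
  also have "\<dots> = l powr (- 1 / \<alpha>) * (1 + l * t powr \<alpha>)"
    using assms by (simp add: powr_minus_divide)
  finally show ?thesis using assms by (simp add: pos_divide_le_eq add_pos_nonneg)
qed simp

text \<open>One constant serves all estimates. Those for t >= 0 hold up to t = 0; those for t > 0
  are singular at 0 and mostly gain decay in l. The bound on l * |ml_p l t| is tuned to the order
  1/\<alpha> - 1 of y'(0).\<close>

definition ml_majorant :: "real \<Rightarrow> bool" where
  "ml_majorant C \<longleftrightarrow> C > 0 \<and> (\<forall>l>0. \<forall>t\<ge>0.
     \<bar>ml_c l t\<bar> \<le> C \<and>
     \<bar>ml_s l t\<bar> \<le> C * l powr (- 1 / \<alpha>) \<and>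
     \<bar>ml_k l t\<bar> \<le> C * (1 / l) \<and>
     \<bar>ml_p l t\<bar> \<le> C * t powr (\<alpha> - 1) \<and>
     (t > 0 \<longrightarrow>
       \<bar>ml_c l t\<bar> \<le> C / t powr \<alpha> * (1 / l) \<and>
       \<bar>ml_s l t\<bar> \<le> C * t / t powr \<alpha> * (1 / l) \<and>
       \<bar>ml_p l t\<bar> \<le> C * t powr (\<alpha> - 1) / (t powr \<alpha>)\<^sup>2 * (1 / l\<^sup>2) \<and>
       l * \<bar>ml_p l t\<bar> \<le> C * t powr (\<alpha> - 2) * l powr (1 - 1 / \<alpha>) \<and>
       \<bar>ml_q l t\<bar> \<le> C * t powr (\<alpha> - 2)))"

lemma ml_majorantD:
  assumes "ml_majorant C" "l > 0" "t \<ge> 0"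
  shows "\<bar>ml_c l t\<bar> \<le> C"
    and "\<bar>ml_s l t\<bar> \<le> C * l powr (- 1 / \<alpha>)"
    and "\<bar>ml_k l t\<bar> \<le> C * (1 / l)"
    and "\<bar>ml_p l t\<bar> \<le> C * t powr (\<alpha> - 1)"
  using assms by (auto simp: ml_majorant_def)

lemma ml_majorantD_pos:
  assumes "ml_majorant C" "l > 0" "t > 0"
  shows "\<bar>ml_c l t\<bar> \<le> C / t powr \<alpha> * (1 / l)"
    and "\<bar>ml_s l t\<bar> \<le> C * t / t powr \<alpha> * (1 / l)"
    and "\<bar>ml_p l t\<bar> \<le> C * t powr (\<alpha> - 1) / (t powr \<alpha>)\<^sup>2 * (1 / l\<^sup>2)"
    and "l * \<bar>ml_p l t\<bar> \<le> C * t powr (\<alpha> - 2) * l powr (1 - 1 / \<alpha>)"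
    and "\<bar>ml_q l t\<bar> \<le> C * t powr (\<alpha> - 2)"
  using assms by (simp_all add: ml_majorant_def del: times_divide_eq_right)

lemma ml_majorant_exists: "\<exists>C. ml_majorant C"
proof -
  obtain C1 where C1: "C1 > 0" "\<And>x. x \<ge> 0 \<Longrightarrow> \<bar>E 1 (- x)\<bar> \<le> C1 / (1 + x)" using ml_bound[of 1] by blast
  obtain C2 where C2: "C2 > 0" "\<And>x. x \<ge> 0 \<Longrightarrow> \<bar>E 2 (- x)\<bar> \<le> C2 / (1 + x)" using ml_bound[of 2] by blast
  obtain C3 where C3: "C3 > 0" "\<And>x. x \<ge> 0 \<Longrightarrow> \<bar>E \<alpha> (- x)\<bar> \<le> C3 / (1 + x)" using ml_bound[of \<alpha>] by blast
  obtain C4 where C4: "C4 > 0" "\<And>x. x \<ge> 0 \<Longrightarrow> \<bar>E (\<alpha> - 1) (- x)\<bar> \<le> C4 / (1 + x)" using ml_bound[of "\<alpha> - 1"] by blast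
  obtain C5 where C5: "C5 > 0" "\<And>x. x > 0 \<Longrightarrow> \<bar>E \<alpha> (- x)\<bar> \<le> C5 / x\<^sup>2" using ml_\<alpha>_bound by blast
  \<comment> \<open>The summand 1 is for |1 - ml_c| <= 1 + C1, through which \<open>ml_c_eq\<close>
    bounds \<open>ml_k\<close>.\<close>
  define C where "C = 1 + C1 + C2 + C3 + C4 + C5"
  have Cge: "C1 + 1 \<le> C" "C2 \<le> C" "C3 \<le> C" "C4 \<le> C" "C5 \<le> C" "C > 0"
    using C1(1) C2(1) C3(1) C4(1) C5(1) by (auto simp: C_def)
  have up: "c / (1 + x) \<le> C / (1 + x)" "c / (1 + x) \<le> C" if "c \<le> C" "x \<ge> 0" for c x
  proof -
    show 1: "c / (1 + x) \<le> C / (1 + x)" using that by (intro divide_right_mono) auto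
    have "C / (1 + x) \<le> C / 1" using that Cge by (intro divide_left_mono) auto
    with 1 show "c / (1 + x) \<le> C" by simp
  qed
  have le_inv: "C / (1 + x) \<le> C / x" if "x > 0" for x
    using that Cge by (intro divide_left_mono) auto
  have "ml_majorant C"
    unfolding ml_majorant_def
  proof (intro conjI allI impI)
    show "C > 0" by fact
    fix l t :: real assume l: "l > 0" and t0: "t \<ge> 0"
    define x where "x = l * t powr \<alpha>"
    have x0: "x \<ge> 0" using l by (simp add: x_def)
    have mx: "- l * t powr \<alpha> = - x" by (simp add: x_def)
    have c_le: "\<bar>ml_c l t\<bar> \<le> C / (1 + x)" "\<bar>ml_c l t\<bar> \<le> C1"
    proof -
      have "\<bar>ml_c l t\<bar> \<le> C1 / (1 + x)" unfolding ml_c_def mx by (rule C1(2)[OF x0])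
      moreover have "C1 / (1 + x) \<le> C1 / 1" using x0 C1(1) by (intro divide_left_mono) auto
      ultimately show "\<bar>ml_c l t\<bar> \<le> C / (1 + x)" "\<bar>ml_c l t\<bar> \<le> C1" using up(1)[of C1 x] x0 Cge(1) by auto
    qed
    then show "\<bar>ml_c l t\<bar> \<le> C" using Cge by linarith
    have "l * \<bar>ml_k l t\<bar> = \<bar>1 - ml_c l t\<bar>" using ml_c_eq[of l t] l by (simp add: abs_mult)
    also have "\<dots> \<le> C" using c_le(2) Cge(1) by linarith
    finally show "\<bar>ml_k l t\<bar> \<le> C * (1 / l)" using l by (simp add: field_simps)
    have s_le: "\<bar>ml_s l t\<bar> \<le> t * (C / (1 + x))" if "t \<ge> 0"
    proof -
      have "\<bar>E 2 (- x)\<bar> \<le> C / (1 + x)" using C2(2)[OF x0] up(1)[OF Cge(2) x0] by linarith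
      then have "t * \<bar>E 2 (- x)\<bar> \<le> t * (C / (1 + x))" using that by (rule mult_left_mono)
      then show ?thesis by (simp only: ml_s_def mx abs_mult abs_of_nonneg[OF that])
    qed
    have p_le: "\<bar>ml_p l t\<bar> \<le> t powr (\<alpha> - 1) * (C / (1 + x))"
    proof -
      have "\<bar>E \<alpha> (- x)\<bar> \<le> C / (1 + x)" using C3(2)[OF x0] up(1)[OF Cge(3) x0] by linarith
      then have "t powr (\<alpha> - 1) * \<bar>E \<alpha> (- x)\<bar> \<le> t powr (\<alpha> - 1) * (C / (1 + x))"
        by (rule mult_left_mono) simp
      then show ?thesis by (simp only: ml_p_def mx abs_mult abs_of_nonneg[OF powr_ge_zero])
    qed
    have "C / (1 + x) \<le> C" using up(2)[OF order_refl x0] .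
    then have "t powr (\<alpha> - 1) * (C / (1 + x)) \<le> t powr (\<alpha> - 1) * C" by (rule mult_left_mono) simp
    then show "\<bar>ml_p l t\<bar> \<le> C * t powr (\<alpha> - 1)" using p_le by (simp add: mult.commute)
    show "\<bar>ml_s l t\<bar> \<le> C * l powr (- 1 / \<alpha>)"
    proof -
      have "t * (C / (1 + x)) = C * (t / (1 + x))" by simp
      also have "\<dots> \<le> C * l powr (- 1 / \<alpha>)"
        unfolding x_def using Cge(6) by (intro mult_left_mono div_one_plus_powr_le l t0) auto
      finally show ?thesis using s_le[OF t0] by linarith
    qed
    assume t: "t > 0"
    then have xp: "x > 0" using l by (simp add: x_def)
    have "C / (1 + x) \<le> C / t powr \<alpha> * (1 / l)" using le_inv[OF xp] by (simp add: x_def mult.commute)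
    then show "\<bar>ml_c l t\<bar> \<le> C / t powr \<alpha> * (1 / l)" using c_le(1) by linarith
    have "t * (C / (1 + x)) \<le> t * (C / x)" using le_inv[OF xp] t by (intro mult_left_mono) auto
    also have "\<dots> = C * t / t powr \<alpha> * (1 / l)" by (simp add: x_def mult.commute)
    finally show "\<bar>ml_s l t\<bar> \<le> C * t / t powr \<alpha> * (1 / l)" using s_le t by linarith
    show "\<bar>ml_p l t\<bar> \<le> C * t powr (\<alpha> - 1) / (t powr \<alpha>)\<^sup>2 * (1 / l\<^sup>2)"
    proof -
      have "\<bar>E \<alpha> (- x)\<bar> \<le> C / x\<^sup>2"
        using C5(2)[OF xp] divide_right_mono[OF Cge(5), of "x\<^sup>2"] by simp
      then have "t powr (\<alpha> - 1) * \<bar>E \<alpha> (- x)\<bar> \<le> t powr (\<alpha> - 1) * (C / x\<^sup>2)"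
        by (rule mult_left_mono) simp
      then have "\<bar>ml_p l t\<bar> \<le> t powr (\<alpha> - 1) * (C / x\<^sup>2)"
        by (simp only: ml_p_def mx abs_mult abs_of_nonneg[OF powr_ge_zero])
      also have "\<dots> = C * t powr (\<alpha> - 1) / (t powr \<alpha>)\<^sup>2 * (1 / l\<^sup>2)"
        by (simp add: x_def power_mult_distrib mult_ac)
      finally show ?thesis .
    qed
    show "l * \<bar>ml_p l t\<bar> \<le> C * t powr (\<alpha> - 2) * l powr (1 - 1 / \<alpha>)"
    proof -
      have tp: "t powr (\<alpha> - 1) = t powr (\<alpha> - 2) * t" using t powr_add[of t "\<alpha> - 2" 1] by simp
      have "l * \<bar>ml_p l t\<bar> \<le> l * (t powr (\<alpha> - 2) * t * (C / (1 + x)))"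
        using p_le l unfolding tp by (intro mult_left_mono) auto
      also have "\<dots> = C * t powr (\<alpha> - 2) * (l * (t / (1 + x)))" by simp
      also have "\<dots> \<le> C * t powr (\<alpha> - 2) * (l * l powr (- 1 / \<alpha>))"
        unfolding x_def using Cge(6) l t by (intro mult_left_mono div_one_plus_powr_le) auto
      also have "l * l powr (- 1 / \<alpha>) = l powr (1 - 1 / \<alpha>)" using l powr_add[of l 1 "- 1 / \<alpha>"] by simp
      finally show ?thesis .
    qed
    have "\<bar>E (\<alpha> - 1) (- x)\<bar> \<le> C" using C4(2)[OF x0] up(2)[OF Cge(4) x0] by linarith
    then have "t powr (\<alpha> - 2) * \<bar>E (\<alpha> - 1) (- x)\<bar> \<le> t powr (\<alpha> - 2) * C"
      by (rule mult_left_mono) simp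
    then show "\<bar>ml_q l t\<bar> \<le> C * t powr (\<alpha> - 2)"
      by (simp only: ml_q_def mx abs_mult abs_of_nonneg[OF powr_ge_zero] mult.commute[of C])
  qed
  then show ?thesis ..
qed

text \<open>
  Cramer's rule: \<open>nl_a\<close> and \<open>nl_b\<close> are \<open>y(0)\<close> and \<open>y'(0)\<close> for the solution of \<open>\<partial>\<^sup>\<alpha>y + l y = f\<close> with
  \<open>\<gamma> y(0) + y(T) = p\<close> and \<open>y'(T) = q\<close>.
\<close>

definition "nl_det \<gamma> T l = \<gamma> * ml_c l T + (ml_c l T)\<^sup>2 + l * ml_s l T * ml_p l T"
definition "nl_a \<gamma> T l p q f = ((p - f * ml_k l T) * ml_c l T - ml_s l T * (q - f * ml_p l T)) * (1 / nl_det \<gamma> T l)"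
definition "nl_b \<gamma> T l p q f =
  ((\<gamma> + ml_c l T) * (q - f * ml_p l T) + l * ml_p l T * (p - f * ml_k l T)) * (1 / nl_det \<gamma> T l)"

lemma rho_eq: "T > 0 \<Longrightarrow> rho \<alpha> \<gamma> (l * T powr \<alpha>) = nl_det \<gamma> T l"
  using powr_add[of T 1 "\<alpha> - 1"]
  by (simp add: rho_def nl_det_def ml_c_def ml_s_def ml_p_def)

lemma P2_eq: "T > 0 \<Longrightarrow> P2 \<alpha> \<gamma> T l t =
    (ml_c l T * ml_c l t + l * ml_p l T * ml_s l t) * (1 / nl_det \<gamma> T l)"
  unfolding P2_def rho_eq by (simp add: ml_c_def ml_s_def ml_p_def mult.assoc)

lemma P3_eq: "T > 0 \<Longrightarrow> P3 \<alpha> \<gamma> T l t =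
    (- ml_s l T * ml_c l t + (\<gamma> + ml_c l T) * ml_s l t) * (1 / nl_det \<gamma> T l)"
  unfolding P3_def rho_eq by (simp add: ml_c_def ml_s_def ml_p_def mult.assoc)

lemma Tri_eq: "Tri \<alpha> \<gamma> T l t = ml_k l t - ml_k l T * P2 \<alpha> \<gamma> T l t - ml_p l T * P3 \<alpha> \<gamma> T l t"
  unfolding Tri_def by (simp add: ml_k_def ml_p_def)

lemma nl_solution_eq:
  assumes "T > 0"
  shows "nl_a \<gamma> T l p q f * ml_c l t + nl_b \<gamma> T l p q f * ml_s l t + f * ml_k l t
    = P2 \<alpha> \<gamma> T l t * p + P3 \<alpha> \<gamma> T l t * q + Tri \<alpha> \<gamma> T l t * f"
  unfolding Tri_eq P2_eq[OF assms] P3_eq[OF assms] nl_a_def nl_b_def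
  by (simp add: algebra_simps)

lemma nl_conditions_iff:
  assumes "nl_det \<gamma> T l \<noteq> 0"
  shows "\<gamma> * a + (a * ml_c l T + b * ml_s l T + f * ml_k l T) = p \<and>
     - a * l * ml_p l T + b * ml_c l T + f * ml_p l T = q \<longleftrightarrow>
     a = nl_a \<gamma> T l p q f \<and> b = nl_b \<gamma> T l p q f" (is "?L \<longleftrightarrow> ?R")
proof -
  \<comment> \<open>Carrying the inverse determinant as a factor \<open>r\<close> with determinant *
    r = 1 turns both directions into polynomial identities.\<close>
  define r where "r = 1 / nl_det \<gamma> T l"
  define C S K P where "C = ml_c l T" and "S = ml_s l T" and "K = ml_k l T" and "P = ml_p l T"
  note defs = C_def[symmetric] S_def[symmetric] K_def[symmetric] P_def[symmetric]
  have r: "(\<gamma> * C + C\<^sup>2 + l * S * P) * r = 1"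
    using assms by (simp add: r_def nl_det_def C_def S_def P_def)
  have ab: "nl_a \<gamma> T l p q f = ((p - f * K) * C - S * (q - f * P)) * r"
    "nl_b \<gamma> T l p q f = ((\<gamma> + C) * (q - f * P) + l * P * (p - f * K)) * r"
    by (simp_all add: nl_a_def nl_b_def r_def defs)
  show ?thesis
    unfolding ab defs
  proof
    assume L: "\<gamma> * a + (a * C + b * S + f * K) = p \<and> - a * l * P + b * C + f * P = q"
    then have p: "p - f * K = \<gamma> * a + a * C + b * S" and q: "q - f * P = b * C - a * l * P" by auto
    have "((p - f * K) * C - S * (q - f * P)) * r = a * ((\<gamma> * C + C\<^sup>2 + l * S * P) * r)"
      "((\<gamma> + C) * (q - f * P) + l * P * (p - f * K)) * r = b * ((\<gamma> * C + C\<^sup>2 + l * S * P) * r)"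
      unfolding p q by (simp_all add: algebra_simps power2_eq_square)
    then show "a = ((p - f * K) * C - S * (q - f * P)) * r \<and>
      b = ((\<gamma> + C) * (q - f * P) + l * P * (p - f * K)) * r" unfolding r by simp
  next
    define X Y where "X = p - f * K" and "Y = q - f * P"
    assume "a = ((p - f * K) * C - S * (q - f * P)) * r \<and>
      b = ((\<gamma> + C) * (q - f * P) + l * P * (p - f * K)) * r"
    then have a: "a = (X * C - S * Y) * r" and b: "b = ((\<gamma> + C) * Y + l * P * X) * r"
      by (simp_all add: X_def Y_def)
    have "\<gamma> * a + a * C + b * S = X * ((\<gamma> * C + C\<^sup>2 + l * S * P) * r)"
      "b * C - a * l * P = Y * ((\<gamma> * C + C\<^sup>2 + l * S * P) * r)"
      unfolding a b by (simp_all add: algebra_simps power2_eq_square)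
    then show "\<gamma> * a + (a * C + b * S + f * K) = p \<and> - a * l * P + b * C + f * P = q"
      unfolding r by (simp add: X_def Y_def)
  qed
qed

end

lemma summable_sq_add:
  fixes x y :: "nat \<Rightarrow> real"
  assumes "summable (\<lambda>n. (x n)\<^sup>2)" "summable (\<lambda>n. (y n)\<^sup>2)"
  shows "summable (\<lambda>n. (x n + y n)\<^sup>2)"
proof (rule summable_comparison_test'[where N = 0])
  show "summable (\<lambda>n. 2 * (x n)\<^sup>2 + 2 * (y n)\<^sup>2)" using assms by (intro summable_add summable_mult)
  show "norm ((x n + y n)\<^sup>2) \<le> 2 * (x n)\<^sup>2 + 2 * (y n)\<^sup>2" for n
  proof -
    have "(x n + y n)\<^sup>2 \<le> 2 * (x n)\<^sup>2 + 2 * (y n)\<^sup>2"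
      using zero_le_power2[of "x n - y n"] by (simp add: power2_eq_square algebra_simps)
    then show ?thesis by simp
  qed
qed

subsection \<open>Growth in the eigenvalue\<close>

context spectral_operator
begin

text \<open>The weight w carries the square summable size of the data and the exponent x counts
  powers of the eigenvalue, so that estimates reduce to adding exponents.\<close>

definition growth :: "real \<Rightarrow> (nat \<Rightarrow> real) \<Rightarrow> (nat \<Rightarrow> real) \<Rightarrow> bool" where
  "growth x w f \<longleftrightarrow> (\<exists>K. \<forall>n. \<bar>f n\<bar> \<le> K * (lam n powr x * w n))"

abbreviation "lam_order x \<equiv> growth x (\<lambda>_. 1)"

lemma growthI: "(\<And>n. \<bar>f n\<bar> \<le> K * (lam n powr x * w n)) \<Longrightarrow> growth x w f"
  unfolding growth_def by blast

lemma growth_mult: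
  assumes "lam_order x f" "growth y w g" "z = x + y"
  shows "growth z w (\<lambda>n. f n * g n)"
proof -
  obtain K L where K: "\<And>n. \<bar>f n\<bar> \<le> K * (lam n powr x * 1)" and L: "\<And>n. \<bar>g n\<bar> \<le> L * (lam n powr y * w n)"
    using assms unfolding growth_def by blast
  show ?thesis
  proof (rule growthI[where K = "K * L"])
    fix n
    have "\<bar>f n\<bar> * \<bar>g n\<bar> \<le> (K * (lam n powr x * 1)) * (L * (lam n powr y * w n))"
      using order_trans[OF abs_ge_zero K[of n]] by (intro mult_mono K L) auto
    then show "\<bar>f n * g n\<bar> \<le> K * L * (lam n powr z * w n)"
      by (simp add: abs_mult assms(3) powr_add mult_ac)
  qed
qed

lemma growth_minus: "growth x w f \<Longrightarrow> growth x w (\<lambda>n. - f n)"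
  unfolding growth_def by simp

lemma growth_add:
  assumes "growth x w f" "growth x w g"
  shows "growth x w (\<lambda>n. f n + g n)"
proof -
  obtain K L where K: "\<And>n. \<bar>f n\<bar> \<le> K * (lam n powr x * w n)" and L: "\<And>n. \<bar>g n\<bar> \<le> L * (lam n powr x * w n)"
    using assms unfolding growth_def by blast
  show ?thesis
    by (rule growthI[where K = "K + L"], subst distrib_right, rule order_trans[OF abs_triangle_ineq add_mono[OF K L]])
qed

lemma growth_diff: "growth x w f \<Longrightarrow> growth x w g \<Longrightarrow> growth x w (\<lambda>n. f n - g n)"
  using growth_add[OF _ growth_minus, of x w f g] by simp

lemma growth_mono:
  assumes "growth x w f" "x \<le> y"
  shows "growth y w f"
proof -
  obtain K where K: "\<And>n. \<bar>f n\<bar> \<le> K * (lam n powr x * w n)" using assms unfolding growth_def by blast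
  show ?thesis
  proof (rule growthI[where K = "K * lam 0 powr (x - y)"])
    fix n
    \<comment> \<open>Neither K nor w is assumed nonnegative; the bound itself forces their product
      to be.\<close>
    have "0 \<le> lam n powr x * (K * w n)"
      using order_trans[OF abs_ge_zero K[of n]] by (simp add: mult_ac)
    then have Kw: "0 \<le> K * w n" using lam_pos[of n] by (simp add: zero_le_mult_iff)
    have "lam n powr x = lam n powr (x - y) * lam n powr y" by (simp add: powr_add[symmetric])
    also have "\<dots> \<le> lam 0 powr (x - y) * lam n powr y"
      using assms(2) lam_pos lam_0_le by (intro mult_right_mono powr_mono2') auto
    finally have "(K * w n) * lam n powr x \<le> (K * w n) * (lam 0 powr (x - y) * lam n powr y)"
      using Kw by (rule mult_left_mono)
    then show "\<bar>f n\<bar> \<le> K * lam 0 powr (x - y) * (lam n powr y * w n)"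
      using K[of n] by (simp add: mult_ac)
  qed
qed

lemma order_const: "lam_order 0 (\<lambda>_. c)"
  by (rule growthI[where K = "\<bar>c\<bar>"]) (use lam_pos in \<open>auto simp: less_imp_neq[symmetric]\<close>)

lemma order_lam: "lam_order 1 lam"
  by (rule growthI[where K = 1]) (use lam_pos in \<open>auto simp: less_imp_le\<close>)

lemma order_tendsto_0:
  assumes "lam_order x f" "x < 0"
  shows "f \<longlonglongrightarrow> 0"
proof -
  obtain K where K: "\<And>n. \<bar>f n\<bar> \<le> K * (lam n powr x * 1)" using assms unfolding growth_def by blast
  have "(\<lambda>n. K * (lam n powr x * 1)) \<longlonglongrightarrow> K * (0 * 1)"
    by (intro tendsto_intros tendsto_neg_powr assms lam_at_top)
  then show ?thesis
    by (intro Lim_null_comparison[of f "\<lambda>n. K * (lam n powr x * 1)"] always_eventually) (use K in auto)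
qed

text \<open>A convergent sequence is bounded, so the nonzero limit controls inverse (lam n * r n)
  for all n and not only for large n.\<close>

lemma order_inverse:
  assumes lim: "(\<lambda>n. lam n * r n) \<longlonglongrightarrow> c" and "c \<noteq> 0" and r: "\<And>n. r n \<noteq> 0"
  shows "lam_order 1 (\<lambda>n. 1 / r n)"
proof -
  have "(\<lambda>n. inverse (lam n * r n)) \<longlonglongrightarrow> inverse c"
    by (rule tendsto_inverse[OF lim \<open>c \<noteq> 0\<close>])
  then obtain K where K: "K > 0" "\<And>n. norm (inverse (lam n * r n)) \<le> K"
    using convergent_imp_Bseq[of "\<lambda>n. inverse (lam n * r n)"] by (auto simp: convergent_def Bseq_def)
  show ?thesis
  proof (rule growthI[where K = K])
    fix n
    have "1 / r n = inverse (lam n * r n) * lam n"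
      using lam_pos[of n] by (simp add: divide_inverse)
    then have "\<bar>1 / r n\<bar> = norm (inverse (lam n * r n)) * lam n"
      using lam_pos[of n] by (simp only: abs_mult real_norm_def abs_of_pos)
    also have "\<dots> \<le> K * lam n" using lam_pos[of n] by (intro mult_right_mono K) auto
    finally show "\<bar>1 / r n\<bar> \<le> K * (lam n powr 1 * 1)" using lam_pos[of n] by simp
  qed
qed

end

section \<open>Orders in the eigenvalue for the inverse problem\<close>

locale inverse_problem = caputo_order \<alpha> + spectral_operator e D A lam
  for \<alpha> :: real and e :: "nat \<Rightarrow> 'a::{real_inner, banach, second_countable_topology}"
    and D :: "'a set" and A :: "'a \<Rightarrow> 'a" and lam :: "nat \<Rightarrow> real" +
  fixes T \<gamma> \<xi> :: real
  assumes T: "T > 0" and \<gamma>: "\<gamma> \<noteq> 0" and T_notin: "T \<notin> Lambda_set \<alpha> \<gamma> lam"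
    and \<xi>: "\<xi> \<in> {0<..<T}" and \<xi>_notin: "\<xi> \<notin> P1_set \<alpha> \<gamma> T lam"
begin

lemma det_nonzero: "nl_det \<gamma> T (lam n) \<noteq> 0"
proof
  assume "nl_det \<gamma> T (lam n) = 0"
  then have "rho \<alpha> \<gamma> (lam n * T powr \<alpha>) = 0" by (simp add: rho_eq T)
  moreover have "lam n * T powr \<alpha> > 0" using lam_pos T by simp
  moreover have "(lam n * T powr \<alpha> / lam n) powr (1 / \<alpha>) = T"
    using lam_pos[of n] T \<alpha> by (simp add: powr_powr)
  ultimately have "T \<in> Lambda_set \<alpha> \<gamma> lam"
    unfolding Lambda_set_def by (metis (mono_tags, lifting) mem_Collect_eq)
  with T_notin show False ..
qed

lemma Tri_nonzero: "Tri \<alpha> \<gamma> T (lam n) \<xi> \<noteq> 0"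
  using \<xi>_notin \<xi> by (auto simp: P1_set_def)

lemma order_parts:
  assumes "t > 0"
  shows "lam_order (- 1) (\<lambda>n. ml_c (lam n) t)" "lam_order (- 1) (\<lambda>n. ml_s (lam n) t)"
    "lam_order (- 1) (\<lambda>n. ml_k (lam n) t)" "lam_order (- 2) (\<lambda>n. ml_p (lam n) t)"
proof -
  have pw: "lam n powr (- 1) = 1 / lam n" "lam n powr (- 2) = 1 / (lam n)\<^sup>2" for n
    using lam_pos[of n] by (simp_all add: powr_minus_divide)
  obtain C where "ml_majorant C" using ml_majorant_exists ..
  note C0 = this[unfolded ml_majorant_def, THEN conjunct1]
    and CD = ml_majorantD[OF \<open>ml_majorant C\<close>] and CP = ml_majorantD_pos[OF \<open>ml_majorant C\<close>]
  show "lam_order (- 1) (\<lambda>n. ml_c (lam n) t)"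
    by (rule growthI, unfold pw mult_1_right, rule CP(1)[OF lam_pos assms])
  show "lam_order (- 1) (\<lambda>n. ml_s (lam n) t)"
    by (rule growthI, unfold pw mult_1_right, rule CP(2)[OF lam_pos assms])
  show "lam_order (- 1) (\<lambda>n. ml_k (lam n) t)"
    by (rule growthI, unfold pw mult_1_right, rule CD(3)[OF lam_pos less_imp_le[OF assms]])
  show "lam_order (- 2) (\<lambda>n. ml_p (lam n) t)"
    by (rule growthI, unfold pw mult_1_right, rule CP(3)[OF lam_pos assms])
qed

text \<open>Of the three terms of the determinant, \<gamma> * ml_c has exact order -1, while the
  square of ml_c and l * ml_s * ml_p have order -2 and disappear in the limit. This is where
  \<gamma> \<noteq> 0 enters.\<close>

lemma order_det: "lam_order 1 (\<lambda>n. 1 / nl_det \<gamma> T (lam n))"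
proof (rule order_inverse)
  note o = order_parts[OF T]
  have "filterlim (\<lambda>n. T powr \<alpha> * lam n) at_top sequentially"
    using T by (intro filterlim_tendsto_pos_mult_at_top[OF tendsto_const _ lam_at_top]) auto
  from filterlim_compose[OF ml_1_asymptotic this]
  have "(\<lambda>n. T powr \<alpha> * lam n * E 1 (- (T powr \<alpha> * lam n))) \<longlonglongrightarrow> 1 / Gamma (1 - \<alpha>)" .
  then have "(\<lambda>n. 1 / T powr \<alpha> * (T powr \<alpha> * lam n * E 1 (- (T powr \<alpha> * lam n)))) \<longlonglongrightarrow> 1 / T powr \<alpha> * (1 / Gamma (1 - \<alpha>))"
    by (rule tendsto_mult_left)
  moreover have "1 / T powr \<alpha> * (T powr \<alpha> * lam n * E 1 (- (T powr \<alpha> * lam n))) = lam n * ml_c (lam n) T" for n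
    using T by (simp add: ml_c_def mult.commute)
  ultimately have L: "(\<lambda>n. lam n * ml_c (lam n) T) \<longlonglongrightarrow> 1 / T powr \<alpha> * (1 / Gamma (1 - \<alpha>))" by simp
  have c0: "(\<lambda>n. ml_c (lam n) T) \<longlonglongrightarrow> 0" by (rule order_tendsto_0[OF o(1)]) simp
  have "lam_order (- 1) (\<lambda>n. lam n * (lam n * (ml_s (lam n) T * ml_p (lam n) T)))"
    by (rule growth_mult[OF order_lam growth_mult[OF order_lam growth_mult[OF o(2) o(4) refl] refl]]) simp
  then have r0: "(\<lambda>n. lam n * (lam n * (ml_s (lam n) T * ml_p (lam n) T))) \<longlonglongrightarrow> 0"
    by (rule order_tendsto_0) simp
  have "(\<lambda>n. \<gamma> * (lam n * ml_c (lam n) T) + (lam n * ml_c (lam n) T) * ml_c (lam n) T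
      + lam n * (lam n * (ml_s (lam n) T * ml_p (lam n) T)))
      \<longlonglongrightarrow> \<gamma> * (1 / T powr \<alpha> * (1 / Gamma (1 - \<alpha>))) + (1 / T powr \<alpha> * (1 / Gamma (1 - \<alpha>))) * 0 + 0"
    by (intro tendsto_intros L c0 r0)
  moreover have "\<gamma> * (lam n * ml_c (lam n) T) + (lam n * ml_c (lam n) T) * ml_c (lam n) T
      + lam n * (lam n * (ml_s (lam n) T * ml_p (lam n) T)) = lam n * nl_det \<gamma> T (lam n)" for n
    by (simp add: nl_det_def power2_eq_square algebra_simps)
  ultimately show "(\<lambda>n. lam n * nl_det \<gamma> T (lam n)) \<longlonglongrightarrow> \<gamma> * (1 / T powr \<alpha> * (1 / Gamma (1 - \<alpha>)))"
    by simp
  show "\<gamma> * (1 / T powr \<alpha> * (1 / Gamma (1 - \<alpha>))) \<noteq> 0"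
    using \<gamma> T Gamma_1_minus_\<alpha>_nonzero by simp
qed (rule det_nonzero)

lemma order_P2_\<xi>: "lam_order (- 1) (\<lambda>n. P2 \<alpha> \<gamma> T (lam n) \<xi>)"
proof -
  note o = order_parts[OF T] and ox = order_parts[of \<xi>]
  have "lam_order (- 2) (\<lambda>n. ml_c (lam n) T * ml_c (lam n) \<xi> + lam n * ml_p (lam n) T * ml_s (lam n) \<xi>)"
  proof (rule growth_add)
    show "lam_order (- 2) (\<lambda>n. ml_c (lam n) T * ml_c (lam n) \<xi>)"
      by (rule growth_mult[OF o(1) ox(1)]) (use \<xi> in auto)
    have "lam_order (- 1) (\<lambda>n. lam n * ml_p (lam n) T)"
      by (rule growth_mult[OF order_lam o(4)]) simp
    then show "lam_order (- 2) (\<lambda>n. lam n * ml_p (lam n) T * ml_s (lam n) \<xi>)"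
      by (rule growth_mult[OF _ ox(2)]) (use \<xi> in auto)
  qed
  from growth_mult[OF this order_det] show ?thesis unfolding P2_eq[OF T] by simp
qed

text \<open>The factor \<gamma> + ml_c(T) does not decay, which costs one order compared with
  \<open>P2\<close>. In \<open>Tri\<close> this is made up for by ml_p(T), of order -2.\<close>

lemma order_P3_\<xi>: "lam_order 0 (\<lambda>n. P3 \<alpha> \<gamma> T (lam n) \<xi>)"
proof -
  note o = order_parts[OF T] and ox = order_parts[of \<xi>]
  have "lam_order (- 1) (\<lambda>n. - ml_s (lam n) T * ml_c (lam n) \<xi> + (\<gamma> + ml_c (lam n) T) * ml_s (lam n) \<xi>)"
  proof (rule growth_add)
    have "lam_order (- 2) (\<lambda>n. - ml_s (lam n) T * ml_c (lam n) \<xi>)"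
      by (rule growth_mult[OF growth_minus[OF o(2)] ox(1)]) (use \<xi> in auto)
    then show "lam_order (- 1) (\<lambda>n. - ml_s (lam n) T * ml_c (lam n) \<xi>)" by (rule growth_mono) simp
    have "lam_order 0 (\<lambda>n. \<gamma> + ml_c (lam n) T)"
      by (intro growth_add order_const growth_mono[OF o(1)]) simp
    then show "lam_order (- 1) (\<lambda>n. (\<gamma> + ml_c (lam n) T) * ml_s (lam n) \<xi>)"
      by (rule growth_mult[OF _ ox(2)]) (use \<xi> in auto)
  qed
  from growth_mult[OF this order_det] show ?thesis unfolding P3_eq[OF T] by simp
qed

text \<open>\<lambda> ml_k(\<xi>) = 1 - ml_c(\<xi>) supplies the limit 1; the two correction terms
  have order -1 even after multiplication by \<lambda>.\<close>

lemma order_Tri_\<xi>: "lam_order 1 (\<lambda>n. 1 / Tri \<alpha> \<gamma> T (lam n) \<xi>)"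
proof (rule order_inverse)
  note o = order_parts[OF T]
  have xp: "\<xi> > 0" using \<xi> by simp
  have c: "(\<lambda>n. ml_c (lam n) \<xi>) \<longlonglongrightarrow> 0" by (rule order_tendsto_0[OF order_parts(1)[OF xp]]) simp
  have "lam_order 0 (\<lambda>n. lam n * ml_k (lam n) T)" by (rule growth_mult[OF order_lam o(3)]) simp
  then have "lam_order (- 1) (\<lambda>n. lam n * ml_k (lam n) T * P2 \<alpha> \<gamma> T (lam n) \<xi>)"
    by (rule growth_mult[OF _ order_P2_\<xi>]) simp
  then have k: "(\<lambda>n. lam n * ml_k (lam n) T * P2 \<alpha> \<gamma> T (lam n) \<xi>) \<longlonglongrightarrow> 0"
    by (rule order_tendsto_0) simp
  have "lam_order (- 1) (\<lambda>n. lam n * ml_p (lam n) T)" by (rule growth_mult[OF order_lam o(4)]) simp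
  then have "lam_order (- 1) (\<lambda>n. lam n * ml_p (lam n) T * P3 \<alpha> \<gamma> T (lam n) \<xi>)"
    by (rule growth_mult[OF _ order_P3_\<xi>]) simp
  then have p: "(\<lambda>n. lam n * ml_p (lam n) T * P3 \<alpha> \<gamma> T (lam n) \<xi>) \<longlonglongrightarrow> 0"
    by (rule order_tendsto_0) simp
  have "(\<lambda>n. 1 - ml_c (lam n) \<xi> - lam n * ml_k (lam n) T * P2 \<alpha> \<gamma> T (lam n) \<xi>
      - lam n * ml_p (lam n) T * P3 \<alpha> \<gamma> T (lam n) \<xi>) \<longlonglongrightarrow> 1 - 0 - 0 - 0"
    by (intro tendsto_intros c k p)
  moreover have "1 - ml_c (lam n) \<xi> - lam n * ml_k (lam n) T * P2 \<alpha> \<gamma> T (lam n) \<xi>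
      - lam n * ml_p (lam n) T * P3 \<alpha> \<gamma> T (lam n) \<xi> = lam n * Tri \<alpha> \<gamma> T (lam n) \<xi>" for n
    unfolding Tri_eq ml_c_eq by (simp add: algebra_simps)
  ultimately show "(\<lambda>n. lam n * Tri \<alpha> \<gamma> T (lam n) \<xi>) \<longlonglongrightarrow> 1" by simp
qed (use Tri_nonzero in auto)

text \<open>Dividing by the determinant costs one order. In \<open>nl_a\<close> every datum meets
  ml_c(T) or ml_s(T), of order -1, and nothing is lost; in \<open>nl_b\<close> the datum q meets
  only \<gamma> + ml_c(T), so its order rises from 1/\<alpha> - 2 to 1/\<alpha> - 1.\<close>

lemma growth_nl_ab:
  assumes p: "growth (1 / \<alpha> - 2) w p" and q: "growth (1 / \<alpha> - 2) w q" and f: "growth 0 w f"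
  shows "growth (- 1) w (\<lambda>n. nl_a \<gamma> T (lam n) (p n) (q n) (f n))"
    and "growth (1 / \<alpha> - 1) w (\<lambda>n. nl_b \<gamma> T (lam n) (p n) (q n) (f n))"
proof -
  note o = order_parts[OF T]
  have \<alpha>': "1 / \<alpha> > 0" "1 / \<alpha> < 1" using \<alpha> by auto
  have "growth (- 1) w (\<lambda>n. ml_k (lam n) T * f n)" by (rule growth_mult[OF o(3) f]) simp
  moreover have "growth (- 1) w p" using p by (rule growth_mono) (use \<alpha>' in simp)
  ultimately have X: "growth (- 1) w (\<lambda>n. p n - f n * ml_k (lam n) T)"
    using growth_diff[of "-1" w p "\<lambda>n. ml_k (lam n) T * f n"] by (simp add: mult.commute)
  have "growth (1 / \<alpha> - 2) w (\<lambda>n. ml_p (lam n) T * f n)"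
    by (rule growth_mono[OF growth_mult[OF o(4) f refl]]) (use \<alpha>' in simp)
  then have Y: "growth (1 / \<alpha> - 2) w (\<lambda>n. q n - f n * ml_p (lam n) T)"
    using growth_diff[OF q, of "\<lambda>n. ml_p (lam n) T * f n"] by (simp add: mult.commute)
  have "growth (- 2) w (\<lambda>n. ml_c (lam n) T * (p n - f n * ml_k (lam n) T))"
    by (rule growth_mult[OF o(1) X]) simp
  moreover have "growth (- 2) w (\<lambda>n. ml_s (lam n) T * (q n - f n * ml_p (lam n) T))"
    by (rule growth_mono[OF growth_mult[OF o(2) Y refl]]) (use \<alpha>' in simp)
  ultimately have "growth (- 2) w (\<lambda>n. ml_c (lam n) T * (p n - f n * ml_k (lam n) T) - ml_s (lam n) T * (q n - f n * ml_p (lam n) T))"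
    by (rule growth_diff)
  from growth_mult[OF order_det this]
  show "growth (- 1) w (\<lambda>n. nl_a \<gamma> T (lam n) (p n) (q n) (f n))"
    by (simp add: nl_a_def mult.commute)
  have "lam_order 0 (\<lambda>n. \<gamma> + ml_c (lam n) T)"
    by (intro growth_add order_const growth_mono[OF o(1)]) simp
  from growth_mult[OF this Y]
  have 1: "growth (1 / \<alpha> - 2) w (\<lambda>n. (\<gamma> + ml_c (lam n) T) * (q n - f n * ml_p (lam n) T))" by simp
  have "lam_order (- 1) (\<lambda>n. lam n * ml_p (lam n) T)" by (rule growth_mult[OF order_lam o(4)]) simp
  then have "growth (1 / \<alpha> - 2) w (\<lambda>n. lam n * ml_p (lam n) T * (p n - f n * ml_k (lam n) T))"
    by (rule growth_mono[OF growth_mult[OF _ X refl]]) (use \<alpha>' in simp)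
  from growth_mult[OF order_det growth_add[OF 1 this]]
  show "growth (1 / \<alpha> - 1) w (\<lambda>n. nl_b \<gamma> T (lam n) (p n) (q n) (f n))"
    by (simp add: nl_b_def mult.commute)
qed

lemma solution_bounds:
  assumes "growth (- 1) w a" "growth (1 / \<alpha> - 1) w b" "growth 0 w f" and w: "\<And>n. w n \<ge> 0"
  shows "\<exists>K\<ge>0.
     (\<forall>n. \<forall>t\<in>{0..T}.
        \<bar>a n * ml_c (lam n) t + b n * ml_s (lam n) t + f n * ml_k (lam n) t\<bar> \<le> K * w n \<and>
        \<bar>lam n * (a n * ml_c (lam n) t + b n * ml_s (lam n) t + f n * ml_k (lam n) t)\<bar> \<le> K * w n \<and>
        \<bar>(f n - a n * lam n) * ml_p (lam n) t + b n * ml_c (lam n) t\<bar> \<le> K * w n) \<and>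
     (\<forall>n. \<forall>t\<in>{0<..T}.
        \<bar>(f n - a n * lam n) * ml_q (lam n) t - b n * (lam n * ml_p (lam n) t)\<bar> \<le> K * w n * t powr (\<alpha> - 2))"
proof -
  obtain Ka where Ka: "\<And>n. \<bar>a n\<bar> \<le> Ka * (lam n powr (- 1) * w n)" using assms(1) unfolding growth_def by blast
  obtain Kb where Kb: "\<And>n. \<bar>b n\<bar> \<le> Kb * (lam n powr (1 / \<alpha> - 1) * w n)" using assms(2) unfolding growth_def by blast
  \<comment> \<open>\<open>b\<close> is used at two orders: the sharp one against
    \<open>ml_s\<close> and l * \<open>ml_p\<close>, the coarse order 0 against \<open>ml_c\<close>,
    which is merely bounded near t = 0.\<close>
  have "growth 0 w b" using assms(2) by (rule growth_mono) (use \<alpha> in simp)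
  then obtain Kc where Kc: "\<And>n. \<bar>b n\<bar> \<le> Kc * (lam n powr 0 * w n)" unfolding growth_def by blast
  obtain Kf where Kf: "\<And>n. \<bar>f n\<bar> \<le> Kf * (lam n powr 0 * w n)" using assms(3) unfolding growth_def by blast
  obtain C where "ml_majorant C" using ml_majorant_exists ..
  note C0 = this[unfolded ml_majorant_def, THEN conjunct1]
    and CD = ml_majorantD[OF \<open>ml_majorant C\<close>] and CP = ml_majorantD_pos[OF \<open>ml_majorant C\<close>]
  define Ks where "Ks = \<bar>Ka\<bar> + \<bar>Kb\<bar> + \<bar>Kc\<bar> + \<bar>Kf\<bar>"
  have up: "x * w n \<le> \<bar>x\<bar> * w n" for x n using w[of n] by (intro mult_right_mono) auto
  have al: "\<bar>a n\<bar> * lam n \<le> \<bar>Ka\<bar> * w n" for n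
  proof -
    have "\<bar>a n\<bar> * lam n \<le> Ka * (lam n powr (- 1) * w n) * lam n"
      using Ka[of n] lam_pos[of n] by (intro mult_right_mono) auto
    also have "\<dots> = Ka * w n" using lam_pos[of n] by (simp add: powr_minus_divide)
    finally show ?thesis using up[of Ka n] by linarith
  qed
  have fl: "\<bar>f n\<bar> \<le> \<bar>Kf\<bar> * w n" for n using Kf[of n] up[of Kf n] lam_pos[of n] by simp
  have bl: "\<bar>b n\<bar> \<le> \<bar>Kc\<bar> * w n" for n using Kc[of n] up[of Kc n] lam_pos[of n] by simp
  have bs: "\<bar>b n\<bar> * lam n powr (1 - 1 / \<alpha>) \<le> \<bar>Kb\<bar> * w n" for n
  proof -
    have "\<bar>b n\<bar> * lam n powr (1 - 1 / \<alpha>) \<le> Kb * (lam n powr (1 / \<alpha> - 1) * w n) * lam n powr (1 - 1 / \<alpha>)"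
      using Kb[of n] by (intro mult_right_mono) auto
    also have "\<dots> = Kb * w n * (lam n powr (1 / \<alpha> - 1) * lam n powr (1 - 1 / \<alpha>))" by simp
    also have "\<dots> = Kb * w n" using lam_pos[of n] by (simp add: powr_add[symmetric])
    finally show ?thesis using up[of Kb n] by linarith
  qed
  have fal: "\<bar>f n - a n * lam n\<bar> \<le> (\<bar>Kf\<bar> + \<bar>Ka\<bar>) * w n" for n
    using abs_triangle_ineq4[of "f n" "a n * lam n"] fl[of n] al[of n] lam_pos[of n]
    by (simp add: abs_mult algebra_simps)
  have ltriple: "\<bar>lam n * (a n * ml_c (lam n) t + b n * ml_s (lam n) t + f n * ml_k (lam n) t)\<bar> \<le> C * Ks * w n"
    if t: "t \<in> {0..T}" for n t
  proof -
    have t0: "t \<ge> 0" using t by simp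
    have 1: "\<bar>a n\<bar> * lam n * \<bar>ml_c (lam n) t\<bar> \<le> \<bar>Ka\<bar> * w n * C"
      using CD(1)[OF lam_pos t0, of n] w[of n] by (intro mult_mono[OF al]) auto
    have "lam n * \<bar>ml_s (lam n) t\<bar> \<le> lam n * (C * lam n powr (- 1 / \<alpha>))"
      using CD(2)[OF lam_pos t0, of n] lam_pos[of n] by (intro mult_left_mono) auto
    also have "\<dots> = C * lam n powr (1 - 1 / \<alpha>)" using lam_pos[of n] powr_add[of "lam n" 1 "- 1 / \<alpha>"] by simp
    finally have "\<bar>b n\<bar> * (lam n * \<bar>ml_s (lam n) t\<bar>) \<le> \<bar>b n\<bar> * (C * lam n powr (1 - 1 / \<alpha>))"
      by (rule mult_left_mono) simp
    also have "\<dots> = C * (\<bar>b n\<bar> * lam n powr (1 - 1 / \<alpha>))" by simp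
    also have "\<dots> \<le> C * (\<bar>Kb\<bar> * w n)" using bs[of n] C0 by (intro mult_left_mono) auto
    finally have 2: "\<bar>b n\<bar> * (lam n * \<bar>ml_s (lam n) t\<bar>) \<le> C * (\<bar>Kb\<bar> * w n)" .
    have "lam n * \<bar>ml_k (lam n) t\<bar> \<le> lam n * (C * (1 / lam n))"
      using CD(3)[OF lam_pos t0, of n] lam_pos[of n] by (intro mult_left_mono) auto
    also have "\<dots> = C" using lam_pos[of n] by simp
    finally have "\<bar>f n\<bar> * (lam n * \<bar>ml_k (lam n) t\<bar>) \<le> \<bar>Kf\<bar> * w n * C"
      using fl[of n] w[of n] lam_pos[of n] by (intro mult_mono) auto
    note 3 = this
    have 4: "0 \<le> C * (\<bar>Kc\<bar> * w n)" using C0 w[of n] by simp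
    have "\<bar>lam n * (a n * ml_c (lam n) t + b n * ml_s (lam n) t + f n * ml_k (lam n) t)\<bar>
        = \<bar>lam n * a n * ml_c (lam n) t + lam n * b n * ml_s (lam n) t + lam n * f n * ml_k (lam n) t\<bar>"
      by (simp add: algebra_simps)
    also have "\<dots> \<le> \<bar>lam n * a n * ml_c (lam n) t\<bar> + \<bar>lam n * b n * ml_s (lam n) t\<bar> + \<bar>lam n * f n * ml_k (lam n) t\<bar>"
      by linarith
    also have "\<dots> = \<bar>a n\<bar> * lam n * \<bar>ml_c (lam n) t\<bar> + \<bar>b n\<bar> * (lam n * \<bar>ml_s (lam n) t\<bar>) + \<bar>f n\<bar> * (lam n * \<bar>ml_k (lam n) t\<bar>)"
      using lam_pos[of n] by (simp add: abs_mult mult_ac)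
    also have "\<dots> \<le> C * Ks * w n" using 1 2 3 4 by (simp add: Ks_def algebra_simps)
    finally show ?thesis .
  qed
  define P where "P = T powr (\<alpha> - 1)"
  have P: "P \<ge> 0" "t powr (\<alpha> - 1) \<le> P" if "t \<in> {0..T}" for t
    using that \<alpha> by (auto simp: P_def intro!: powr_mono2)
  have Ks: "Ks \<ge> 0" by (simp add: Ks_def)
  \<comment> \<open>The coefficient of u is bounded through that of A u, whence the division by the
    least eigenvalue.\<close>
  define K where "K = C * Ks / lam 0 + C * Ks + C * Ks * P + C * Ks"
  have K4: "C * Ks / lam 0 \<ge> 0" "C * Ks \<ge> 0" "C * Ks * P \<ge> 0"
    using C0 Ks lam_pos[of 0] by (auto simp: P_def)
  have Kmono: "x * w n \<le> K * w n" if "x \<le> K" for x n using that w[of n] by (rule mult_right_mono)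
  show ?thesis
  proof (intro exI[of _ K] conjI allI ballI)
    show "K \<ge> 0" using K4 by (simp add: K_def)
    fix n t assume t: "t \<in> {0..T}"
    let ?u = "a n * ml_c (lam n) t + b n * ml_s (lam n) t + f n * ml_k (lam n) t"
    show "\<bar>lam n * ?u\<bar> \<le> K * w n"
      using ltriple[OF t, of n] Kmono[of "C * Ks" n] K4 by (simp add: K_def)
    have "lam 0 * \<bar>?u\<bar> \<le> \<bar>lam n * ?u\<bar>"
      unfolding abs_mult using lam_0_le[of n] lam_pos[of n] by (intro mult_right_mono) auto
    with ltriple[OF t, of n] have "lam 0 * \<bar>?u\<bar> \<le> C * Ks * w n" by linarith
    then have "\<bar>?u\<bar> \<le> C * Ks / lam 0 * w n" using lam_pos[of 0] by (simp add: field_simps)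
    then show "\<bar>?u\<bar> \<le> K * w n" using Kmono[of "C * Ks / lam 0" n] K4 by (simp add: K_def)
    have t0: "t \<ge> 0" using t by simp
    have "\<bar>ml_p (lam n) t\<bar> \<le> C * P"
      using CD(4)[OF lam_pos t0, of n] mult_left_mono[OF P(2)[OF t], of C] C0 by linarith
    then have "\<bar>f n - a n * lam n\<bar> * \<bar>ml_p (lam n) t\<bar> \<le> (\<bar>Kf\<bar> + \<bar>Ka\<bar>) * w n * (C * P)"
      using fal[of n] w[of n] by (intro mult_mono) auto
    also have "\<dots> \<le> C * Ks * P * w n"
    proof -
      have "(\<bar>Kf\<bar> + \<bar>Ka\<bar>) * (C * P * w n) \<le> Ks * (C * P * w n)"
        using C0 P(1)[OF t] w[of n] by (intro mult_right_mono) (auto simp: Ks_def)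
      then show ?thesis by (simp add: mult_ac)
    qed
    finally have 1: "\<bar>f n - a n * lam n\<bar> * \<bar>ml_p (lam n) t\<bar> \<le> C * Ks * P * w n" .
    have "\<bar>b n\<bar> * \<bar>ml_c (lam n) t\<bar> \<le> \<bar>Kc\<bar> * w n * C"
      using bl[of n] CD(1)[OF lam_pos t0, of n] w[of n] by (intro mult_mono) auto
    also have "\<dots> \<le> C * Ks * w n"
    proof -
      have "\<bar>Kc\<bar> * (w n * C) \<le> Ks * (w n * C)"
        using C0 w[of n] by (intro mult_right_mono) (auto simp: Ks_def)
      then show ?thesis by (simp add: mult_ac)
    qed
    finally have 2: "\<bar>b n\<bar> * \<bar>ml_c (lam n) t\<bar> \<le> C * Ks * w n" .
    have "\<bar>(f n - a n * lam n) * ml_p (lam n) t + b n * ml_c (lam n) t\<bar>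
        \<le> \<bar>f n - a n * lam n\<bar> * \<bar>ml_p (lam n) t\<bar> + \<bar>b n\<bar> * \<bar>ml_c (lam n) t\<bar>"
      unfolding abs_mult[symmetric] by (rule abs_triangle_ineq)
    also have "\<dots> \<le> (C * Ks * P + C * Ks) * w n" using 1 2 by (simp add: algebra_simps)
    finally show "\<bar>(f n - a n * lam n) * ml_p (lam n) t + b n * ml_c (lam n) t\<bar> \<le> K * w n"
      using Kmono[of "C * Ks * P + C * Ks" n] K4 by (simp add: K_def)
  next
    fix n t assume "t \<in> {0<..T}"
    then have t: "t > 0" by simp
    let ?t = "t powr (\<alpha> - 2)"
    have 1: "\<bar>f n - a n * lam n\<bar> * \<bar>ml_q (lam n) t\<bar> \<le> (\<bar>Kf\<bar> + \<bar>Ka\<bar>) * w n * (C * ?t)"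
      using fal[of n] CP(5)[OF lam_pos t, of n] w[of n] by (intro mult_mono) auto
    have "\<bar>b n\<bar> * (lam n * \<bar>ml_p (lam n) t\<bar>) \<le> \<bar>b n\<bar> * (C * ?t * lam n powr (1 - 1 / \<alpha>))"
      by (intro mult_left_mono CP(4) lam_pos t) auto
    also have "\<dots> = C * ?t * (\<bar>b n\<bar> * lam n powr (1 - 1 / \<alpha>))" by simp
    also have "\<dots> \<le> C * ?t * (\<bar>Kb\<bar> * w n)" using bs[of n] C0 by (intro mult_left_mono) auto
    finally have 2: "\<bar>b n\<bar> * (lam n * \<bar>ml_p (lam n) t\<bar>) \<le> C * ?t * (\<bar>Kb\<bar> * w n)" .
    have "\<bar>(f n - a n * lam n) * ml_q (lam n) t - b n * (lam n * ml_p (lam n) t)\<bar>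
        \<le> \<bar>f n - a n * lam n\<bar> * \<bar>ml_q (lam n) t\<bar> + \<bar>b n\<bar> * (lam n * \<bar>ml_p (lam n) t\<bar>)"
      using abs_triangle_ineq4[of "(f n - a n * lam n) * ml_q (lam n) t" "b n * (lam n * ml_p (lam n) t)"] lam_pos[of n]
      by (simp add: abs_mult)
    also have "\<dots> \<le> (C * ?t * w n) * (\<bar>Kf\<bar> + \<bar>Ka\<bar> + \<bar>Kb\<bar>)" using 1 2 by (simp add: algebra_simps)
    also have "\<dots> \<le> (C * ?t * w n) * Ks"
      using C0 w[of n] by (intro mult_left_mono) (auto simp: Ks_def)
    also have "\<dots> = C * Ks * w n * ?t" by simp
    also have "\<dots> \<le> K * w n * ?t"
      using K4 by (intro mult_right_mono Kmono) (auto simp: K_def)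
    finally show "\<bar>(f n - a n * lam n) * ml_q (lam n) t - b n * (lam n * ml_p (lam n) t)\<bar> \<le> K * w n * ?t" .
  qed
qed

end

subsection \<open>Existence and uniqueness\<close>

context inverse_problem
begin

text \<open>The coefficients of u, A u and u' are dominated on all of [0, T], those of u'' only up
  to the factor t^(\<alpha> - 2); hence u' is differentiated away from 0, and the Caputo integral is
  handled by an integrable majorant.\<close>

lemma series_solution:
  fixes a b f w :: "nat \<Rightarrow> real"
  assumes gr: "growth (- 1) w a" "growth (1 / \<alpha> - 1) w b" "growth 0 w f"
    and w: "\<And>n. w n \<ge> 0" "summable (\<lambda>n. (w n)\<^sup>2)"
  defines "c \<equiv> \<lambda>n t. a n * ml_c (lam n) t + b n * ml_s (lam n) t + f n * ml_k (lam n) t"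
  defines "u \<equiv> \<lambda>t. \<Sum>n. c n t *\<^sub>R e n"
  shows "\<And>t. t \<in> {0..T} \<Longrightarrow> u t \<in> D"
    and "continuous_on {0..T} (\<lambda>t. A (u t))"
    and "C1_on_closed_interval 0 T u"
    and "\<And>t. t \<in> {0<..T} \<Longrightarrow> caputo_exists \<alpha> u t"
    and "\<And>t. t \<in> {0<..T} \<Longrightarrow> caputo_deriv \<alpha> u t = (\<Sum>n. f n *\<^sub>R e n) - A (u t)"
    and "\<And>t n. t \<in> {0..T} \<Longrightarrow> inner (u t) (e n) = c n t"
    and "\<And>n. inner (vector_derivative u (at T within {0..T})) (e n)
      = - a n * lam n * ml_p (lam n) T + b n * ml_c (lam n) T + f n * ml_p (lam n) T"
proof -
  define c1 where "c1 n t = (f n - a n * lam n) * ml_p (lam n) t + b n * ml_c (lam n) t" for n t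
  define c2 where "c2 n t = (f n - a n * lam n) * ml_q (lam n) t - b n * (lam n * ml_p (lam n) t)" for n t
  have "\<exists>K\<ge>0.
      (\<forall>n. \<forall>t\<in>{0..T}. \<bar>c n t\<bar> \<le> K * w n \<and> \<bar>lam n * c n t\<bar> \<le> K * w n \<and> \<bar>c1 n t\<bar> \<le> K * w n) \<and>
      (\<forall>n. \<forall>t\<in>{0<..T}. \<bar>c2 n t\<bar> \<le> K * w n * t powr (\<alpha> - 2))"
    unfolding c_def c1_def c2_def by (rule solution_bounds[OF gr w(1)])
  then obtain K where K: "K \<ge> 0"
    and b1: "\<forall>n. \<forall>t\<in>{0..T}. \<bar>c n t\<bar> \<le> K * w n \<and> \<bar>lam n * c n t\<bar> \<le> K * w n \<and> \<bar>c1 n t\<bar> \<le> K * w n"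
    and b2: "\<forall>n. \<forall>t\<in>{0<..T}. \<bar>c2 n t\<bar> \<le> K * w n * t powr (\<alpha> - 2)"
    by (elim exE conjE)
  define B where "B n = K * w n" for n
  have sB: "summable (\<lambda>n. (B n)\<^sup>2)"
    unfolding B_def power_mult_distrib using w(2) by (rule summable_mult)
  have bc: "\<bar>c n t\<bar> \<le> B n" and blc: "\<bar>lam n * c n t\<bar> \<le> B n" and bc1: "\<bar>c1 n t\<bar> \<le> B n"
    if "t \<in> {0..T}" for n t using b1 that by (auto simp: B_def)
  have bc2: "\<bar>c2 n t\<bar> \<le> B n * t powr (\<alpha> - 2)" if "t \<in> {0<..T}" for n t
    using b2 that by (auto simp: B_def)
  have sq: "summable (\<lambda>n. (g n)\<^sup>2)" if "\<And>n. \<bar>g n\<bar> \<le> B n * M" for g M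
    by (rule summable_sq_bound[OF sB, of _ M]) (use that in \<open>simp add: mult.commute\<close>)
  have sqc: "summable (\<lambda>n. (c n t)\<^sup>2)" "summable (\<lambda>n. (lam n * c n t)\<^sup>2)" "summable (\<lambda>n. (c1 n t)\<^sup>2)"
    if "t \<in> {0..T}" for t
    using sq[of _ 1] bc[OF that] blc[OF that] bc1[OF that] by auto
  have sqf: "summable (\<lambda>n. (f n)\<^sup>2)"
  proof -
    obtain Kf where "\<And>n. \<bar>f n\<bar> \<le> Kf * (lam n powr 0 * w n)" using gr(3) unfolding growth_def by blast
    then show ?thesis
      by (intro summable_sq_bound[OF w(2), of _ Kf]) (use lam_pos in \<open>auto simp: less_imp_neq[symmetric]\<close>)
  qed
  show D: "u t \<in> D" if "t \<in> {0..T}" for t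
    unfolding u_def by (rule suminf_in_domain(1)[OF sqc(1,2)[OF that]])
  have Au: "A (u t) = (\<Sum>n. (lam n * c n t) *\<^sub>R e n)" if "t \<in> {0..T}" for t
    unfolding u_def by (rule suminf_in_domain(2)[OF sqc(1,2)[OF that]])
  have sub: "continuous_on {0..T} g" if "continuous_on {0..} g" for g :: "real \<Rightarrow> real"
    using that by (rule continuous_on_subset) auto
  have contc: "continuous_on {0..T} (c n)" "continuous_on {0..T} (c1 n)" for n
    unfolding c_def c1_def by (intro continuous_intros sub continuous_on_ml_parts)+
  have "continuous_on {0..T} (\<lambda>t. \<Sum>n. (lam n * c n t) *\<^sub>R e n)"
    by (rule continuous_on_suminf_e[OF sB]) (use blc contc in \<open>auto intro!: continuous_intros\<close>)
  then show contA: "continuous_on {0..T} (\<lambda>t. A (u t))"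
    by (rule continuous_on_eq) (simp add: Au)
  show inner_u: "inner (u t) (e n) = c n t" if "t \<in> {0..T}" for t n
    unfolding u_def by (rule inner_suminf_e[OF sqc(1)[OF that]])
  define v where "v t = (\<Sum>n. c1 n t *\<^sub>R e n)" for t
  have dc: "(c n has_real_derivative c1 n t) (at t within {0..T})" if "t \<in> {0..T}" for n t
  proof -
    have t0: "t \<ge> 0" using that by simp
    have "(c n has_real_derivative a n * (- lam n * ml_p (lam n) t) + b n * ml_c (lam n) t + f n * ml_p (lam n) t) (at t within {0..})"
      unfolding c_def
      by (intro DERIV_add DERIV_cmult ml_c_deriv ml_s_deriv ml_k_deriv t0)
    then have "(c n has_real_derivative c1 n t) (at t within {0..})"
      by (simp add: c1_def algebra_simps)
    then show ?thesis by (rule DERIV_subset) auto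
  qed
  have du: "(u has_vector_derivative v t) (at t within {0..T})" if "t \<in> {0..T}" for t
    unfolding u_def v_def
    by (rule has_vector_derivative_suminf_e[OF _ that sB _ sB]) (use bc1 bc dc in auto)
  have vd: "vector_derivative u (at t within {0..T}) = v t" if "t \<in> {0..T}" for t
    using vector_derivative_within_cbox[of 0 T t u "v t"] du[OF that] that T by simp
  have contv: "continuous_on {0..T} v"
    unfolding v_def by (rule continuous_on_suminf_e[OF sB]) (use bc1 contc in auto)
  show "C1_on_closed_interval 0 T u"
    unfolding C1_on_closed_interval_def
  proof (intro conjI ballI)
    show "u differentiable (at t within {0..T})" if "t \<in> {0..T}" for t
      using du[OF that] by (rule differentiableI_vector)
    show "continuous_on {0..T} (\<lambda>t. vector_derivative u (at t within {0..T}))"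
      using contv by (rule continuous_on_eq) (simp add: vd)
  qed
  show "inner (vector_derivative u (at T within {0..T})) (e n)
      = - a n * lam n * ml_p (lam n) T + b n * ml_c (lam n) T + f n * ml_p (lam n) T" for n
  proof -
    have "T \<in> {0..T}" using T by simp
    then have "inner (vector_derivative u (at T within {0..T})) (e n) = c1 n T"
      unfolding vd[OF \<open>T \<in> {0..T}\<close>] v_def by (rule inner_suminf_e[OF sqc(3)])
    then show ?thesis by (simp add: c1_def algebra_simps)
  qed
  define z where "z t = (\<Sum>n. c2 n t *\<^sub>R e n)" for t
  have sqc2: "summable (\<lambda>n. (c2 n t)\<^sup>2)" if "t \<in> {0<..T}" for t
    by (rule sq[of _ "t powr (\<alpha> - 2)"]) (rule bc2[OF that])
  have inner_z: "inner (z t) (e n) = c2 n t" if "t \<in> {0<..T}" for t n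
    unfolding z_def by (rule inner_suminf_e[OF sqc2[OF that]])
  have du': "(u has_vector_derivative v t) (at t)" if "t \<in> {0<..<T}" for t
    using du[of t] that at_within_Icc_at[of 0 t T] by simp
  have dv: "(v has_vector_derivative z t) (at t)" if t: "t \<in> {0<..<T}" for t
  proof -
    \<comment> \<open>On this interval the factor s^(\<alpha> - 2) is bounded, which gives the
      series of second derivatives a majorant free of the variable.\<close>
    let ?S = "{t / 2..T}"
    have "(v has_vector_derivative z t) (at t within ?S)"
      unfolding v_def z_def
    proof (rule has_vector_derivative_suminf_e[where B = "\<lambda>n. (t / 2) powr (\<alpha> - 2) * B n" and C = B])
      show "summable (\<lambda>n. ((t / 2) powr (\<alpha> - 2) * B n)\<^sup>2)"
        unfolding power_mult_distrib using sB by (rule summable_mult)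
      show "\<bar>c2 n s\<bar> \<le> (t / 2) powr (\<alpha> - 2) * B n" if s: "s \<in> ?S" for n s
      proof -
        have "s powr (\<alpha> - 2) \<le> (t / 2) powr (\<alpha> - 2)" using s t \<alpha> by (intro powr_mono2') auto
        then have "B n * s powr (\<alpha> - 2) \<le> B n * (t / 2) powr (\<alpha> - 2)"
          using K w(1)[of n] by (intro mult_left_mono) (auto simp: B_def)
        moreover have "\<bar>c2 n s\<bar> \<le> B n * s powr (\<alpha> - 2)" using s t by (intro bc2) auto
        ultimately show ?thesis by (simp add: mult.commute)
      qed
      show "\<bar>c1 n s\<bar> \<le> B n" if "s \<in> ?S" for n s using that t by (intro bc1) auto
      show "(c1 n has_real_derivative c2 n s) (at s within ?S)" if s: "s \<in> ?S" for n s
      proof -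
        have s0: "s > 0" using s t by simp
        have "(ml_c (lam n) has_real_derivative - lam n * ml_p (lam n) s) (at s)"
          using ml_c_deriv[of s "lam n"] s0 at_within_interior[of s "{0..}"] by auto
        then have "(c1 n has_real_derivative (f n - a n * lam n) * ml_q (lam n) s + b n * (- lam n * ml_p (lam n) s)) (at s)"
          unfolding c1_def by (intro DERIV_add DERIV_cmult ml_p_deriv s0)
        then have "(c1 n has_real_derivative c2 n s) (at s)" by (simp add: c2_def algebra_simps)
        then show ?thesis by (rule has_field_derivative_at_within)
      qed
    qed (use t sB in auto)
    then show ?thesis using t at_within_Icc_at[of "t / 2" t T] by simp
  qed
  have vdu: "vector_derivative u (at t) = v t" if "t \<in> {0<..<T}" for t
    using du'[OF that] by (rule vector_derivative_at)
  have dvdu: "((\<lambda>r. vector_derivative u (at r)) has_vector_derivative z t) (at t)" if "t \<in> {0<..<T}" for t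
    by (rule has_vector_derivative_transform_within_open[OF dv[OF that] open_greaterThanLessThan that])
      (simp add: vdu)
  have sd: "second_deriv u t = z t" if "t \<in> {0<..<T}" for t
    unfolding second_deriv_def using dvdu[OF that] by (rule vector_derivative_at)
  define N where "N = sqrt (\<Sum>n. (B n)\<^sup>2)"
  \<comment> \<open>Splitting off the singular factor leaves coefficients dominated by
    \<open>B\<close> on the whole of (0, T]; continuity of \<open>z\<close> and its norm bound
    follow from this.\<close>
  have z_eq: "z t = t powr (\<alpha> - 2) *\<^sub>R (\<Sum>n. (t powr (2 - \<alpha>) * c2 n t) *\<^sub>R e n)"
    and b2': "\<And>n. \<bar>t powr (2 - \<alpha>) * c2 n t\<bar> \<le> B n" if t: "t \<in> {0<..T}" for t
  proof -
    show bb: "\<bar>t powr (2 - \<alpha>) * c2 n t\<bar> \<le> B n" for n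
    proof -
      have "\<bar>t powr (2 - \<alpha>) * c2 n t\<bar> \<le> t powr (2 - \<alpha>) * (B n * t powr (\<alpha> - 2))"
        unfolding abs_mult using bc2[OF t, of n] by (simp add: mult_left_mono)
      also have "\<dots> = B n * (t powr (2 - \<alpha>) * t powr (\<alpha> - 2))" by simp
      also have "\<dots> = B n" using t by (simp add: powr_add[symmetric])
      finally show ?thesis .
    qed
    have "summable (\<lambda>n. (t powr (2 - \<alpha>) * c2 n t)\<^sup>2)" by (rule sq[of _ 1]) (use bb in simp)
    from suminf_scaleR_right[OF summable_e[OF this], of "t powr (\<alpha> - 2)"]
    have "t powr (\<alpha> - 2) *\<^sub>R (\<Sum>n. (t powr (2 - \<alpha>) * c2 n t) *\<^sub>R e n)
        = (\<Sum>n. ((t powr (\<alpha> - 2) * t powr (2 - \<alpha>)) * c2 n t) *\<^sub>R e n)" by (simp add: mult.assoc)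
    also have "t powr (\<alpha> - 2) * t powr (2 - \<alpha>) = 1" using t by (simp add: powr_add[symmetric])
    finally show "z t = t powr (\<alpha> - 2) *\<^sub>R (\<Sum>n. (t powr (2 - \<alpha>) * c2 n t) *\<^sub>R e n)"
      by (simp add: z_def)
  qed
  have contz: "continuous_on {0<..T} z"
  proof -
    have sub': "continuous_on {0<..T} g" if "continuous_on {0..} g \<or> continuous_on {0<..} g" for g :: "real \<Rightarrow> real"
      using that by (auto elim: continuous_on_subset)
    have "continuous_on {0<..T} (\<lambda>t. t powr (2 - \<alpha>) * c2 n t)" for n
      unfolding c2_def
      by (intro continuous_intros sub'; use continuous_on_ml_parts continuous_on_ml_q in auto)
    then have "continuous_on {0<..T} (\<lambda>t. \<Sum>n. (t powr (2 - \<alpha>) * c2 n t) *\<^sub>R e n)"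
      by (intro continuous_on_suminf_e[OF sB]) (use b2' in auto)
    then have "continuous_on {0<..T} (\<lambda>t. t powr (\<alpha> - 2) *\<^sub>R (\<Sum>n. (t powr (2 - \<alpha>) * c2 n t) *\<^sub>R e n))"
      by (intro continuous_intros) auto
    then show ?thesis by (rule continuous_on_eq) (simp add: z_eq)
  qed
  have normz: "norm (z t) \<le> N * t powr (\<alpha> - 2)" if t: "t \<in> {0<..T}" for t
  proof -
    have "norm (\<Sum>n. (t powr (2 - \<alpha>) * c2 n t) *\<^sub>R e n) \<le> N"
      unfolding N_def by (rule norm_suminf_e_le[OF sB b2'[OF t]])
    from mult_left_mono[OF this powr_ge_zero, of t "\<alpha> - 2"] show ?thesis
      unfolding z_eq[OF t] by (simp add: mult.commute)
  qed
  have int: "set_integrable lborel {0<..<t} (\<lambda>s. (t - s) powr (1 - \<alpha>) *\<^sub>R second_deriv u s)"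
    if t: "t \<in> {0<..T}" for t
    unfolding set_integrable_def
  proof (rule Bochner_Integration.integrable_bound)
    \<comment> \<open>The majorant is a Beta integrand with the parameters \<alpha> - 1 and 2 -
      \<alpha>, both positive.\<close>
    have "set_integrable lborel {0<..<t} (\<lambda>s. N * ((t - s) powr (1 - \<alpha>) * s powr (\<alpha> - 2)))"
      using Beta_integral_scaled(1)[of "\<alpha> - 1" "2 - \<alpha>" t] \<alpha> t by (intro set_integrable_mult_right) simp
    then show "integrable lborel (\<lambda>s. indicator {0<..<t} s *\<^sub>R (N * ((t - s) powr (1 - \<alpha>) * s powr (\<alpha> - 2))))"
      by (simp only: set_integrable_def)
    have "continuous_on {0<..<t} (\<lambda>s. (t - s) powr (1 - \<alpha>) *\<^sub>R z s)"
      using t by (intro continuous_intros continuous_on_subset[OF contz]) auto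
    then have "continuous_on {0<..<t} (\<lambda>s. (t - s) powr (1 - \<alpha>) *\<^sub>R second_deriv u s)"
      by (rule continuous_on_eq) (use t sd in auto)
    then have "(\<lambda>s. indicator {0<..<t} s *\<^sub>R ((t - s) powr (1 - \<alpha>) *\<^sub>R second_deriv u s)) \<in> borel_measurable borel"
      by (rule borel_measurable_continuous_on_indicator[rotated]) simp
    then show "(\<lambda>s. indicator {0<..<t} s *\<^sub>R ((t - s) powr (1 - \<alpha>) *\<^sub>R second_deriv u s)) \<in> borel_measurable lborel"
      by (simp only: measurable_lborel2)
    show "AE s in lborel. norm (indicator {0<..<t} s *\<^sub>R ((t - s) powr (1 - \<alpha>) *\<^sub>R second_deriv u s))
        \<le> norm (indicator {0<..<t} s *\<^sub>R (N * ((t - s) powr (1 - \<alpha>) * s powr (\<alpha> - 2))))"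
    proof (rule AE_I2)
      fix s
      show "norm (indicator {0<..<t} s *\<^sub>R ((t - s) powr (1 - \<alpha>) *\<^sub>R second_deriv u s))
        \<le> norm (indicator {0<..<t} s *\<^sub>R (N * ((t - s) powr (1 - \<alpha>) * s powr (\<alpha> - 2))))"
      proof (cases "s \<in> {0<..<t}")
        case True
        have "(t - s) powr (1 - \<alpha>) * norm (z s) \<le> (t - s) powr (1 - \<alpha>) * (N * s powr (\<alpha> - 2))"
          using True t by (intro mult_left_mono normz) auto
        also have "\<dots> \<le> \<bar>N * ((t - s) powr (1 - \<alpha>) * s powr (\<alpha> - 2))\<bar>" by (simp add: mult_ac)
        finally have "norm ((t - s) powr (1 - \<alpha>) *\<^sub>R z s) \<le> \<bar>N * ((t - s) powr (1 - \<alpha>) * s powr (\<alpha> - 2))\<bar>"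
          unfolding norm_scaleR abs_of_nonneg[OF powr_ge_zero] .
        moreover have "second_deriv u s = z s" using True t by (intro sd) auto
        ultimately show ?thesis using True by (simp only: indicator_simps scaleR_one real_norm_def)
      qed simp
    qed
  qed
  show "caputo_exists \<alpha> u t" if t: "t \<in> {0<..T}" for t
    unfolding caputo_exists_def
  proof (intro conjI ballI int t)
    fix s assume "s \<in> {0<..<t}"
    then have s: "s \<in> {0<..<T}" using t by auto
    show "u differentiable at s" using du'[OF s] by (rule differentiableI_vector)
    show "(\<lambda>r. vector_derivative u (at r)) differentiable at s" using dvdu[OF s] by (rule differentiableI_vector)
  qed
  show "caputo_deriv \<alpha> u t = (\<Sum>n. f n *\<^sub>R e n) - A (u t)" if t: "t \<in> {0<..T}" for t
  proof (rule eq_of_inner_e)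
    fix n
    have t0: "t > 0" "t \<in> {0..T}" using t by auto
    let ?I = "LBINT s:{0<..<t}. (t - s) powr (1 - \<alpha>) *\<^sub>R second_deriv u s"
    have "inner ?I (e n) = (LBINT s. inner (indicator {0<..<t} s *\<^sub>R ((t - s) powr (1 - \<alpha>) *\<^sub>R second_deriv u s)) (e n))"
      unfolding set_lebesgue_integral_def
      by (rule integral_inner_left[symmetric]) (use int[OF t] in \<open>simp add: set_integrable_def\<close>)
    also have "\<dots> = (LBINT s:{0<..<t}. (f n - a n * lam n) * ((t - s) powr (1 - \<alpha>) * ml_q (lam n) s)
        - b n * lam n * ((t - s) powr (1 - \<alpha>) * ml_p (lam n) s))"
      unfolding set_lebesgue_integral_def
    proof (rule Bochner_Integration.integral_cong[OF refl])
      fix s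
      show "inner (indicator {0<..<t} s *\<^sub>R ((t - s) powr (1 - \<alpha>) *\<^sub>R second_deriv u s)) (e n)
        = indicator {0<..<t} s *\<^sub>R ((f n - a n * lam n) * ((t - s) powr (1 - \<alpha>) * ml_q (lam n) s)
        - b n * lam n * ((t - s) powr (1 - \<alpha>) * ml_p (lam n) s))"
      proof (cases "s \<in> {0<..<t}")
        case True
        then have e1: "inner (second_deriv u s) (e n) = c2 n s" using sd[of s] inner_z[of s n] t by simp
        show ?thesis using True
          by (simp only: indicator_simps scaleR_one inner_scaleR_left e1) (simp add: c2_def algebra_simps)
      qed simp
    qed
    also have "\<dots> = (f n - a n * lam n) * (Gamma (2 - \<alpha>) * ml_c (lam n) t) - b n * lam n * (Gamma (2 - \<alpha>) * ml_s (lam n) t)"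
      by (subst set_integral_diff(2))
        (intro set_integrable_mult_right caputo_ml_q(1) caputo_ml_p(1) t0,
         intro set_integrable_mult_right caputo_ml_q(1) caputo_ml_p(1) t0,
         simp only: set_integral_mult_right caputo_ml_q(2)[OF t0(1)] caputo_ml_p(2)[OF t0(1)])
    finally have I: "inner ?I (e n) = Gamma (2 - \<alpha>) * ((f n - a n * lam n) * ml_c (lam n) t - b n * lam n * ml_s (lam n) t)"
      by (simp add: algebra_simps)
    have G: "Gamma (2 - \<alpha>) > 0" using \<alpha> by (intro Gamma_real_pos) auto
    have "inner (caputo_deriv \<alpha> u t) (e n) = (f n - a n * lam n) * ml_c (lam n) t - b n * lam n * ml_s (lam n) t"
      unfolding caputo_deriv_def using I G by simp
    also have "\<dots> = f n - lam n * c n t"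
      unfolding c_def ml_c_eq by (simp add: algebra_simps)
    also have "\<dots> = inner ((\<Sum>n. f n *\<^sub>R e n) - A (u t)) (e n)"
      unfolding inner_diff_left inner_suminf_e[OF sqf] Au[OF t0(2)] inner_suminf_e[OF sqc(2)[OF t0(2)]] ..
    finally show "inner (caputo_deriv \<alpha> u t) (e n) = inner ((\<Sum>n. f n *\<^sub>R e n) - A (u t)) (e n)" .
  qed
qed

text \<open>Each coefficient of an arbitrary solution solves the scalar equation, so
  \<open>caputo_scalar_unique\<close> expresses it by y(0), y'(0) and g_n, and the conditions at 0
  and T fix the first two. The condition at \<xi> is left for determining g.\<close>

lemma solution_coefficients:
  assumes sol: "is_solution D A \<alpha> T \<gamma> \<xi> \<phi> \<psi> h v g" and t: "t \<in> {0..T}"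
  shows "inner (v t) (e n) = P2 \<alpha> \<gamma> T (lam n) t * inner \<phi> (e n) + P3 \<alpha> \<gamma> T (lam n) t * inner \<psi> (e n)
      + Tri \<alpha> \<gamma> T (lam n) t * inner g (e n)"
proof -
  note s = sol[unfolded is_solution_def]
  define v' where "v' t = vector_derivative v (at t within {0..T})" for t
  define y where "y t = inner (v t) (e n)" for t
  define y1 where "y1 t = inner (v' t) (e n)" for t
  define y2 where "y2 t = inner (second_deriv v t) (e n)" for t
  define gn where "gn = inner g (e n)"
  let ?l = "lam n"
  have dv: "(v has_vector_derivative v' t) (at t within {0..T})" if "t \<in> {0..T}" for t
    using s that unfolding C1_on_closed_interval_def v'_def by (simp add: vector_derivative_works[symmetric])
  have dinner: "((\<lambda>t. inner (f t) (e n)) has_real_derivative inner f' (e n)) F"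
    if "(f has_vector_derivative f') F" for f f' F
    unfolding has_real_derivative_iff_has_vector_derivative
    by (rule bounded_linear.has_vector_derivative[OF bounded_linear_inner_left that])
  have dy: "(y has_real_derivative y1 t) (at t within {0..T})" if "t \<in> {0..T}" for t
    unfolding y_def y1_def by (rule dinner[OF dv[OF that]])
  have dy': "(y has_real_derivative y1 t) (at t)" if "t \<in> {0<..<T}" for t
    using dy[of t] that at_within_Icc_at[of 0 t T] by simp
  have vat: "vector_derivative v (at t) = v' t" if "t \<in> {0<..<T}" for t
    using dv[of t] that at_within_Icc_at[of 0 t T] by (simp add: vector_derivative_at)
  have ex: "caputo_exists \<alpha> v t" if "t \<in> {0<..T}" for t using s that by blast
  have dy1: "(y1 has_real_derivative y2 t) (at t)" if t: "t \<in> {0<..<T}" for t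
  proof -
    \<comment> \<open>Existence of the Caputo derivative at T contains twice differentiability on
      all of (0, T).\<close>
    have "(\<lambda>r. vector_derivative v (at r)) differentiable at t"
      using ex[of T] t T by (simp add: caputo_exists_def)
    then have "((\<lambda>r. vector_derivative v (at r)) has_vector_derivative second_deriv v t) (at t)"
      unfolding second_deriv_def by (simp add: vector_derivative_works[symmetric])
    then have "(v' has_vector_derivative second_deriv v t) (at t)"
      by (rule has_vector_derivative_transform_within_open[OF _ open_greaterThanLessThan t]) (simp add: vat)
    then show ?thesis unfolding y1_def y2_def by (rule dinner)
  qed
  have cont: "continuous_on {0..T} y" "continuous_on {0..T} y1"
  proof -
    show "continuous_on {0..T} y" using dy by (rule DERIV_continuous_on)
    have "continuous_on {0..T} v'" using s unfolding C1_on_closed_interval_def v'_def by simp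
    then show "continuous_on {0..T} y1" unfolding y1_def by (intro continuous_intros)
  qed
  have cap_int: "set_integrable lborel {0<..<t} (\<lambda>s. (t - s) powr (1 - \<alpha>) * y2 s)"
    and cap_val: "(LBINT s:{0<..<t}. (t - s) powr (1 - \<alpha>) * y2 s) = Gamma (2 - \<alpha>) * inner (caputo_deriv \<alpha> v t) (e n)"
    if t: "t \<in> {0<..T}" for t
  proof -
    have int: "integrable lborel (\<lambda>s. indicator {0<..<t} s *\<^sub>R ((t - s) powr (1 - \<alpha>) *\<^sub>R second_deriv v s))"
      using ex[OF t] by (simp add: caputo_exists_def set_integrable_def)
    have eq: "inner (indicator {0<..<t} s *\<^sub>R ((t - s) powr (1 - \<alpha>) *\<^sub>R second_deriv v s)) (e n)
        = indicator {0<..<t} s *\<^sub>R ((t - s) powr (1 - \<alpha>) * y2 s)" for s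
      by (simp add: y2_def)
    show "set_integrable lborel {0<..<t} (\<lambda>s. (t - s) powr (1 - \<alpha>) * y2 s)"
      using integrable_inner_left[of "e n" lborel, OF int] unfolding eq set_integrable_def by simp
    have G: "Gamma (2 - \<alpha>) > 0" using \<alpha> by (intro Gamma_real_pos) auto
    show "(LBINT s:{0<..<t}. (t - s) powr (1 - \<alpha>) * y2 s) = Gamma (2 - \<alpha>) * inner (caputo_deriv \<alpha> v t) (e n)"
      using integral_inner_left[of "e n" lborel, OF int] G unfolding eq
      by (simp add: caputo_deriv_def set_lebesgue_integral_def)
  qed
  \<comment> \<open>The kernel (t - s)^(1 - \<alpha>) is at least t^(1 - \<alpha>) on (0, t), so
    integrability of the Caputo integrand implies that of \<open>y2\<close>, which
    \<open>caputo_scalar_unique\<close> requires.\<close>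
  have y2_int: "set_integrable lborel {0<..<t} y2" if t: "t \<in> {0<..T}" for t
    unfolding set_integrable_def
  proof (rule Bochner_Integration.integrable_bound)
    let ?k = "\<lambda>s. indicator {0<..<t} s *\<^sub>R ((t - s) powr (1 - \<alpha>) * y2 s)"
    have k: "integrable lborel ?k" using cap_int[OF t] by (simp add: set_integrable_def)
    then show "integrable lborel (\<lambda>s. t powr (\<alpha> - 1) * ?k s)" by (rule integrable_mult_right)
    have [measurable]: "?k \<in> borel_measurable borel" using borel_measurable_integrable[OF k] by simp
    have "(\<lambda>s. (t - s) powr (\<alpha> - 1) * ?k s) \<in> borel_measurable lborel" by measurable
    moreover have e: "(t - s) powr (\<alpha> - 1) * ?k s = indicator {0<..<t} s *\<^sub>R y2 s" for s
    proof (cases "s \<in> {0<..<t}")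
      case True
      then have "(t - s) powr (\<alpha> - 1) * (t - s) powr (1 - \<alpha>) = 1" by (simp add: powr_add[symmetric])
      then show ?thesis using True by (simp add: mult.assoc[symmetric])
    qed simp
    ultimately show "(\<lambda>s. indicator {0<..<t} s *\<^sub>R y2 s) \<in> borel_measurable lborel" by (simp only:)
    show "AE s in lborel. norm (indicator {0<..<t} s *\<^sub>R y2 s) \<le> norm (t powr (\<alpha> - 1) * ?k s)"
    proof (rule AE_I2)
      fix s
      show "norm (indicator {0<..<t} s *\<^sub>R y2 s) \<le> norm (t powr (\<alpha> - 1) * ?k s)"
      proof (cases "s \<in> {0<..<t}")
        case True
        then have "(t - s) powr (\<alpha> - 1) \<le> t powr (\<alpha> - 1)" using \<alpha> by (intro powr_mono2) auto
        then show ?thesis unfolding e[symmetric] norm_mult by (intro mult_right_mono) auto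
      qed simp
    qed
  qed
  have cap_eq: "caputo_deriv \<alpha> v t + A (v t) = g" if "t \<in> {0<..<T}" for t using s that by blast
  have vD: "v t \<in> D" if "t \<in> {0..T}" for t using s that by blast
  have eqn: "(LBINT r:{0<..<t}. (t - r) powr (1 - \<alpha>) * y2 r) = Gamma (2 - \<alpha>) * (gn - ?l * y t)"
    if t: "t \<in> {0<..<T}" for t
  proof -
    have "caputo_deriv \<alpha> v t = g - A (v t)" using cap_eq[OF t] by (simp add: algebra_simps)
    then have "inner (caputo_deriv \<alpha> v t) (e n) = gn - ?l * y t"
      using inner_A_e[OF vD] t by (simp add: inner_diff_left gn_def y_def)
    then show ?thesis using cap_val[of t] t by simp
  qed
  \<comment> \<open>The scalar equation is needed only inside (0, t), so t = T is covered although
    the problem poses the equation for t < T.\<close>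
  have rep: "y t = y 0 * ml_c ?l t + y1 0 * ml_s ?l t + gn * ml_k ?l t" if t: "t \<in> {0..T}" for t
  proof (cases "t = 0")
    case False
    with t have t': "t \<in> {0<..T}" by simp
    show ?thesis
      by (rule caputo_scalar_unique)
        (use t' dy' dy1 eqn y2_int[OF t'] in \<open>auto intro: continuous_on_subset[OF cont(1)] continuous_on_subset[OF cont(2)]\<close>)
  qed simp
  have TT: "T \<in> {0..T}" using T by simp
  \<comment> \<open>The derivative at T is one-sided; the representation is differentiated within
    [0, T], and uniqueness of that derivative identifies it with \<open>y1 T\<close>.\<close>
  have y1T: "y1 T = - y 0 * ?l * ml_p ?l T + y1 0 * ml_c ?l T + gn * ml_p ?l T"
  proof -
    let ?r = "\<lambda>t. y 0 * ml_c ?l t + y1 0 * ml_s ?l t + gn * ml_k ?l t"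
    have "(?r has_real_derivative y 0 * (- ?l * ml_p ?l T) + y1 0 * ml_c ?l T + gn * ml_p ?l T) (at T within {0..})"
      using T by (intro DERIV_add DERIV_cmult ml_c_deriv ml_s_deriv ml_k_deriv) auto
    then have "(?r has_real_derivative y 0 * (- ?l * ml_p ?l T) + y1 0 * ml_c ?l T + gn * ml_p ?l T) (at T within {0..T})"
      by (rule DERIV_subset) auto
    then have "(y has_real_derivative y 0 * (- ?l * ml_p ?l T) + y1 0 * ml_c ?l T + gn * ml_p ?l T) (at T within {0..T})"
      by (rule has_field_derivative_transform_within[where d = 1]) (use TT in \<open>auto intro: rep[symmetric]\<close>)
    then have "vector_derivative y (at T within {0..T}) = y 0 * (- ?l * ml_p ?l T) + y1 0 * ml_c ?l T + gn * ml_p ?l T"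
      using vector_derivative_within_cbox[of 0 T T y] T
      by (simp add: has_real_derivative_iff_has_vector_derivative)
    moreover have "vector_derivative y (at T within {0..T}) = y1 T"
      using vector_derivative_within_cbox[of 0 T T y "y1 T"] T dy[OF TT]
      by (simp add: has_real_derivative_iff_has_vector_derivative)
    ultimately show ?thesis by simp
  qed
  have c1: "\<gamma> * y 0 + (y 0 * ml_c ?l T + y1 0 * ml_s ?l T + gn * ml_k ?l T) = inner \<phi> (e n)"
  proof -
    have "\<gamma> *\<^sub>R v 0 + v T = \<phi>" using s by blast
    then have "inner \<phi> (e n) = \<gamma> * y 0 + y T" by (auto simp: y_def inner_add_left)
    then show ?thesis using rep[OF TT] by simp
  qed
  have "vector_derivative v (at T within {0..T}) = \<psi>" using s by blast
  then have c2: "- y 0 * ?l * ml_p ?l T + y1 0 * ml_c ?l T + gn * ml_p ?l T = inner \<psi> (e n)"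
    using y1T by (simp add: y1_def v'_def)
  have "y 0 = nl_a \<gamma> T ?l (inner \<phi> (e n)) (inner \<psi> (e n)) gn \<and> y1 0 = nl_b \<gamma> T ?l (inner \<phi> (e n)) (inner \<psi> (e n)) gn"
    using nl_conditions_iff[OF det_nonzero[of n]] c1 c2 by blast
  then show ?thesis
    using rep[OF t] nl_solution_eq[OF T, of \<gamma> ?l "inner \<phi> (e n)" "inner \<psi> (e n)" gn t]
    by (simp add: y_def gn_def)
qed

end

context spectral_operator
begin

lemma power_domain_summable:
  assumes "g \<in> power_domain e lam \<sigma>"
  shows "summable (\<lambda>n. (lam n powr \<sigma> * \<bar>inner g (e n)\<bar>)\<^sup>2)"
proof -
  have "(lam n powr \<sigma> * \<bar>inner g (e n)\<bar>)\<^sup>2 = lam n powr (2 * \<sigma>) * (inner g (e n))\<^sup>2" for n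
    using powr_add[of "lam n" \<sigma> \<sigma>] by (simp add: power_mult_distrib power2_eq_square[of "lam n powr \<sigma>"])
  then show ?thesis using assms by (simp add: power_domain_def)
qed

lemma growth_of_summand:
  assumes "\<And>n. lam n powr x * \<bar>f n\<bar> \<le> w n"
  shows "growth (- x) w f"
proof (rule growthI[where K = 1])
  fix n
  have "lam n powr (- x) * (lam n powr x * \<bar>f n\<bar>) \<le> lam n powr (- x) * w n"
    using assms by (intro mult_left_mono) auto
  moreover have "lam n powr (- x) * lam n powr x = 1"
    using lam_pos[of n] by (simp add: powr_add[symmetric])
  ultimately show "\<bar>f n\<bar> \<le> 1 * (lam n powr (- x) * w n)"
    by (simp add: mult.assoc[symmetric])
qed

end

context inverse_problem
begin

end

theorem theorem3p1:
  fixes D :: "'a::{real_inner, banach, second_countable_topology} set"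
    and A :: "'a \<Rightarrow> 'a" and e :: "nat \<Rightarrow> 'a" and lam :: "nat \<Rightarrow> real"
    and \<alpha> T \<gamma> \<xi> :: real and \<phi> \<psi> h :: 'a
  assumes "self_adjoint D A" "positive_operator D A" "unbounded_operator D A"
    and "has_compact_inverse D A" and "eigensystem D A e lam"
    and "1 < \<alpha>" "\<alpha> < 2" "T > 0" "\<gamma> \<noteq> 0"
    and "T \<notin> Lambda_set \<alpha> \<gamma> lam"
    and "\<xi> \<in> {0<..<T}" "\<xi> \<notin> P1_set \<alpha> \<gamma> T lam"
    and "\<phi> \<in> power_domain e lam (2 - 1 / \<alpha>)" "\<psi> \<in> power_domain e lam (2 - 1 / \<alpha>)"
    and "h \<in> D"
  shows "\<exists>u f. is_solution D A \<alpha> T \<gamma> \<xi> \<phi> \<psi> h u f \<and>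
    (\<forall>v g. is_solution D A \<alpha> T \<gamma> \<xi> \<phi> \<psi> h v g \<longrightarrow> (\<forall>t\<in>{0..T}. v t = u t) \<and> g = f) \<and>
    (\<forall>t\<in>{0..T}. (\<lambda>n. (P2 \<alpha> \<gamma> T (lam n) t * inner \<phi> (e n) + P3 \<alpha> \<gamma> T (lam n) t * inner \<psi> (e n)
                       + Tri \<alpha> \<gamma> T (lam n) t * inner f (e n)) *\<^sub>R e n) sums u t) \<and>
    (\<lambda>n. (inner h (e n) - P2 \<alpha> \<gamma> T (lam n) \<xi> * inner \<phi> (e n)
           - P3 \<alpha> \<gamma> T (lam n) \<xi> * inner \<psi> (e n)) *\<^sub>R ((1 / Tri \<alpha> \<gamma> T (lam n) \<xi>) *\<^sub>R e n)) sums f"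
proof -
  interpret inverse_problem \<alpha> e D A lam T \<gamma> \<xi>
    by unfold_locales (use assms in \<open>auto simp: eigensystem_def\<close>)
  note \<phi> = assms(13) and \<psi> = assms(14) and h = assms(15)
  define p where "p n = inner \<phi> (e n)" for n
  define q where "q n = inner \<psi> (e n)" for n
  define hn where "hn n = inner h (e n)" for n
  \<comment> \<open>The condition u(\<xi>) = h, solved for the coefficient of f.\<close>
  define fn where "fn n = (hn n - P2 \<alpha> \<gamma> T (lam n) \<xi> * p n - P3 \<alpha> \<gamma> T (lam n) \<xi> * q n) * (1 / Tri \<alpha> \<gamma> T (lam n) \<xi>)" for n
  let ?L = "\<lambda>n. lam n powr (2 - 1 / \<alpha>)"
  \<comment> \<open>\<open>w0\<close> measures the data \<phi>, \<psi>, h and shows that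
    \<open>fn\<close> is square summable; \<open>w\<close> measures \<phi>, \<psi>, f as the data of
    the problem with known right-hand side.\<close>
  define w0 where "w0 n = ?L n * \<bar>p n\<bar> + ?L n * \<bar>q n\<bar> + lam n * \<bar>hn n\<bar>" for n
  define w where "w n = ?L n * \<bar>p n\<bar> + ?L n * \<bar>q n\<bar> + \<bar>fn n\<bar>" for n
  have sp: "summable (\<lambda>n. (?L n * \<bar>p n\<bar> + ?L n * \<bar>q n\<bar>)\<^sup>2)"
    unfolding p_def q_def by (intro summable_sq_add power_domain_summable \<phi> \<psi>)
  \<comment> \<open>For h in \<open>D\<close> the numbers lam n * h_n are the coefficients of A h,
    to which Bessel's inequality applies.\<close>
  have sh: "summable (\<lambda>n. (lam n * \<bar>hn n\<bar>)\<^sup>2)"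
    using bessel[of "A h"] by (simp add: inner_A_e[OF h] hn_def power_mult_distrib)
  have sw0: "summable (\<lambda>n. (w0 n)\<^sup>2)" unfolding w0_def by (intro summable_sq_add sp sh)
  have nn: "?L n * \<bar>p n\<bar> \<ge> 0" "?L n * \<bar>q n\<bar> \<ge> 0" "lam n * \<bar>hn n\<bar> \<ge> 0" for n
    using lam_pos[of n] by auto
  have \<alpha>': "1 / \<alpha> > 0" "1 / \<alpha> < 1" using \<alpha> by auto
  have g0: "growth (- (2 - 1 / \<alpha>)) w0 p" "growth (- (2 - 1 / \<alpha>)) w0 q" "growth (- 1) w0 hn"
  proof -
    show "growth (- (2 - 1 / \<alpha>)) w0 p"
      by (rule growth_of_summand) (use nn in \<open>simp add: w0_def add_increasing2\<close>)
    show "growth (- (2 - 1 / \<alpha>)) w0 q"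
      by (rule growth_of_summand) (use nn in \<open>simp add: w0_def add_increasing add_increasing2\<close>)
    show "growth (- 1) w0 hn"
      by (rule growth_of_summand) (use nn lam_pos in \<open>simp add: w0_def add_increasing less_imp_le\<close>)
  qed
  have g1: "growth (- 1) w0 p" "growth (- 1) w0 q"
    using growth_mono[OF g0(1), of "- 1"] growth_mono[OF g0(2), of "- 1"] \<alpha>' by simp_all
  \<comment> \<open>All three terms of the numerator have order -1, which
    \<open>order_Tri_\<xi>\<close> raises to 0. The factor \<open>P3\<close> of order 0 gains
    nothing for \<psi>, but 1/\<alpha> - 2 <= -1 is enough.\<close>
  have "growth (- 1) w0 (\<lambda>n. P2 \<alpha> \<gamma> T (lam n) \<xi> * p n)"
    by (rule growth_mono[OF growth_mult[OF order_P2_\<xi> g1(1) refl]]) simp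
  moreover have "growth (- 1) w0 (\<lambda>n. P3 \<alpha> \<gamma> T (lam n) \<xi> * q n)"
    by (rule growth_mult[OF order_P3_\<xi> g1(2)]) simp
  ultimately have "growth (- 1) w0 (\<lambda>n. hn n - P2 \<alpha> \<gamma> T (lam n) \<xi> * p n - P3 \<alpha> \<gamma> T (lam n) \<xi> * q n)"
    by (intro growth_diff g0(3))
  from growth_mult[OF order_Tri_\<xi> this, of 0]
  have "growth 0 w0 fn" by (simp add: fn_def[abs_def] mult.commute)
  then obtain K where "\<And>n. \<bar>fn n\<bar> \<le> K * (lam n powr 0 * w0 n)" unfolding growth_def by blast
  then have sf: "summable (\<lambda>n. (fn n)\<^sup>2)"
    by (intro summable_sq_bound[OF sw0, of _ K]) (use lam_pos in \<open>auto simp: less_imp_neq[symmetric]\<close>)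
  have sw: "summable (\<lambda>n. (w n)\<^sup>2)" unfolding w_def by (intro summable_sq_add sp) (use sf in simp)
  have w: "w n \<ge> 0" for n using nn(1,2)[of n] by (simp add: w_def)
  have gw: "growth (1 / \<alpha> - 2) w p" "growth (1 / \<alpha> - 2) w q" "growth 0 w fn"
  proof -
    have "growth (- (2 - 1 / \<alpha>)) w p"
      by (rule growth_of_summand) (use nn in \<open>simp add: w_def add_increasing2\<close>)
    then show "growth (1 / \<alpha> - 2) w p" by simp
    have "growth (- (2 - 1 / \<alpha>)) w q"
      by (rule growth_of_summand) (use nn in \<open>simp add: w_def add_increasing add_increasing2\<close>)
    then show "growth (1 / \<alpha> - 2) w q" by simp
    have "growth (- 0) w fn"
      by (rule growth_of_summand) (use nn lam_pos in \<open>simp add: w_def add_increasing less_imp_neq[symmetric]\<close>)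
    then show "growth 0 w fn" by simp
  qed
  define a where "a n = nl_a \<gamma> T (lam n) (p n) (q n) (fn n)" for n
  define b where "b n = nl_b \<gamma> T (lam n) (p n) (q n) (fn n)" for n
  have ga: "growth (- 1) w a" and gb: "growth (1 / \<alpha> - 1) w b"
    unfolding a_def[abs_def] b_def[abs_def] by (intro growth_nl_ab gw)+
  define c where "c n t = a n * ml_c (lam n) t + b n * ml_s (lam n) t + fn n * ml_k (lam n) t" for n t
  define u where "u t = (\<Sum>n. c n t *\<^sub>R e n)" for t
  define f where "f = (\<Sum>n. fn n *\<^sub>R e n)"
  note S = series_solution[OF ga gb gw(3) w sw, folded c_def, folded u_def, folded f_def]
  have c_eq: "c n t = P2 \<alpha> \<gamma> T (lam n) t * p n + P3 \<alpha> \<gamma> T (lam n) t * q n + Tri \<alpha> \<gamma> T (lam n) t * fn n" for n t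
    unfolding c_def a_def b_def by (rule nl_solution_eq[OF T])
  have inner_f: "inner f (e n) = fn n" for n unfolding f_def by (rule inner_suminf_e[OF sf])
  have cond: "\<gamma> * a n + (a n * ml_c (lam n) T + b n * ml_s (lam n) T + fn n * ml_k (lam n) T) = p n"
    "- a n * lam n * ml_p (lam n) T + b n * ml_c (lam n) T + fn n * ml_p (lam n) T = q n" for n
    using nl_conditions_iff[OF det_nonzero[of n], of "a n" "b n" "fn n" "p n" "q n"] by (simp_all add: a_def b_def)
  have T0: "0 \<in> {0..T}" "T \<in> {0..T}" "\<xi> \<in> {0..T}" using T \<xi> by auto
  have sol: "is_solution D A \<alpha> T \<gamma> \<xi> \<phi> \<psi> h u f"
    unfolding is_solution_def
  proof (intro conjI ballI S(1,3,4))
    show "continuous_on {0..T} (\<lambda>t. A (u t))" by (rule S(2))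
    then show cA: "continuous_on {0<..T} (\<lambda>t. A (u t))" by (rule continuous_on_subset) auto
    have "continuous_on {0<..T} (\<lambda>t. f - A (u t))" by (intro continuous_intros cA)
    then show "continuous_on {0<..T} (caputo_deriv \<alpha> u)"
      by (rule continuous_on_eq) (simp add: S(5))
    show "caputo_deriv \<alpha> u t + A (u t) = f" if "t \<in> {0<..<T}" for t
      using S(5)[of t] that by simp
    show "\<gamma> *\<^sub>R u 0 + u T = \<phi>"
      by (rule eq_of_inner_e) (use cond(1) in \<open>simp add: inner_add_left S(6)[OF T0(1)] S(6)[OF T0(2)] c_def p_def\<close>)
    show "vector_derivative u (at T within {0..T}) = \<psi>"
      by (rule eq_of_inner_e) (use cond(2) in \<open>simp add: S(7) q_def\<close>)
    show "u \<xi> = h"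
    proof (rule eq_of_inner_e)
      fix n
      have "Tri \<alpha> \<gamma> T (lam n) \<xi> * fn n = hn n - P2 \<alpha> \<gamma> T (lam n) \<xi> * p n - P3 \<alpha> \<gamma> T (lam n) \<xi> * q n"
        using Tri_nonzero[of n] by (simp add: fn_def)
      then show "inner (u \<xi>) (e n) = inner h (e n)"
        unfolding S(6)[OF T0(3)] c_eq by (simp add: hn_def)
    qed
  qed
  have uniq: "(\<forall>t\<in>{0..T}. v t = u t) \<and> g = f" if v: "is_solution D A \<alpha> T \<gamma> \<xi> \<phi> \<psi> h v g" for v g
  proof -
    have gf: "inner g (e n) = fn n" for n
    proof -
      have "v \<xi> = h" using v by (simp add: is_solution_def)
      then have "hn n = P2 \<alpha> \<gamma> T (lam n) \<xi> * p n + P3 \<alpha> \<gamma> T (lam n) \<xi> * q n + Tri \<alpha> \<gamma> T (lam n) \<xi> * inner g (e n)"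
        using solution_coefficients[OF v T0(3), of n] by (simp add: hn_def p_def q_def)
      then show ?thesis using Tri_nonzero[of n] by (simp add: fn_def)
    qed
    have "g = f" by (rule eq_of_inner_e) (simp add: gf inner_f)
    moreover have "v t = u t" if t: "t \<in> {0..T}" for t
      by (rule eq_of_inner_e)
        (simp only: solution_coefficients[OF v t] S(6)[OF t] c_eq gf p_def q_def)
    ultimately show ?thesis by blast
  qed
  have usum: "(\<lambda>n. (P2 \<alpha> \<gamma> T (lam n) t * inner \<phi> (e n) + P3 \<alpha> \<gamma> T (lam n) t * inner \<psi> (e n)
      + Tri \<alpha> \<gamma> T (lam n) t * inner f (e n)) *\<^sub>R e n) sums u t" if t: "t \<in> {0..T}" for t
    using expansion[of "u t"] by (simp only: S(6)[OF t] c_eq inner_f p_def q_def)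
  have "(\<lambda>n. fn n *\<^sub>R e n) sums f" unfolding f_def by (intro summable_sums summable_e sf)
  then have fsum: "(\<lambda>n. (inner h (e n) - P2 \<alpha> \<gamma> T (lam n) \<xi> * inner \<phi> (e n)
      - P3 \<alpha> \<gamma> T (lam n) \<xi> * inner \<psi> (e n)) *\<^sub>R ((1 / Tri \<alpha> \<gamma> T (lam n) \<xi>) *\<^sub>R e n)) sums f"
    by (simp only: fn_def hn_def p_def q_def scaleR_scaleR)
  from sol uniq usum fsum show ?thesis by blast
qed

end
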